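(* Let $\Gamma$ be a connected, locally finite graph of infinite rank. Then for every $n\in\mathbb N$, $\mathrm{PMap}(\Gamma)$ contains a subgroup isomorphic to the wreath product $\mathrm{Aut}(F_n)\wr\mathbb Z=\big(\bigoplus_{\mathbb Z}\mathrm{Aut}(F_n)\big)\rtimes\mathbb Z$, where $\mathbb Z$ acts by shifting indices. In particular $\mathrm{PMap}(\Gamma)$ contains $\mathbb Z\wr\mathbb Z$.
   Context: The rank of $\Gamma$ is the rank of $\pi_1(\Gamma)$. $\mathrm{Map}(\Gamma)$ is the group of proper homotopy classes of proper homotopy equivalences $\Gamma\to\Gamma$; it acts by homeomorphisms on the end space $E(\Gamma)$ and on the subspace $E_\ell(\Gamma)$ of ends accumulated by loops, and $\mathrm{PMap}(\Gamma)$ is the kernel of this action. $F_n$ is the free group of rank $n$. *)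

theory Defs
  imports "HOL-Analysis.Analysis" "HOL-Algebra.Algebra"
begin

text \<open>A graph is given by a vertex set V, an edge set Ed and endpoint maps src, tgt
  (loops and multiple edges allowed).  Points of the realization are vertices Inl v
  and interior points Inr (e,t) of edges, 0 < t < 1.\<close>

definition gpt :: "('e \<Rightarrow> 'v) \<Rightarrow> ('e \<Rightarrow> 'v) \<Rightarrow> 'e \<Rightarrow> real \<Rightarrow> 'v + 'e \<times> real" where
  "gpt src tgt e t = (if t = 0 then Inl (src e) else if t = 1 then Inl (tgt e) else Inr (e, t))"

definition gcarrier :: "'v set \<Rightarrow> 'e set \<Rightarrow> ('v + 'e \<times> real) set" where
  "gcarrier V Ed = Inl ` V \<union> {Inr (e, t) | e t. e \<in> Ed \<and> 0 < t \<and> t < 1}"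

definition gopen :: "'v set \<Rightarrow> 'e set \<Rightarrow> ('e \<Rightarrow> 'v) \<Rightarrow> ('e \<Rightarrow> 'v) \<Rightarrow> ('v + 'e \<times> real) set \<Rightarrow> bool" where
  "gopen V Ed src tgt U \<longleftrightarrow> U \<subseteq> gcarrier V Ed \<and>
     (\<forall>e\<in>Ed. openin (top_of_set {0..1}) {t \<in> {0..1}. gpt src tgt e t \<in> U})"

lemma istopology_gopen: "istopology (gopen V Ed src tgt)"
proof -
  have "gopen V Ed src tgt (S \<inter> T)" if "gopen V Ed src tgt S" "gopen V Ed src tgt T" for S T
  proof -
    have eq: "{t \<in> {0..1}. gpt src tgt e t \<in> S \<inter> T} =
      {t \<in> {0..1}. gpt src tgt e t \<in> S} \<inter> {t \<in> {0..1}. gpt src tgt e t \<in> T}" for e by auto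
    show ?thesis using that unfolding gopen_def eq by (auto intro: openin_Int)
  qed
  moreover have "gopen V Ed src tgt (\<Union>K)" if "\<forall>S\<in>K. gopen V Ed src tgt S" for K
  proof -
    have eq: "{t \<in> {0..1}. gpt src tgt e t \<in> \<Union>K} =
      \<Union>((\<lambda>S. {t \<in> {0..1}. gpt src tgt e t \<in> S}) ` K)" for e by auto
    show ?thesis using that unfolding gopen_def eq by (auto intro!: openin_Union)
  qed
  ultimately show ?thesis unfolding istopology_def by blast
qed

text \<open>The realization with its CW (weak) topology.\<close>
definition graph_top :: "'v set \<Rightarrow> 'e set \<Rightarrow> ('e \<Rightarrow> 'v) \<Rightarrow> ('e \<Rightarrow> 'v) \<Rightarrow> ('v + 'e \<times> real) topology" where
  "graph_top V Ed src tgt = topology (gopen V Ed src tgt)"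

definition is_graph :: "'v set \<Rightarrow> 'e set \<Rightarrow> ('e \<Rightarrow> 'v) \<Rightarrow> ('e \<Rightarrow> 'v) \<Rightarrow> bool" where
  "is_graph V Ed src tgt \<longleftrightarrow> src ` Ed \<subseteq> V \<and> tgt ` Ed \<subseteq> V"

definition locally_finite_graph :: "'v set \<Rightarrow> 'e set \<Rightarrow> ('e \<Rightarrow> 'v) \<Rightarrow> ('e \<Rightarrow> 'v) \<Rightarrow> bool" where
  "locally_finite_graph V Ed src tgt \<longleftrightarrow> (\<forall>v\<in>V. finite {e \<in> Ed. src e = v \<or> tgt e = v})"

definition pconcat :: "(real \<Rightarrow> 'a) \<Rightarrow> (real \<Rightarrow> 'a) \<Rightarrow> real \<Rightarrow> 'a" where
  "pconcat p q = (\<lambda>s. if s \<le> 1/2 then p (2 * s) else q (2 * s - 1))"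

definition loop_at :: "'a topology \<Rightarrow> 'a \<Rightarrow> (real \<Rightarrow> 'a) \<Rightarrow> bool" where
  "loop_at T x0 g \<longleftrightarrow> pathin T g \<and> g 0 = x0 \<and> g 1 = x0"

definition loop_htpy :: "'a topology \<Rightarrow> 'a \<Rightarrow> (real \<Rightarrow> 'a) \<Rightarrow> (real \<Rightarrow> 'a) \<Rightarrow> bool" where
  "loop_htpy T x0 p q \<longleftrightarrow>
     homotopic_with (\<lambda>h. h 0 = x0 \<and> h 1 = x0) (top_of_set {0..1}) T p q"

definition loop_class :: "'a topology \<Rightarrow> 'a \<Rightarrow> (real \<Rightarrow> 'a) \<Rightarrow> (real \<Rightarrow> 'a) set" where
  "loop_class T x0 p = {q. loop_at T x0 q \<and> loop_htpy T x0 p q}"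

definition fundamental_group :: "'a topology \<Rightarrow> 'a \<Rightarrow> (real \<Rightarrow> 'a) set monoid" where
  "fundamental_group T x0 =
    \<lparr>carrier = {loop_class T x0 p | p. loop_at T x0 p},
     monoid.mult = (\<lambda>A B. loop_class T x0 (pconcat (SOME p. p \<in> A) (SOME q. q \<in> B))),
     one = loop_class T x0 (\<lambda>s. x0)\<rparr>"

definition infinite_rank :: "('a, 'b) monoid_scheme \<Rightarrow> bool" where
  "infinite_rank G \<longleftrightarrow> \<not> (\<exists>S. finite S \<and> S \<subseteq> carrier G \<and> generate G S = carrier G)"

definition proper_cmap :: "'a topology \<Rightarrow> 'b topology \<Rightarrow> ('a \<Rightarrow> 'b) \<Rightarrow> bool" where
  "proper_cmap T Y f \<longleftrightarrow> continuous_map T Y f \<and>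
     (\<forall>K. compactin Y K \<longrightarrow> compactin T {x \<in> topspace T. f x \<in> K})"

definition proper_homotopic :: "'a topology \<Rightarrow> ('a \<Rightarrow> 'a) \<Rightarrow> ('a \<Rightarrow> 'a) \<Rightarrow> bool" where
  "proper_homotopic T f g \<longleftrightarrow>
     (\<exists>H. proper_cmap (prod_topology (top_of_set {0..1::real}) T) T H \<and>
          (\<forall>x. H (0, x) = f x) \<and> (\<forall>x. H (1, x) = g x))"

definition proper_htpy_equiv :: "'a topology \<Rightarrow> ('a \<Rightarrow> 'a) \<Rightarrow> bool" where
  "proper_htpy_equiv T f \<longleftrightarrow> proper_cmap T T f \<and>
     (\<exists>g. proper_cmap T T g \<and> proper_homotopic T (g \<circ> f) id \<and> proper_homotopic T (f \<circ> g) id)"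

definition phe_class :: "'a topology \<Rightarrow> ('a \<Rightarrow> 'a) \<Rightarrow> ('a \<Rightarrow> 'a) set" where
  "phe_class T f = {g. proper_cmap T T g \<and> proper_homotopic T f g}"

definition MapGrp :: "'a topology \<Rightarrow> ('a \<Rightarrow> 'a) set monoid" where
  "MapGrp T =
    \<lparr>carrier = {phe_class T f | f. proper_htpy_equiv T f},
     monoid.mult = (\<lambda>A B. phe_class T ((SOME a. a \<in> A) \<circ> (SOME b. b \<in> B))),
     one = phe_class T id\<rparr>"

definition compl_components :: "'a topology \<Rightarrow> 'a set \<Rightarrow> 'a set set" where
  "compl_components T K = connected_components_of (subtopology T (topspace T - K))"

definition Ends :: "'a topology \<Rightarrow> ('a set \<Rightarrow> 'a set) set" where
  "Ends T = {\<epsilon>. (\<forall>K. compactin T K \<longrightarrow> \<epsilon> K \<in> compl_components T K) \<and>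
                (\<forall>K. \<not> compactin T K \<longrightarrow> \<epsilon> K = {}) \<and>
                (\<forall>K L. compactin T K \<longrightarrow> compactin T L \<longrightarrow> K \<subseteq> L \<longrightarrow> \<epsilon> L \<subseteq> \<epsilon> K)}"

definition end_act :: "'a topology \<Rightarrow> ('a \<Rightarrow> 'a) \<Rightarrow> ('a set \<Rightarrow> 'a set) \<Rightarrow> ('a set \<Rightarrow> 'a set)" where
  "end_act T f \<epsilon> = (\<lambda>K. if compactin T K then
       (THE C. C \<in> compl_components T K \<and> (\<exists>L. compactin T L \<and> f ` \<epsilon> L \<subseteq> C))
     else {})"

definition PMapGrp :: "'a topology \<Rightarrow> ('a \<Rightarrow> 'a) set monoid" where
  "PMapGrp T = MapGrp T \<lparr>carrier :=
     {A \<in> carrier (MapGrp T). \<forall>f\<in>A. \<forall>\<epsilon>\<in>Ends T. end_act T f \<epsilon> = \<epsilon>}\<rparr>"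

text \<open>Words over letters (i, b), i < n, b = True meaning the inverse generator.\<close>
fun freduce :: "(nat \<times> bool) list \<Rightarrow> (nat \<times> bool) list" where
  "freduce [] = []"
| "freduce (x # xs) = (case freduce xs of [] \<Rightarrow> [x]
     | y # ys \<Rightarrow> (if fst x = fst y \<and> snd x \<noteq> snd y then ys else x # y # ys))"

definition free_group :: "nat \<Rightarrow> (nat \<times> bool) list monoid" where
  "free_group n = \<lparr>carrier = {w. freduce w = w \<and> (\<forall>x\<in>set w. fst x < n)},
     monoid.mult = (\<lambda>v w. freduce (v @ w)), one = []\<rparr>"

definition wreathZ :: "('a, 'b) monoid_scheme \<Rightarrow> ((int \<Rightarrow> 'a) \<times> int) monoid" where
  "wreathZ A = \<lparr>carrier = {(f, k). (\<forall>i. f i \<in> carrier A) \<and> finite {i. f i \<noteq> \<one>\<^bsub>A\<^esub>}},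
     monoid.mult = (\<lambda>(f, k) (g, l). (\<lambda>i. f i \<otimes>\<^bsub>A\<^esub> g (i - k), k + l)),
     one = (\<lambda>i. \<one>\<^bsub>A\<^esub>, 0)\<rparr>"

end

theory Submission
  imports Defs "HOL-Library.Diagonal_Subsequence" "HOL-Library.Nat_Bijection"
begin

text \<open>A spanning tree of the graph, built from breadth-first parents, identifies the fundamental group at
  \<open>x0\<close> with the free group on the non-tree edges, of which there must be infinitely many.  A map that fixes
  the vertices and sends every edge \<open>e\<close> along an edge path \<open>P e\<close> with the same endpoints is proper as soon
  as every edge lies on finitely many of these paths, and it then fixes all ends.  Up to proper homotopy it
  depends only on the free reductions of the \<open>P e\<close>, so composition becomes substitution of words.

  Choose non-tree edges \<open>io i m\<close> (\<open>i\<close> natural, \<open>m\<close> an integer) both of whose endpoints converge in the end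
  compactification of the tree.  The wreath product permutes the blocks \<open>{io i m. i < N}\<close> and acts on each of
  them by automorphisms of a free group; the shift is proper because the reduced tree path between endpoints
  of distant edges leaves every finite subgraph.  The action is faithful on mapping classes: a trivial class
  acts on the fundamental group by conjugation with some word, and that word commutes with infinitely many
  fixed generators, hence is empty.\<close>

section \<open>Free words\<close>

text \<open>The homotopies that define mapping classes are free: one from a given map to the
  identity may move the basepoint around a loop, so triviality is visible on loops only up to
  conjugation. All calculations are made with words: \<open>feq\<close> compares reduced forms, and
  two facts translate, namely that freely equal edge paths are homotopic inside the subgraph of
  their letters, and, by a covering whose fibre is the free group, that homotopic edge paths are
  freely equal. The confinement to the letters is what keeps infinitely many simultaneous homotopies
  proper. Convergence enters as follows. Moving a non-tree edge creates tree segments between old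
  and new endpoints, and a tree edge \<open>d\<close> lies on such a segment only if it lies on
  exactly one of the tree paths from the root to its two ends. If \<open>d\<close> lies on almost
  all or almost none of the tree paths, a fixed shift meets this case finitely often. Automorphism
  groups and the integers are treated together through \<open>letter_action\<close>: the integers
  act on two letters by the transvections \<open>a -> a b^k\<close>.\<close>

definition linv :: "'x \<times> bool \<Rightarrow> 'x \<times> bool" where
  "linv a = (fst a, \<not> snd a)"

text \<open>Left multiplication by a letter on reduced words. Reduced forms arise by letting a word
  act on \<open>[]\<close>, so associativity comes from composition of functions (van der Waerden's
  trick).\<close>

definition push :: "'x \<times> bool \<Rightarrow> ('x \<times> bool) list \<Rightarrow> ('x \<times> bool) list" where
  "push a w = (case w of [] \<Rightarrow> [a] | b # v \<Rightarrow> if b = linv a then v else a # w)"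

definition fred :: "('x \<times> bool) list \<Rightarrow> ('x \<times> bool) list" where
  "fred w = foldr push w []"

abbreviation isred :: "('x \<times> bool) list \<Rightarrow> bool" where
  "isred \<equiv> successively (\<lambda>a b. b \<noteq> linv a)"

definition feq :: "('x \<times> bool) list \<Rightarrow> ('x \<times> bool) list \<Rightarrow> bool" where
  "feq u v \<longleftrightarrow> fred u = fred v"

definition winv :: "('x \<times> bool) list \<Rightarrow> ('x \<times> bool) list" where
  "winv w = rev (map linv w)"

text \<open>The images are concatenated without reduction, so \<open>sub_sub\<close> and
  \<open>sub_winv\<close> are equations of lists, and free reduction enters only through
  \<open>feq\<close>.\<close>

definition sub :: "('x \<Rightarrow> ('y \<times> bool) list) \<Rightarrow> ('x \<times> bool) list \<Rightarrow> ('y \<times> bool) list" where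
  "sub \<sigma> w = concat (map (\<lambda>a. if snd a then winv (\<sigma> (fst a)) else \<sigma> (fst a)) w)"

lemma linv_linv [simp]: "linv (linv a) = a"
  by (simp add: linv_def)

lemma linv_eq_iff: "b = linv a \<longleftrightarrow> a = linv b"
  by (metis linv_linv)

lemma linv_neq [simp]: "linv a \<noteq> a" "a \<noteq> linv a"
  by (auto simp: linv_def prod_eq_iff)

lemma fst_linv [simp]: "fst (linv a) = fst a" and snd_linv [simp]: "snd (linv a) = (\<not> snd a)"
  by (simp_all add: linv_def)

lemma fred_simps [simp]: "fred [] = []" "fred (a # w) = push a (fred w)"
  by (simp_all add: fred_def)

lemma freduce_eq_fred: "freduce w = fred w"
proof (induction w)
  case (Cons a w)
  have *: "b = linv a \<longleftrightarrow> fst a = fst b \<and> snd a \<noteq> snd b" for b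
    by (cases a; cases b) (auto simp: linv_def)
  show ?case
    by (cases "fred w") (simp_all add: Cons push_def *)
qed simp

lemma isred_push: "isred w \<Longrightarrow> isred (push a w)"
  by (auto simp: push_def successively_Cons split: list.split)

lemma isred_foldr_push: "isred z \<Longrightarrow> isred (foldr push w z)"
  by (induction w) (auto intro: isred_push)

lemma isred_fred: "isred (fred w)"
  unfolding fred_def by (rule isred_foldr_push) simp

lemma fred_id: "isred w \<Longrightarrow> fred w = w"
  by (induction w) (auto simp: successively_Cons push_def split: list.split)

lemma fred_fred [simp]: "fred (fred w) = fred w"
  by (simp add: fred_id isred_fred)

text \<open>Reducedness makes \<open>push a\<close> invertible: if it cancels a head
  \<open>linv a\<close>, the next letter is not \<open>a\<close>, so pushing \<open>linv a\<close>
  puts the head back.\<close>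

lemma push_linv: assumes "isred w" shows "push (linv a) (push a w) = w"
proof (cases w)
  case (Cons b v)
  with assms show ?thesis
    by (cases v) (auto simp: push_def successively_Cons linv_eq_iff)
qed (simp add: push_def)

lemma push_linv': "isred w \<Longrightarrow> push a (push (linv a) w) = w"
  using push_linv [of w "linv a"] by simp

lemma fred_append: "fred (u @ v) = foldr push u (fred v)"
  by (simp add: fred_def)

text \<open>A cancellation in \<open>push a w\<close> removes a letter \<open>linv a\<close> whose
  action is undone by that of \<open>a\<close>; reducing a prefix therefore does not change how it
  acts.\<close>

lemma foldr_push_push: assumes "isred z" shows "foldr push (push a w) z = push a (foldr push w z)"
proof (cases w)
  case (Cons b v)
  then show ?thesis
    using push_linv'[OF isred_foldr_push[OF assms], of a v] by (auto simp: push_def)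
qed (simp add: push_def)

lemma foldr_push_fred: "isred z \<Longrightarrow> foldr push (fred u) z = foldr push u z"
  by (induction u) (auto simp: foldr_push_push)

lemma fred_append_fred: "fred (fred u @ fred v) = fred (u @ v)"
  by (simp add: fred_append foldr_push_fred isred_fred)

lemma feq_refl [simp]: "feq u u"
  by (simp add: feq_def)

lemma feq_sym: "feq u v \<Longrightarrow> feq v u"
  by (simp add: feq_def)

lemma feq_trans [trans]: "feq u v \<Longrightarrow> feq v w \<Longrightarrow> feq u w"
  by (simp add: feq_def)

lemma feq_fred [simp]: "feq (fred u) u" "feq u (fred u)"
  by (simp_all add: feq_def)

lemma feq_append: "feq u u' \<Longrightarrow> feq v v' \<Longrightarrow> feq (u @ v) (u' @ v')"
  unfolding feq_def by (metis fred_append_fred)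

lemma winv_simps [simp]: "winv [] = []" "winv (a # w) = winv w @ [linv a]"
    "winv (u @ v) = winv v @ winv u"
  by (simp_all add: winv_def)

lemma winv_winv [simp]: "winv (winv w) = w"
  by (simp add: winv_def rev_map comp_def)

lemma set_winv: "set (winv w) = linv ` set w"
  by (simp add: winv_def)

lemma fst_set_winv [simp]: "fst ` set (winv w) = fst ` set w"
  by (simp add: set_winv image_image)

lemma feq_cancel2: "feq (u @ a # linv a # v) (u @ v)"
  by (simp add: feq_def fred_append push_linv' isred_fred)

lemma feq_cancel_winv: "feq (u @ w @ winv w @ v) (u @ v)"
proof (induction w arbitrary: u v)
  case (Cons a w)
  have "feq ((u @ [a]) @ w @ winv w @ (linv a # v)) ((u @ [a]) @ (linv a # v))"
    by (rule Cons)
  also have "feq \<dots> (u @ v)"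
    using feq_cancel2[of u a v] by simp
  finally show ?case by simp
qed simp

lemma feq_winv_right [simp]: "feq (w @ winv w) []"
  using feq_cancel_winv[of "[]" w "[]"] by simp

lemma feq_winv_left [simp]: "feq (winv w @ w) []"
  using feq_winv_right[of "winv w"] by simp

lemma feq_cancel_winv': "feq (u @ winv w @ w @ v) (u @ v)"
  using feq_cancel_winv[of u "winv w" v] by simp

text \<open>Uniqueness of inverses: \<open>v @ winv v\<close> is inserted, its \<open>v\<close> is
  replaced by \<open>u\<close>, and \<open>winv u @ u\<close> cancels.\<close>

lemma feq_winv: assumes "feq u v" shows "feq (winv u) (winv v)"
proof -
  have "feq (winv u) (winv u @ v @ winv v)"
    using feq_sym[OF feq_cancel_winv[of "winv u" v "[]"]] by simp
  also have "feq \<dots> (winv u @ u @ winv v)"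
    by (intro feq_append feq_refl feq_sym[OF assms])
  also have "feq \<dots> (winv v)"
    using feq_cancel_winv'[of "[]" u "winv v"] by simp
  finally show ?thesis .
qed

lemma set_fred: "set (fred w) \<subseteq> set w"
proof (induction w)
  case (Cons a w)
  have "set (push a v) \<subseteq> insert a (set v)" for v
    by (auto simp: push_def split: list.split if_splits)
  with Cons show ?case by fastforce
qed simp

lemma sub_simps [simp]: "sub \<sigma> [] = []" "sub \<sigma> (u @ v) = sub \<sigma> u @ sub \<sigma> v"
   "sub \<sigma> (a # v) = (if snd a then winv (\<sigma> (fst a)) else \<sigma> (fst a)) @ sub \<sigma> v"
  by (simp_all add: sub_def)

lemma sub_winv: "sub \<sigma> (winv w) = winv (sub \<sigma> w)"
  by (induction w) auto

lemma feq_sub_fred: "feq (sub \<sigma> (fred w)) (sub \<sigma> w)"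
proof (induction w)
  case (Cons a w)
  have "feq (sub \<sigma> (push a v)) (sub \<sigma> (a # v))" for v
  proof (cases "\<exists>v'. v = linv a # v'")
    case True
    then obtain v' where v: "v = linv a # v'" by blast
    show ?thesis
      using feq_sym[OF feq_cancel_winv[of "[]" "\<sigma> (fst a)" "sub \<sigma> v'"]]
            feq_sym[OF feq_cancel_winv'[of "[]" "\<sigma> (fst a)" "sub \<sigma> v'"]]
      by (auto simp: v push_def)
  next
    case False
    then have "push a v = a # v" by (auto simp: push_def split: list.split)
    then show ?thesis by simp
  qed
  also have "feq (sub \<sigma> (a # fred w)) (sub \<sigma> (a # w))"
    using Cons by (auto intro: feq_append)
  finally show ?case by simp
qed simp

lemma feq_sub: assumes "feq u v" shows "feq (sub \<sigma> u) (sub \<sigma> v)"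
  using feq_sub_fred[of \<sigma> u] feq_sub_fred[of \<sigma> v] assms unfolding feq_def by metis

lemma sub_sub: "sub \<sigma> (sub \<rho> w) = sub (\<lambda>x. sub \<sigma> (\<rho> x)) w"
  by (induction w) (auto simp: sub_winv)

lemma feq_sub_cong:
  assumes "\<And>x. x \<in> fst ` set w \<Longrightarrow> feq (\<sigma> x) (\<rho> x)"
  shows "feq (sub \<sigma> w) (sub \<rho> w)"
  using assms by (induction w) (auto intro!: feq_append feq_winv)

lemma sub_cong:
  assumes "\<And>x. x \<in> fst ` set w \<Longrightarrow> \<sigma> x = \<rho> x"
  shows "sub \<sigma> w = sub \<rho> w"
  using assms by (induction w) auto

lemma sub_single: "sub (\<lambda>x. [(x, False)]) w = w"
  by (induction w) (auto simp: linv_def prod_eq_iff)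

lemma letters_sub: "fst ` set (sub \<sigma> w) = (\<Union>x\<in>fst ` set w. fst ` set (\<sigma> x))"
  by (induction w) (auto simp: image_Un)

lemma letters_fred: "fst ` set (fred w) \<subseteq> fst ` set w"
  using set_fred by fast

text \<open>Used for the covering: a lift multiplies letters from the left and so ends at the
  reduction of the reversed word.\<close>

lemma feq_rev: assumes "feq u v" shows "feq (rev u) (rev v)"
proof -
  have *: "feq (rev (fred w)) (rev w)" for w :: "('a \<times> bool) list"
  proof (induction w)
    case (Cons a w)
    have "feq (rev (push a v)) (rev v @ [a])" for v
    proof (cases "\<exists>v'. v = linv a # v'")
      case True
      then obtain v' where v: "v = linv a # v'" by blast
      show ?thesis
        using feq_sym[OF feq_cancel2[of "rev v'" "linv a" "[]"]] by (auto simp: v push_def)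
    next
      case False
      then have "push a v = a # v" by (auto simp: push_def split: list.split)
      then show ?thesis by simp
    qed
    also have "feq (rev (fred w) @ [a]) (rev w @ [a])"
      by (intro feq_append Cons feq_refl)
    finally show ?case by simp
  qed simp
  show ?thesis using *[of u] *[of v] assms unfolding feq_def by metis
qed

lemma fred_append_singleton:
  assumes "isred w" "w \<noteq> []" "last w \<noteq> linv a"
  shows "isred (w @ [a])"
  using assms by (auto simp: successively_append_iff linv_eq_iff)

text \<open>Since \<open>x\<close> does not occur in \<open>w\<close>, both sides are already
  reduced and agree letter by letter; a nonempty \<open>w\<close> would then begin with
  \<open>x\<close>.\<close>

lemma feq_commute_letter_Nil:
  assumes "feq (w @ [(x, False)]) ((x, False) # w)" "x \<notin> fst ` set w" "isred w"
  shows "w = []"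
proof (rule ccontr)
  assume "w \<noteq> []"
  have "last w \<noteq> linv (x, False)" "hd w \<noteq> linv (x, False)"
    using assms(2) \<open>w \<noteq> []\<close> last_in_set[of w] hd_in_set[of w] by (force simp: linv_def)+
  then have "isred (w @ [(x, False)])" "isred ((x, False) # w)"
    using fred_append_singleton assms \<open>w \<noteq> []\<close> by (auto simp: successively_Cons)
  with assms(1) have "w @ [(x, False)] = (x, False) # w"
    by (metis feq_def fred_id)
  with \<open>w \<noteq> []\<close> have "(x, False) \<in> set w"
    by (metis append_eq_Cons_conv hd_in_set list.sel(1))
  with assms(2) show False by force
qed

section \<open>Paths up to homotopy in abstract topologies\<close>

definition phtpy :: "'a topology \<Rightarrow> 'a \<Rightarrow> 'a \<Rightarrow> (real \<Rightarrow> 'a) \<Rightarrow> (real \<Rightarrow> 'a) \<Rightarrow> bool" where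
  "phtpy T a b = homotopic_with (\<lambda>h. h 0 = a \<and> h 1 = b) (top_of_set {0..1}) T"

lemma phtpy_refl: "pathin T p \<Longrightarrow> phtpy T (p 0) (p 1) p p"
  by (simp add: phtpy_def pathin_def)

lemma phtpy_sym: "phtpy T a b p q \<Longrightarrow> phtpy T a b q p"
  unfolding phtpy_def by (rule homotopic_with_symD)

lemma phtpy_trans [trans]: "phtpy T a b p q \<Longrightarrow> phtpy T a b q r \<Longrightarrow> phtpy T a b p r"
  unfolding phtpy_def by (rule homotopic_with_trans)

lemma phtpyD:
  assumes "phtpy T a b p q"
  shows "pathin T p" "pathin T q" "p 0 = a" "q 0 = a" "p 1 = b" "q 1 = b"
  using homotopic_with_imp_continuous_maps [OF assms[unfolded phtpy_def]]
    homotopic_with_imp_property [OF assms[unfolded phtpy_def]] by (auto simp: pathin_def)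

lemma phtpy_equal:
  assumes "pathin T p" "\<And>t. t \<in> {0..1} \<Longrightarrow> q t = p t" "p 0 = a" "p 1 = b"
  shows "phtpy T a b q p"
proof -
  have "phtpy T a b p q"
    unfolding phtpy_def using assms by (intro homotopic_with_equal) (auto simp: pathin_def)
  then show ?thesis by (rule phtpy_sym)
qed

text \<open>Paths are functions on all reals, but only their values on the unit interval
  matter.\<close>

lemma phtpy_cong:
  assumes "phtpy T a b p q" "\<And>t. t \<in> {0..1} \<Longrightarrow> p' t = p t" "\<And>t. t \<in> {0..1} \<Longrightarrow> q' t = q t"
  shows "phtpy T a b p' q'"
proof -
  have "phtpy T a b p' p"
    using phtpyD[OF assms(1)] assms(2) by (intro phtpy_equal) auto
  also have "phtpy T a b p q" by fact
  also have "phtpy T a b q q'"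
    by (rule phtpy_sym, rule phtpy_equal) (use phtpyD[OF assms(1)] assms(3) in auto)
  finally show ?thesis .
qed

text \<open>Both reparametrizations (\<open>C\<close> an interval) and the comparison of the two boundary
  paths of a square (\<open>C\<close> a square) are straight-line homotopies in a convex parameter domain.\<close>
lemma phtpy_convex:
  fixes C :: "'c::real_normed_vector set"
  assumes "convex C" "continuous_map (top_of_set C) T Q"
    and c: "continuous_on {0..1} f" "continuous_on {0..1} g"
    and C: "f ` {0..1} \<subseteq> C" "g ` {0..1} \<subseteq> C"
    and "f 0 = g 0" "f 1 = g 1"
    and p: "\<And>t. t \<in> {0..1} \<Longrightarrow> p t = Q (f t)" and q: "\<And>t. t \<in> {0..1} \<Longrightarrow> q t = Q (g t)"
  shows "phtpy T (p 0) (p 1) p q"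
proof -
  let ?k = "\<lambda>z::real\<times>real. (1 - fst z) *\<^sub>R f (snd z) + fst z *\<^sub>R g (snd z)"
  have "continuous_on ({0..1} \<times> {0..1}) ?k"
    by (intro continuous_intros continuous_on_compose2[OF c(1)] continuous_on_compose2[OF c(2)]) auto
  moreover have "?k ` ({0..1} \<times> {0..1}) \<subseteq> C"
  proof (intro image_subsetI)
    fix z :: "real \<times> real" assume z: "z \<in> {0..1} \<times> {0..1}"
    then have "f (snd z) \<in> C" "g (snd z) \<in> C" using C by auto
    then show "?k z \<in> C" using z \<open>convex C\<close> unfolding convex_alt by auto
  qed
  ultimately have k: "continuous_map (top_of_set ({0..1} \<times> {0..1})) (top_of_set C) ?k"
    by (simp add: image_subset_iff_funcset)
  have "phtpy T (p 0) (p 1) (\<lambda>t. Q (f t)) (\<lambda>t. Q (g t))"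
    unfolding phtpy_def homotopic_with_def
  proof (intro exI conjI ballI allI)
    show "continuous_map (prod_topology (top_of_set {0..1}) (top_of_set {0..1})) T (Q \<circ> ?k)"
      using continuous_map_compose[OF k assms(2)] by simp
    show "(Q \<circ> ?k) (t, 0) = p 0" "(Q \<circ> ?k) (t, 1) = p 1" for t
      using assms(7,8) p[of 0] p[of 1] by (simp_all flip: scaleR_add_left)
  qed simp_all
  then show ?thesis by (rule phtpy_cong) (use p q in auto)
qed

lemma phtpy_reparam:
  assumes "pathin T P" "continuous_on {0..1} f" "continuous_on {0..1} g"
    and "f ` {0..1} \<subseteq> {0..1}" "g ` {0..1} \<subseteq> {0..1}" "f 0 = g 0" "f 1 = g 1"
    and "\<And>t. t \<in> {0..1} \<Longrightarrow> p t = P (f t)" and "\<And>t. t \<in> {0..1} \<Longrightarrow> q t = P (g t)"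
  shows "phtpy T (p 0) (p 1) p q"
  using phtpy_convex[of "{0..1}" T P f g p q] assms by (simp add: pathin_def)

lemma phtpyE:
  assumes "phtpy T a b p q"
  obtains h where "continuous_map (top_of_set ({0..1::real} \<times> {0..1::real})) T h"
    "\<And>x. h (0, x) = p x" "\<And>x. h (1, x) = q x" "\<And>t. t \<in> {0..1} \<Longrightarrow> h (t, 0) = a \<and> h (t, 1) = b"
  using assms unfolding phtpy_def homotopic_with_def by auto

lemma continuous_map_glue:
  fixes S :: "'c::topological_space set"
  assumes "continuous_map (top_of_set (S \<times> {0..1})) T h" "continuous_map (top_of_set (S \<times> {0..1})) T k"
    and "\<And>s. s \<in> S \<Longrightarrow> h (s, 1::real) = k (s, 0)"
  shows "continuous_map (top_of_set (S \<times> {0..1})) T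
    (\<lambda>z. if snd z \<le> 1/2 then h (fst z, 2 * snd z) else k (fst z, 2 * snd z - 1))"
proof (rule continuous_map_cases_le)
  have eq1: "subtopology (top_of_set (S \<times> {0..1})) {x \<in> topspace (top_of_set (S \<times> {0..1})). snd x \<le> 1/2}
      = top_of_set (S \<times> {0..1/2::real})"
    and eq2: "subtopology (top_of_set (S \<times> {0..1})) {x \<in> topspace (top_of_set (S \<times> {0..1})). 1/2 \<le> snd x}
      = top_of_set (S \<times> {1/2..1::real})"
    by (auto simp: subtopology_subtopology intro!: arg_cong[of _ _ "subtopology euclidean"])
  have "continuous_map (top_of_set (S \<times> {0..1/2})) (top_of_set (S \<times> {0..1})) (\<lambda>z::'c \<times> real. (fst z, 2 * snd z))"
    by (auto intro!: continuous_intros)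
  from continuous_map_compose[OF this assms(1)]
  show "continuous_map (subtopology (top_of_set (S \<times> {0..1})) {x \<in> topspace (top_of_set (S \<times> {0..1})). snd x \<le> 1/2})
     T (\<lambda>z. h (fst z, 2 * snd z))"
    unfolding eq1 by (simp add: comp_def)
  have "continuous_map (top_of_set (S \<times> {1/2..1})) (top_of_set (S \<times> {0..1})) (\<lambda>z::'c \<times> real. (fst z, 2 * snd z - 1))"
    by (auto intro!: continuous_intros)
  from continuous_map_compose[OF this assms(2)]
  show "continuous_map (subtopology (top_of_set (S \<times> {0..1})) {x \<in> topspace (top_of_set (S \<times> {0..1})). 1/2 \<le> snd x})
     T (\<lambda>z. k (fst z, 2 * snd z - 1))"
    unfolding eq2 by (simp add: comp_def)
  fix x :: "'c \<times> real" assume "x \<in> topspace (top_of_set (S \<times> {0..1}))" "snd x = 1/2"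
  then have "2 * snd x = 1" "fst x \<in> S" by auto
  then show "h (fst x, 2 * snd x) = k (fst x, 2 * snd x - 1)" using assms(3) by simp
qed (auto intro!: continuous_intros)

lemma phtpy_pconcat:
  assumes "phtpy T a b p p'" "phtpy T b c q q'"
  shows "phtpy T a c (pconcat p q) (pconcat p' q')"
proof -
  obtain h where h: "continuous_map (top_of_set ({0..1::real} \<times> {0..1::real})) T h"
    "\<And>x. h (0, x) = p x" "\<And>x. h (1, x) = p' x" "\<And>t. t \<in> {0..1} \<Longrightarrow> h (t, 0) = a \<and> h (t, 1) = b"
    using phtpyE[OF assms(1)] by metis
  obtain k where k: "continuous_map (top_of_set ({0..1::real} \<times> {0..1::real})) T k"
    "\<And>x. k (0, x) = q x" "\<And>x. k (1, x) = q' x" "\<And>t. t \<in> {0..1} \<Longrightarrow> k (t, 0) = b \<and> k (t, 1) = c"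
    using phtpyE[OF assms(2)] by metis
  show ?thesis
    unfolding phtpy_def homotopic_with_def
    using continuous_map_glue[OF h(1) k(1)] h k
    by (intro exI[of _ "\<lambda>z. if snd z \<le> 1/2 then h (fst z, 2 * snd z) else k (fst z, 2 * snd z - 1)"])
       (auto simp: pconcat_def)
qed

lemma pconcat_ends [simp]: "pconcat p q 0 = p 0" "pconcat p q 1 = q 1"
  by (simp_all add: pconcat_def)

lemma pathin_pconcat:
  assumes "pathin T p" "pathin T q" "p 1 = q 0"
  shows "pathin T (pconcat p q)"
  using phtpyD(1)[OF phtpy_pconcat] phtpy_refl[OF assms(1)] phtpy_refl[OF assms(2)] assms(3) by metis

lemma pathin_reparam:
  assumes "pathin T p" "continuous_on {0..1} f" "f ` {0..1} \<subseteq> {0..1}"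
  shows "pathin T (\<lambda>t. p (f t))"
  using phtpyD(1)[OF phtpy_reparam[of T p f f "\<lambda>t. p (f t)" "\<lambda>t. p (f t)"]] assms by simp

lemma phtpy_assoc:
  assumes "pathin T p" "pathin T q" "pathin T r" "p 1 = q 0" "q 1 = r 0"
  shows "phtpy T (p 0) (r 1) (pconcat (pconcat p q) r) (pconcat p (pconcat q r))"
proof -
  \<comment> \<open>The reparametrization that turns \<open>p (q r)\<close> into
    \<open>(p q) r\<close>: the breakpoints 1/4 and 1/2 go to 1/2 and 3/4.\<close>
  define f where "f t = (if t \<le> 1/2 then (if t \<le> 1/4 then 2 * t else t + 1/4) else t / 2 + 1 / 2)" for t :: real
  have "continuous_on ({0..1/4} \<union> {1/4..1/2} \<union> {1/2..1}) f"
  proof (intro continuous_on_closed_Un)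
    show "continuous_on {0..1/4} f"
      by (rule continuous_on_cong[THEN iffD1, OF refl, of _ "\<lambda>t. 2 * t"]) (auto simp: f_def intro!: continuous_intros)
    show "continuous_on {1/4..1/2} f"
      by (rule continuous_on_cong[THEN iffD1, OF refl, of _ "\<lambda>t. t + 1/4"]) (auto simp: f_def intro!: continuous_intros)
    show "continuous_on {1/2..1} f"
      by (rule continuous_on_cong[THEN iffD1, OF refl, of _ "\<lambda>t. t / 2 + 1 / 2"]) (auto simp: f_def intro!: continuous_intros)
  qed auto
  moreover have "{0..1/4} \<union> {1/4..1/2} \<union> {1/2..1} = {0..1::real}" by auto
  ultimately have f: "continuous_on {0..1} f" by simp
  have "phtpy T (pconcat (pconcat p q) r 0) (pconcat (pconcat p q) r 1)
      (pconcat (pconcat p q) r) (pconcat p (pconcat q r))"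
  proof (rule phtpy_reparam[where f=f and g="\<lambda>t. t"])
    show "pathin T (pconcat p (pconcat q r))"
      using assms by (intro pathin_pconcat) auto
    fix t :: real assume "t \<in> {0..1}"
    show "pconcat (pconcat p q) r t = pconcat p (pconcat q r) (f t)"
      by (auto simp: pconcat_def f_def algebra_simps)
  qed (use f in \<open>auto simp: f_def intro!: continuous_intros\<close>)
  then show ?thesis by simp
qed

lemma phtpy_const_left:
  assumes "pathin T p" "p 0 = a"
  shows "phtpy T a (p 1) (pconcat (\<lambda>_. a) p) p"
proof -
  have "phtpy T (pconcat (\<lambda>_. a) p 0) (pconcat (\<lambda>_. a) p 1) (pconcat (\<lambda>_. a) p) p"
    by (rule phtpy_reparam[OF assms(1), where f="\<lambda>t. max 0 (2 * t - 1)" and g="\<lambda>t. t"])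
       (use assms in \<open>auto simp: pconcat_def max_absorb1 max_absorb2 intro!: continuous_intros\<close>)
  then show ?thesis by simp
qed

lemma phtpy_const_right:
  assumes "pathin T p" "p 1 = b"
  shows "phtpy T (p 0) b (pconcat p (\<lambda>_. b)) p"
proof -
  have "phtpy T (pconcat p (\<lambda>_. b) 0) (pconcat p (\<lambda>_. b) 1) (pconcat p (\<lambda>_. b)) p"
    by (rule phtpy_reparam[OF assms(1), where f="\<lambda>t. min 1 (2 * t)" and g="\<lambda>t. t"])
       (use assms in \<open>auto simp: pconcat_def min_absorb1 min_absorb2 intro!: continuous_intros\<close>)
  then show ?thesis by simp
qed

definition prev :: "(real \<Rightarrow> 'a) \<Rightarrow> real \<Rightarrow> 'a" where
  "prev p = (\<lambda>t. p (1 - t))"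

lemma prev_ends [simp]: "prev p 0 = p 1" "prev p 1 = p 0"
  by (simp_all add: prev_def)

lemma prev_prev [simp]: "prev (prev p) = p"
  by (simp add: prev_def)

lemma pathin_prev: "pathin T p \<Longrightarrow> pathin T (prev p)"
  unfolding prev_def by (rule pathin_reparam) (auto intro!: continuous_intros)

lemma phtpy_prev_right:
  assumes "pathin T p"
  shows "phtpy T (p 0) (p 0) (pconcat p (prev p)) (\<lambda>_. p 0)"
proof -
  have "phtpy T (pconcat p (prev p) 0) (pconcat p (prev p) 1) (pconcat p (prev p)) (\<lambda>_. p 0)"
    \<comment> \<open>Out and back along \<open>p\<close> is \<open>p\<close> composed with the tent
      function, the constant loop is \<open>p\<close> composed with 0; the homotopy flattens the
      tent.\<close>
    by (rule phtpy_reparam[OF assms(1), where f="\<lambda>t. 1 - \<bar>2 * t - 1\<bar>" and g="\<lambda>t. 0"])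
       (auto simp: pconcat_def prev_def algebra_simps intro!: continuous_intros arg_cong[of _ _ p])
  then show ?thesis by simp
qed

text \<open>Converts free homotopies into homotopies with fixed ends: if \<open>Q (s, t)\<close> is
  a path in \<open>t\<close> deformed in \<open>s\<close>, the other two sides of the square are the
  tracks of its endpoints.\<close>

lemma phtpy_square:
  assumes "continuous_map (top_of_set ({0..1} \<times> {0..1})) T Q"
  shows "phtpy T (Q (0, 0)) (Q (1, 1)) (pconcat (\<lambda>t. Q (0, t)) (\<lambda>s. Q (s, 1)))
     (pconcat (\<lambda>s. Q (s, 0)) (\<lambda>t. Q (1, t)))"
proof -
  let ?f = "pconcat (\<lambda>t. (0, t)) (\<lambda>s. (s, 1)) :: real \<Rightarrow> real \<times> real"
  let ?g = "pconcat (\<lambda>s. (s, 0)) (\<lambda>t. (1, t)) :: real \<Rightarrow> real \<times> real"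
  have "pathin euclidean ?f" "pathin euclidean ?g"
    by (intro pathin_pconcat; force simp: pathin_def intro!: continuous_intros)+
  then have "continuous_on {0..1} ?f" "continuous_on {0..1} ?g" by (auto simp: pathin_def)
  then have "phtpy T ((Q \<circ> ?f) 0) ((Q \<circ> ?f) 1) (Q \<circ> ?f) (Q \<circ> ?g)"
    by (intro phtpy_convex[OF _ assms, of ?f ?g]) (auto simp: pconcat_def intro!: convex_Times)
  then show ?thesis by (auto elim!: phtpy_cong simp: pconcat_def)
qed

subsection \<open>The fundamental group is a group\<close>

lemma loop_htpy_eq: "loop_htpy T x0 = phtpy T x0 x0"
  by (intro ext) (simp add: loop_htpy_def phtpy_def)

lemma loop_class_eqI: "phtpy T x0 x0 p q \<Longrightarrow> loop_class T x0 p = loop_class T x0 q"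
  unfolding loop_class_def loop_htpy_eq by (blast intro: phtpy_trans phtpy_sym)

lemma in_loop_class: "loop_at T x0 p \<Longrightarrow> p \<in> loop_class T x0 p"
  using phtpy_refl[of T p] by (auto simp: loop_class_def loop_htpy_eq loop_at_def)

lemma loop_class_some:
  assumes "loop_at T x0 p"
  shows "phtpy T x0 x0 p (SOME q. q \<in> loop_class T x0 p)"
  using someI[of "\<lambda>q. q \<in> loop_class T x0 p", OF in_loop_class[OF assms]]
  by (simp add: loop_class_def loop_htpy_eq)

text \<open>The operation concatenates representatives picked by \<open>SOME\<close>; they are
  homotopic to \<open>p\<close> and \<open>q\<close>, so the choice does not affect the
  class.\<close>

lemma fundamental_group_mult:
  assumes "loop_at T x0 p" "loop_at T x0 q"
  shows "loop_class T x0 p \<otimes>\<^bsub>fundamental_group T x0\<^esub> loop_class T x0 q = loop_class T x0 (pconcat p q)"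
  unfolding fundamental_group_def
  using loop_class_eqI[OF phtpy_pconcat[OF loop_class_some[OF assms(1)] loop_class_some[OF assms(2)]]]
  by simp

lemma loop_at_pconcat: "loop_at T x0 p \<Longrightarrow> loop_at T x0 q \<Longrightarrow> loop_at T x0 (pconcat p q)"
  by (auto simp: loop_at_def intro: pathin_pconcat)

lemma loop_at_prev: "loop_at T x0 p \<Longrightarrow> loop_at T x0 (prev p)"
  by (auto simp: loop_at_def intro: pathin_prev)

lemma loop_at_const: "x0 \<in> topspace T \<Longrightarrow> loop_at T x0 (\<lambda>_. x0)"
  by (auto simp: loop_at_def pathin_def)

lemma carrier_fundamental_group: "carrier (fundamental_group T x0) = loop_class T x0 ` {p. loop_at T x0 p}"
  by (auto simp: fundamental_group_def)

lemma one_fundamental_group: "\<one>\<^bsub>fundamental_group T x0\<^esub> = loop_class T x0 (\<lambda>_. x0)"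
  by (simp add: fundamental_group_def)

lemma fundamental_group_l_inv:
  assumes "loop_at T x0 p"
  shows "loop_class T x0 (prev p) \<otimes>\<^bsub>fundamental_group T x0\<^esub> loop_class T x0 p = \<one>\<^bsub>fundamental_group T x0\<^esub>"
  using loop_class_eqI[of T x0 "pconcat (prev p) p" "\<lambda>_. x0"] phtpy_prev_right[of T "prev p"] assms loop_at_prev[OF assms]
  by (simp add: fundamental_group_mult one_fundamental_group loop_at_def)

lemma group_fundamental_group:
  assumes "x0 \<in> topspace T"
  shows "group (fundamental_group T x0)"
proof (rule groupI)
  fix A B C
  assume "A \<in> carrier (fundamental_group T x0)" "B \<in> carrier (fundamental_group T x0)"
    "C \<in> carrier (fundamental_group T x0)"
  then obtain p q r where pqr: "loop_at T x0 p" "loop_at T x0 q" "loop_at T x0 r"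
    and [simp]: "A = loop_class T x0 p" "B = loop_class T x0 q" "C = loop_class T x0 r"
    by (auto simp: carrier_fundamental_group)
  show "A \<otimes>\<^bsub>fundamental_group T x0\<^esub> B \<in> carrier (fundamental_group T x0)"
    using pqr by (auto simp: fundamental_group_mult carrier_fundamental_group loop_at_pconcat)
  show "A \<otimes>\<^bsub>fundamental_group T x0\<^esub> B \<otimes>\<^bsub>fundamental_group T x0\<^esub> C =
    A \<otimes>\<^bsub>fundamental_group T x0\<^esub> (B \<otimes>\<^bsub>fundamental_group T x0\<^esub> C)"
    using pqr phtpy_assoc[of T p q r]
    by (simp add: fundamental_group_mult loop_at_pconcat) (auto simp: loop_at_def intro!: loop_class_eqI)
  show "\<one>\<^bsub>fundamental_group T x0\<^esub> \<otimes>\<^bsub>fundamental_group T x0\<^esub> A = A"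
    using pqr phtpy_const_left[of T p x0] loop_at_const[OF assms]
    by (simp add: fundamental_group_mult one_fundamental_group) (auto simp: loop_at_def intro!: loop_class_eqI)
  show "\<exists>y\<in>carrier (fundamental_group T x0). y \<otimes>\<^bsub>fundamental_group T x0\<^esub> A = \<one>\<^bsub>fundamental_group T x0\<^esub>"
    using pqr(1) fundamental_group_l_inv[of T x0 p] loop_at_prev[of T x0 p] by (auto simp: carrier_fundamental_group)
next
  show "\<one>\<^bsub>fundamental_group T x0\<^esub> \<in> carrier (fundamental_group T x0)"
    using loop_at_const[OF assms] by (auto simp: carrier_fundamental_group one_fundamental_group)
qed

section \<open>The topology of a graph\<close>

lemma openin_graph_top: "openin (graph_top V Ed src tgt) U \<longleftrightarrow> gopen V Ed src tgt U"
  by (simp add: graph_top_def topology_inverse' istopology_gopen)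

lemma gpt_ends [simp]: "gpt src tgt e 0 = Inl (src e)" "gpt src tgt e 1 = Inl (tgt e)"
  by (simp_all add: gpt_def)

lemma openin_prod_discrete:
  "openin (prod_topology (discrete_topology D) Y) S \<longleftrightarrow>
    S \<subseteq> D \<times> topspace Y \<and> (\<forall>d\<in>D. openin Y {y \<in> topspace Y. (d, y) \<in> S})"
proof (intro iffI conjI ballI)
  assume S: "openin (prod_topology (discrete_topology D) Y) S"
  then show "S \<subseteq> D \<times> topspace Y" using openin_subset by fastforce
  fix d assume "d \<in> D"
  then have "continuous_map Y (prod_topology (discrete_topology D) Y) (\<lambda>y. (d, y))"
    by (simp add: continuous_map_paired)
  from openin_continuous_map_preimage[OF this S] show "openin Y {y \<in> topspace Y. (d, y) \<in> S}" .
next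
  assume S: "S \<subseteq> D \<times> topspace Y \<and> (\<forall>d\<in>D. openin Y {y \<in> topspace Y. (d, y) \<in> S})"
  then have "S = (\<Union>d\<in>D. {d} \<times> {y \<in> topspace Y. (d, y) \<in> S})" by auto
  moreover have "openin (prod_topology (discrete_topology D) Y) (\<Union>d\<in>D. {d} \<times> {y \<in> topspace Y. (d, y) \<in> S})"
    using S by (intro openin_Union) (auto simp: openin_prod_Times_iff)
  ultimately show "openin (prod_topology (discrete_topology D) Y) S" by simp
qed

lemma continuous_map_prod_discrete:
  assumes "\<And>d. d \<in> D \<Longrightarrow> continuous_map (prod_topology Z Y) T (\<lambda>p. H (fst p, (d, snd p)))"
  shows "continuous_map (prod_topology Z (prod_topology (discrete_topology D) Y)) T H"
  (is "continuous_map ?X T H")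
  unfolding continuous_map_def
proof (intro conjI allI impI funcsetI)
  fix x assume "x \<in> topspace ?X"
  then obtain z d y where "x = (z, (d, y))" "z \<in> topspace Z" "d \<in> D" "y \<in> topspace Y" by auto
  then show "H x \<in> topspace T"
    using continuous_map_image_subset_topspace[OF assms[of d]] by force
next
  fix U assume U: "openin T U"
  have d: "continuous_map ?X (discrete_topology D) (\<lambda>x. fst (snd x))"
    by (rule continuous_map_compose[OF continuous_map_snd continuous_map_fst, unfolded comp_def])
  have p: "continuous_map ?X (prod_topology Z Y) (\<lambda>x. (fst x, snd (snd x)))"
    by (intro continuous_map_pairedI continuous_map_fst
       continuous_map_compose[OF continuous_map_snd continuous_map_snd, unfolded comp_def])
  have "openin ?X ({x \<in> topspace ?X. fst (snd x) \<in> {d}} \<inter> {x \<in> topspace ?X. (fst x, snd (snd x)) \<in>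
      {p \<in> topspace (prod_topology Z Y). H (fst p, (d, snd p)) \<in> U}})" if "d \<in> D" for d
    by (intro openin_Int openin_continuous_map_preimage[OF d] openin_continuous_map_preimage[OF p]
        openin_continuous_map_preimage[OF assms U] that) (use that in auto)
  then have "openin ?X (\<Union>d\<in>D. {x \<in> topspace ?X. fst (snd x) \<in> {d}} \<inter> {x \<in> topspace ?X. (fst x, snd (snd x)) \<in>
      {p \<in> topspace (prod_topology Z Y). H (fst p, (d, snd p)) \<in> U}})" by blast
  also have "(\<Union>d\<in>D. {x \<in> topspace ?X. fst (snd x) \<in> {d}} \<inter> {x \<in> topspace ?X. (fst x, snd (snd x)) \<in>
      {p \<in> topspace (prod_topology Z Y). H (fst p, (d, snd p)) \<in> U}}) = {x \<in> topspace ?X. H x \<in> U}"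
    by auto
  finally show "openin ?X {x \<in> topspace ?X. H x \<in> U}" .
qed

lemma Hausdorff_space_realI:
  assumes "\<And>x y. x \<in> topspace Z \<Longrightarrow> y \<in> topspace Z \<Longrightarrow> x \<noteq> y \<Longrightarrow> \<exists>f. continuous_map Z euclideanreal f \<and> f x \<noteq> f y"
  shows "Hausdorff_space Z"
  unfolding Hausdorff_space_def
proof (intro allI impI)
  fix x y assume xy: "x \<in> topspace Z \<and> y \<in> topspace Z \<and> x \<noteq> y"
  then obtain f where f: "continuous_map Z euclideanreal f" "f x \<noteq> f y" using assms by blast
  obtain A B where "open A" "open B" "f x \<in> A" "f y \<in> B" "A \<inter> B = {}"
    using hausdorff[OF f(2)] by blast
  then show "\<exists>U W. openin Z U \<and> openin Z W \<and> x \<in> U \<and> y \<in> W \<and> disjnt U W"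
    using openin_continuous_map_preimage[OF f(1), of A] openin_continuous_map_preimage[OF f(1), of B] xy
    by (intro exI[of _ "{x \<in> topspace Z. f x \<in> A}"] exI[of _ "{x \<in> topspace Z. f x \<in> B}"])
       (auto simp: disjnt_def)
qed

locale graph =
  fixes V :: "'v set" and Ed :: "'e set" and src tgt :: "'e \<Rightarrow> 'v"
  assumes is_graph: "is_graph V Ed src tgt"
begin

abbreviation G :: "('v + 'e \<times> real) topology" where "G \<equiv> graph_top V Ed src tgt"
abbreviation gp :: "'e \<Rightarrow> real \<Rightarrow> 'v + 'e \<times> real" where "gp \<equiv> gpt src tgt"

lemma src_in [simp]: "e \<in> Ed \<Longrightarrow> src e \<in> V" and tgt_in [simp]: "e \<in> Ed \<Longrightarrow> tgt e \<in> V"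
  using is_graph by (auto simp: is_graph_def)

lemma gpt_in: "e \<in> Ed \<Longrightarrow> t \<in> {0..1} \<Longrightarrow> gp e t \<in> gcarrier V Ed"
  by (auto simp: gpt_def gcarrier_def)

lemma topspace_graph [simp]: "topspace G = gcarrier V Ed"
proof -
  have "gopen V Ed src tgt (gcarrier V Ed)"
    unfolding gopen_def
  proof (intro conjI ballI)
    fix e assume "e \<in> Ed"
    then have "{t \<in> {0..1}. gp e t \<in> gcarrier V Ed} = {0..1}" using gpt_in by auto
    then show "openin (top_of_set {0..1}) {t \<in> {0..1}. gp e t \<in> gcarrier V Ed}" by simp
  qed simp
  then show ?thesis
    unfolding topspace_def openin_graph_top by (auto simp: gopen_def)
qed

lemma Inl_in [simp]: "Inl v \<in> gcarrier V Ed \<longleftrightarrow> v \<in> V"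
  by (auto simp: gcarrier_def)

lemma pathin_gpt: "e \<in> Ed \<Longrightarrow> pathin G (gp e)"
  unfolding pathin_def continuous_map_def using gpt_in by (auto simp: openin_graph_top gopen_def)

lemma gcarrier_cases:
  assumes "x \<in> gcarrier V Ed"
  obtains v where "v \<in> V" "x = Inl v" | e t where "e \<in> Ed" "0 < t" "t < 1" "x = Inr (e, t)" "x = gp e t"
  using assms by (auto simp: gcarrier_def gpt_def)

lemma continuous_map_graphI:
  assumes "\<And>v. v \<in> V \<Longrightarrow> f (Inl v) \<in> topspace Y" "\<And>e. e \<in> Ed \<Longrightarrow> pathin Y (\<lambda>t. f (gp e t))"
  shows "continuous_map G Y f"
  unfolding continuous_map_def
proof (intro conjI allI impI funcsetI)
  fix x assume "x \<in> topspace G"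
  then have "x \<in> gcarrier V Ed" by simp
  then show "f x \<in> topspace Y"
  proof (cases rule: gcarrier_cases)
    case (2 e t)
    then have "f (gp e t) \<in> topspace Y"
      using Pi_mem[OF continuous_map_funspace[OF assms(2)[OF 2(1), unfolded pathin_def]], of t] by simp
    with 2 show ?thesis by simp
  qed (use assms in auto)
next
  fix U assume U: "openin Y U"
  have "openin (top_of_set {0..1}) {t \<in> {0..1}. gp e t \<in> {x \<in> topspace G. f x \<in> U}}" if "e \<in> Ed" for e
  proof -
    have "{t \<in> {0..1}. gp e t \<in> {x \<in> topspace G. f x \<in> U}} = {t \<in> topspace (top_of_set {0..1}). f (gp e t) \<in> U}"
      using gpt_in[OF that] by auto
    then show ?thesis using openin_continuous_map_preimage[OF assms(2)[OF that, unfolded pathin_def] U] by simp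
  qed
  then show "openin G {x \<in> topspace G. f x \<in> U}"
    by (simp add: openin_graph_top gopen_def)
qed

text \<open>Each vertex also receives a copy of the interval, collapsed to a point. This covers
  isolated vertices and makes the disjoint union of all pieces a product with a discrete
  space.\<close>

lemma quotient_map_edges:
  "quotient_map (prod_topology (discrete_topology (Inl ` V \<union> Inr ` Ed)) (top_of_set {0..1})) G
     (\<lambda>(d, t). case d of Inl v \<Rightarrow> Inl v | Inr e \<Rightarrow> gp e t)" (is "quotient_map ?X G ?q")
  unfolding quotient_map_def
proof (intro conjI allI impI)
  show "?q ` topspace ?X = topspace G"
  proof (intro equalityI subsetI)
    fix x assume "x \<in> topspace G"
    then have "x \<in> gcarrier V Ed" by simp
    then show "x \<in> ?q ` topspace ?X"
    proof (cases rule: gcarrier_cases)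
      case (1 v) then show ?thesis by (intro image_eqI[of _ _ "(Inl v, 0)"]) auto
    next
      case (2 e t) then show ?thesis by (intro image_eqI[of _ _ "(Inr e, t)"]) auto
    qed
  qed (use gpt_in in auto)
  fix U assume U: "U \<subseteq> topspace G"
  have "openin ?X {x \<in> topspace ?X. ?q x \<in> U} \<longleftrightarrow>
     (\<forall>e\<in>Ed. openin (top_of_set {0..1}) {t \<in> {0..1}. gp e t \<in> U})" (is "?L \<longleftrightarrow> ?R")
  proof -
    define S where "S = {x \<in> topspace ?X. ?q x \<in> U}"
    have "{y. 0 \<le> y \<and> y \<le> 1 \<and> (Inl v, y) \<in> S} = {y::real. 0 \<le> y \<and> y \<le> 1 \<and> Inl v \<in> U}" if "v \<in> V" for v
      using that by (auto simp: S_def)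
    moreover have "{y. 0 \<le> y \<and> y \<le> 1 \<and> (Inr e, y) \<in> S} = {y. 0 \<le> y \<and> y \<le> 1 \<and> gp e y \<in> U}" if "e \<in> Ed" for e
      using that by (auto simp: S_def)
    moreover have "S \<subseteq> (Inl ` V \<union> Inr ` Ed) \<times> {0..1}" by (auto simp: S_def)
    ultimately have "?L \<longleftrightarrow> (\<forall>v\<in>V. openin (top_of_set {0..1}) {y::real. 0 \<le> y \<and> y \<le> 1 \<and> Inl v \<in> U}) \<and> ?R"
      unfolding S_def[symmetric] openin_prod_discrete by (simp add: ball_Un cong: ball_cong)
    moreover have "openin (top_of_set {0..1}) {y::real. 0 \<le> y \<and> y \<le> 1 \<and> Inl v \<in> U}" for v
    proof (cases "Inl v \<in> U")
      case True
      then have "{y::real. 0 \<le> y \<and> y \<le> 1 \<and> Inl v \<in> U} = {0..1}" by auto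
      then show ?thesis by simp
    qed simp
    ultimately show ?thesis by blast
  qed
  then show "openin ?X {x \<in> topspace ?X. ?q x \<in> U} \<longleftrightarrow> openin G U"
    using U by (simp add: openin_graph_top gopen_def)
qed

text \<open>Quotient maps need not be stable under products; here the product with the identity of
  \<open>{0..1}\<close> is again a quotient map because the interval is locally compact and
  Hausdorff.\<close>

lemma continuous_map_prod_graphI:
  assumes "\<And>v. v \<in> V \<Longrightarrow> pathin Y (\<lambda>s. H (s, Inl v))"
    and "\<And>e. e \<in> Ed \<Longrightarrow> continuous_map (top_of_set ({0..1} \<times> {0..1})) Y (\<lambda>z. H (fst z, gp e (snd z)))"
  shows "continuous_map (prod_topology (top_of_set {0..1}) G) Y H"
proof (rule continuous_compose_quotient_map)
  show "quotient_map (prod_topology (top_of_set {0..1::real}) (prod_topology (discrete_topology (Inl ` V \<union> Inr ` Ed)) (top_of_set {0..1})))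
     (prod_topology (top_of_set {0..1}) G) (\<lambda>(s, x). (s, (\<lambda>(d, t). case d of Inl v \<Rightarrow> Inl v | Inr e \<Rightarrow> gp e t) x))"
  proof (intro quotient_map_prod_right quotient_map_edges disjI1)
    have "compact_space (top_of_set {0..1::real})" by (simp add: compact_space_subtopology)
    moreover show "Hausdorff_space (top_of_set {0..1::real})"
      by (simp add: Hausdorff_space_subtopology)
    ultimately show "locally_compact_space (top_of_set {0..1::real})"
      by (simp add: compact_imp_locally_compact_space)
  qed
  show "continuous_map (prod_topology (top_of_set {0..1}) (prod_topology (discrete_topology (Inl ` V \<union> Inr ` Ed)) (top_of_set {0..1}))) Y
     (H \<circ> (\<lambda>(s, x). (s, (\<lambda>(d, t). case d of Inl v \<Rightarrow> Inl v | Inr e \<Rightarrow> gp e t) x)))"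
  proof (rule continuous_map_prod_discrete)
    fix d assume "d \<in> Inl ` V \<union> Inr ` Ed"
    then show "continuous_map (prod_topology (top_of_set {0..1}) (top_of_set {0..1})) Y
       (\<lambda>p. (H \<circ> (\<lambda>(s, x). (s, (\<lambda>(d, t). case d of Inl v \<Rightarrow> Inl v | Inr e \<Rightarrow> gp e t) x))) (fst p, (d, snd p)))"
    proof
      assume "d \<in> Inl ` V"
      then obtain v where v: "v \<in> V" "d = Inl v" by auto
      show ?thesis
        using continuous_map_compose[OF continuous_map_fst assms(1)[OF v(1), unfolded pathin_def], of "top_of_set {0..1}"]
        by (simp add: v comp_def)
    next
      assume "d \<in> Inr ` Ed"
      then show ?thesis using assms(2) by (auto simp: comp_def)
    qed
  qed
qed

text \<open>Continuous real functions separate points: the hat function \<open>f v\<close> of a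
  vertex separates vertices, and the bumps \<open>g a e\<close> detect the edge and the coordinate
  of an interior point.\<close>

lemma Hausdorff_graph: "Hausdorff_space G"
proof (rule Hausdorff_space_realI)
  fix x y assume xy: "x \<in> topspace G" "y \<in> topspace G" "x \<noteq> y"
  define f where "f v z = (case z of Inl u \<Rightarrow> of_bool (u = v) | Inr (e, t) \<Rightarrow> (1 - t) * of_bool (src e = v) + t * of_bool (tgt e = v))"
    for v :: 'v and z :: "'v + 'e \<times> real"
  \<comment> \<open>Two values of \<open>a\<close> suffice: on the edge \<open>e\<close>,
    \<open>g 1 e - g 0 e\<close> equals \<open>t * (1 - t)\<close>, and dividing
    \<open>g 0 e\<close> by this recovers \<open>t\<close>.\<close>
  define g where "g a e z = (case z of Inl u \<Rightarrow> 0 | Inr (d, t) \<Rightarrow> if d = e then t * (1 - t) * (a + t) else 0)"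
    for a :: real and e :: 'e and z :: "'v + 'e \<times> real"
  have f: "continuous_map G euclideanreal (f v)" for v
  proof (rule continuous_map_graphI)
    fix e assume "e \<in> Ed"
    have "f v (gp e t) = (1 - t) * of_bool (src e = v) + t * of_bool (tgt e = v)" for t
      by (auto simp: f_def gpt_def)
    then show "pathin euclideanreal (\<lambda>t. f v (gp e t))" by (simp add: pathin_def continuous_intros)
  qed simp
  have g: "continuous_map G euclideanreal (g a e)" for a e
  proof (rule continuous_map_graphI)
    fix d assume "d \<in> Ed"
    have "g a e (gp d t) = (if d = e then t * (1 - t) * (a + t) else 0)" for t
      by (auto simp: g_def gpt_def)
    then show "pathin euclideanreal (\<lambda>t. g a e (gp d t))" by (simp add: pathin_def continuous_intros)
  qed simp
  show "\<exists>f. continuous_map G euclideanreal f \<and> f x \<noteq> f y"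
  proof (rule ccontr)
    assume "\<not> ?thesis"
    then have eq: "f v x = f v y" "g a e x = g a e y" for v a e using f g by blast+
    have 1: False if "x = Inr (e, t)" "0 < t" "t < 1" "\<And>a. g a e x = g a e y" "x \<noteq> y" for e t x y
    proof -
      have "t * (1 - t) * (1 + t) > 0" using that by simp
      moreover have "g 1 e y = t * (1 - t) * (1 + t)"
        using that(4)[of 1] unfolding that(1) by (simp add: g_def)
      ultimately have "g 1 e y \<noteq> 0" by linarith
      then obtain t' where y: "y = Inr (e, t')"
        by (auto simp: g_def split: sum.splits if_splits)
      have "t * (1 - t) * (0 + t) = t' * (1 - t') * (0 + t')" "t * (1 - t) * (1 + t) = t' * (1 - t') * (1 + t')"
        using that(4)[of 0] that(4)[of 1] by (simp_all add: g_def that(1) y)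
      moreover from this have *: "t * (1 - t) = t' * (1 - t')" by (simp add: algebra_simps)
      ultimately have "(t * (1 - t)) * t = (t * (1 - t)) * t'" by simp
      moreover have "t * (1 - t) \<noteq> 0" using that by simp
      ultimately have "t = t'" by (metis mult_left_cancel)
      with that y show False by simp
    qed
    have 2: "u = u'" if "x = Inl u" "y = Inl u'" for u u'
      using eq(1)[of u] that by (auto simp: f_def split: if_splits)
    have "x \<in> gcarrier V Ed" "y \<in> gcarrier V Ed" using xy by auto
    then show False
      using 1[of x _ _ y] 1[of y _ _ x] 2 eq xy(3)
      by (elim gcarrier_cases) metis+
  qed
qed

lemma compactin_finite_subgraph:
  assumes "finite V0" "finite E0" "V0 \<subseteq> V" "E0 \<subseteq> Ed"
  shows "compactin G (Inl ` V0 \<union> (\<Union>e\<in>E0. gp e ` {0..1}))"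
proof -
  have "compactin G (gp e ` {0..1})" if "e \<in> E0" for e
    using image_compactin[OF _ pathin_gpt[unfolded pathin_def], of "{0..1}" e] that assms
    by (auto simp: compactin_subtopology)
  then have "compactin G (\<Union>e\<in>E0. gp e ` {0..1})"
    using assms by (intro compactin_Union) auto
  moreover have "compactin G (Inl ` V0)"
    using assms by (intro finite_imp_compactin) auto
  ultimately show ?thesis by (intro compactin_Un)
qed

lemma continuous_map_inclusion:
  assumes "V' \<subseteq> V" "E' \<subseteq> Ed" "is_graph V' E' src tgt"
  shows "continuous_map (graph_top V' E' src tgt) G id"
proof -
  interpret sub: graph V' E' src tgt by unfold_locales fact
  show ?thesis
    using assms pathin_gpt by (intro sub.continuous_map_graphI) auto
qed

section \<open>Stars, open cells and compact sets\<close>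

definition star :: "'v \<Rightarrow> ('v + 'e \<times> real) set" where
  "star v = insert (Inl v) {Inr (e, t) | e t. e \<in> Ed \<and> (src e = v \<or> tgt e = v) \<and> 0 < t \<and> t < 1}"

definition ecell :: "'e \<Rightarrow> ('v + 'e \<times> real) set" where
  "ecell e = {Inr (e, t) | t. 0 < t \<and> t < 1}"

lemma openin_star: assumes "v \<in> V" shows "openin G (star v)"
  unfolding openin_graph_top gopen_def
proof (intro conjI ballI)
  show "star v \<subseteq> gcarrier V Ed" using assms by (auto simp: star_def gcarrier_def)
  fix e assume e: "e \<in> Ed"
  let ?S = "(if src e = v then {} else {0}) \<union> (if tgt e = v then {} else {1}) :: real set"
  show "openin (top_of_set {0..1}) {t \<in> {0..1}. gp e t \<in> star v}"
  proof (cases "src e = v \<or> tgt e = v")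
    case True
    then have "{t \<in> {0..1}. gp e t \<in> star v} = {0..1} \<inter> - ?S"
      using e by (auto simp: gpt_def star_def)
    moreover have "open (- ?S)" by (intro open_Compl finite_imp_closed) auto
    ultimately show ?thesis by (metis openin_open)
  next
    case False
    then have eq: "{t \<in> {0..1}. gp e t \<in> star v} = {}"
      by (auto simp: gpt_def star_def)
    show ?thesis unfolding eq by simp
  qed
qed

lemma openin_ecell_part:
  assumes "e \<in> Ed" "open O'" "O' \<subseteq> {0<..<1}"
  shows "openin G {Inr (e, t) | t. t \<in> O'}"
  unfolding openin_graph_top gopen_def
proof (intro conjI ballI)
  show "{Inr (e, t) |t. t \<in> O'} \<subseteq> gcarrier V Ed" using assms by (auto simp: gcarrier_def)
  fix d assume "d \<in> Ed"
  have "{t \<in> {0..1}. gp d t \<in> {Inr (e, t) |t. t \<in> O'}} = (if d = e then {0..1} \<inter> O' else {})"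
    using assms(3) by (auto simp: gpt_def)
  then show "openin (top_of_set {0..1}) {t \<in> {0..1}. gp d t \<in> {Inr (e, t) |t. t \<in> O'}}"
    using assms(2) openin_open by auto
qed

lemma openin_ecell: "e \<in> Ed \<Longrightarrow> openin G (ecell e)"
  using openin_ecell_part[of e "{0<..<1}"] by (simp add: ecell_def)

text \<open>Open stars and open cells cover the graph, and by local finiteness each star meets
  finitely many edges. The set \<open>gcarrier V0 E0\<close> may lack endpoints of
  \<open>E0\<close>, so it need not be a subgraph.\<close>

lemma compactin_imp_finite_subgraph:
  assumes K: "compactin G K" and lf: "locally_finite_graph V Ed src tgt"
  obtains V0 E0 where "finite V0" "finite E0" "V0 \<subseteq> V" "E0 \<subseteq> Ed" "K \<subseteq> gcarrier V0 E0"
proof -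
  let ?U = "star ` V \<union> ecell ` Ed"
  have "K \<subseteq> topspace G" using K compactin_subset_topspace by blast
  then have "K \<subseteq> \<Union> ?U" by (auto simp: gcarrier_def star_def ecell_def)
  moreover have "\<And>U. U \<in> ?U \<Longrightarrow> openin G U" using openin_star openin_ecell by auto
  ultimately obtain F where F: "finite F" "F \<subseteq> ?U" "K \<subseteq> \<Union>F"
    using K unfolding compactin_def by meson
  obtain V1 where V1: "V1 \<subseteq> V" "finite V1" "F \<inter> star ` V = star ` V1"
    using finite_subset_image[of "F \<inter> star ` V" star V] F(1) by blast
  obtain E1 where E1: "E1 \<subseteq> Ed" "finite E1" "F \<inter> ecell ` Ed = ecell ` E1"
    using finite_subset_image[of "F \<inter> ecell ` Ed" ecell Ed] F(1) by blast
  have "F = star ` V1 \<union> ecell ` E1"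
    unfolding V1(3)[symmetric] E1(3)[symmetric] Int_Un_distrib[symmetric]
    by (rule Int_absorb2[symmetric]) (rule F(2))
  note VE = V1(1,2) E1(1,2) this
  let ?E0 = "E1 \<union> (\<Union>v\<in>V1. {e \<in> Ed. src e = v \<or> tgt e = v})"
  show thesis
  proof (rule that)
    show "finite V1" by fact
    show "finite ?E0" using VE lf by (auto simp: locally_finite_graph_def)
    show "V1 \<subseteq> V" by fact
    show "?E0 \<subseteq> Ed" using VE by auto
    have "star v \<subseteq> gcarrier V1 ?E0" if "v \<in> V1" for v using that by (auto simp: gcarrier_def star_def)
    moreover have "ecell e \<subseteq> gcarrier V1 ?E0" if "e \<in> E1" for e using that by (auto simp: gcarrier_def ecell_def)
    ultimately show "K \<subseteq> gcarrier V1 ?E0" using F(3) VE(5) by blast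
  qed
qed

end

section \<open>Edge paths\<close>

definition lst :: "('e \<Rightarrow> 'v) \<Rightarrow> ('e \<Rightarrow> 'v) \<Rightarrow> 'e \<times> bool \<Rightarrow> 'v" where
  "lst src tgt a = (if snd a then tgt (fst a) else src (fst a))"

definition lend :: "('e \<Rightarrow> 'v) \<Rightarrow> ('e \<Rightarrow> 'v) \<Rightarrow> 'e \<times> bool \<Rightarrow> 'v" where
  "lend src tgt a = (if snd a then src (fst a) else tgt (fst a))"

definition lpath :: "('e \<Rightarrow> 'v) \<Rightarrow> ('e \<Rightarrow> 'v) \<Rightarrow> 'e \<times> bool \<Rightarrow> real \<Rightarrow> 'v + 'e \<times> real" where
  "lpath src tgt a = (if snd a then prev (gpt src tgt (fst a)) else gpt src tgt (fst a))"

text \<open>Every edge path ends with a constant segment: the path of the one-letter word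
  \<open>[a]\<close> is only homotopic to \<open>lpath src tgt a\<close>, so the edge map of the
  trivial assignment is only homotopic to the identity.\<close>

primrec epath :: "('e \<Rightarrow> 'v) \<Rightarrow> ('e \<Rightarrow> 'v) \<Rightarrow> 'v \<Rightarrow> ('e \<times> bool) list \<Rightarrow> real \<Rightarrow> 'v + 'e \<times> real" where
  "epath src tgt x [] = (\<lambda>_. Inl x)"
| "epath src tgt x (a # w) = pconcat (lpath src tgt a) (epath src tgt (lend src tgt a) w)"

primrec wpath :: "'e set \<Rightarrow> ('e \<Rightarrow> 'v) \<Rightarrow> ('e \<Rightarrow> 'v) \<Rightarrow> 'v \<Rightarrow> ('e \<times> bool) list \<Rightarrow> 'v \<Rightarrow> bool" where
  "wpath Ed src tgt x [] y \<longleftrightarrow> x = y"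
| "wpath Ed src tgt x (a # w) y \<longleftrightarrow> fst a \<in> Ed \<and> lst src tgt a = x \<and> wpath Ed src tgt (lend src tgt a) w y"

definition edge_map :: "('e \<Rightarrow> 'v) \<Rightarrow> ('e \<Rightarrow> 'v) \<Rightarrow> ('e \<Rightarrow> ('e \<times> bool) list) \<Rightarrow> 'v + 'e \<times> real \<Rightarrow> 'v + 'e \<times> real" where
  "edge_map src tgt P z = (case z of Inl v \<Rightarrow> Inl v | Inr (e, t) \<Rightarrow> epath src tgt (src e) (P e) t)"

lemma lst_linv [simp]: "lst src tgt (linv a) = lend src tgt a"
  and lend_linv [simp]: "lend src tgt (linv a) = lst src tgt a"
  and lpath_linv [simp]: "lpath src tgt (linv a) = prev (lpath src tgt a)"
  by (simp_all add: lst_def lend_def lpath_def)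

lemma lst_simps [simp]: "lst src tgt (e, False) = src e" "lst src tgt (e, True) = tgt e"
  and lend_simps [simp]: "lend src tgt (e, False) = tgt e" "lend src tgt (e, True) = src e"
  by (simp_all add: lst_def lend_def)

lemma lpath_ends [simp]: "lpath src tgt a 0 = Inl (lst src tgt a)" "lpath src tgt a 1 = Inl (lend src tgt a)"
  by (simp_all add: lst_def lend_def lpath_def)

lemma epath_0 [simp]: "wpath E src tgt x w y \<Longrightarrow> epath src tgt x w 0 = Inl x"
  by (cases w) auto

lemma epath_1 [simp]: "wpath E src tgt x w y \<Longrightarrow> epath src tgt x w 1 = Inl y"
  by (induction w arbitrary: x) auto

lemma wpath_append: "wpath E src tgt x (u @ v) z \<longleftrightarrow> (\<exists>y. wpath E src tgt x u y \<and> wpath E src tgt y v z)"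
  by (induction u arbitrary: x) auto

lemma wpath_appendI: "wpath E src tgt x u y \<Longrightarrow> wpath E src tgt y v z \<Longrightarrow> wpath E src tgt x (u @ v) z"
  by (auto simp: wpath_append)

lemma wpath_winv: "wpath E src tgt x w y \<Longrightarrow> wpath E src tgt y (winv w) x"
  by (induction w arbitrary: x) (auto simp: wpath_append)

lemma wpath_push: "wpath E src tgt x (a # w) y \<Longrightarrow> wpath E src tgt x (push a w) y"
  by (cases w) (auto simp: push_def)

lemma wpath_fred: "wpath E src tgt x w y \<Longrightarrow> wpath E src tgt x (fred w) y"
  by (induction w arbitrary: x) (auto intro!: wpath_push)

lemma wpath_letters: "wpath E src tgt x w y \<Longrightarrow> fst ` set w \<subseteq> E"
  by (induction w arbitrary: x) auto

lemma wpath_mono: "wpath E src tgt x w y \<Longrightarrow> fst ` set w \<subseteq> E' \<Longrightarrow> wpath E' src tgt x w y"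
  by (induction w arbitrary: x) auto

lemma wpath_sub:
  assumes "wpath E src tgt x w y" "\<And>e. e \<in> fst ` set w \<Longrightarrow> wpath E' src tgt (src e) (P e) (tgt e)"
  shows "wpath E' src tgt x (sub P w) y"
  using assms
proof (induction w arbitrary: x)
  case (Cons a w)
  then have "wpath E' src tgt (src (fst a)) (P (fst a)) (tgt (fst a))" by simp
  then have "wpath E' src tgt x (if snd a then winv (P (fst a)) else P (fst a)) (lend src tgt a)"
    using Cons.prems(1) by (auto simp: lst_def lend_def intro: wpath_winv)
  moreover have "wpath E' src tgt (lend src tgt a) (sub P w) y"
    using Cons by simp
  ultimately show ?case by (auto intro: wpath_appendI)
qed simp

lemma prev_pconcat:
  assumes "pathin T p" "pathin T q" "p 1 = q 0"
  shows "phtpy T (q 1) (p 0) (prev (pconcat p q)) (pconcat (prev q) (prev p))"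
proof (rule phtpy_equal)
  show "pathin T (pconcat (prev q) (prev p))"
    using assms by (intro pathin_pconcat pathin_prev) auto
  fix t :: real assume "t \<in> {0..1}"
  show "prev (pconcat p q) t = pconcat (prev q) (prev p) t"
  proof (cases "t = 1/2")
    case True
    show ?thesis unfolding True using assms by (simp add: prev_def pconcat_def)
  qed (auto simp: prev_def pconcat_def algebra_simps)
qed auto

context graph
begin

abbreviation "ep \<equiv> epath src tgt"
abbreviation "wp \<equiv> wpath Ed src tgt"
abbreviation "ls \<equiv> lst src tgt"
abbreviation "lnd \<equiv> lend src tgt"
abbreviation "lp \<equiv> lpath src tgt"

lemma lst_in [simp]: "fst a \<in> Ed \<Longrightarrow> ls a \<in> V" and lend_in [simp]: "fst a \<in> Ed \<Longrightarrow> lnd a \<in> V"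
  by (simp_all add: lst_def lend_def)

lemma pathin_lpath: "fst a \<in> Ed \<Longrightarrow> pathin G (lp a)"
  by (auto simp: lpath_def intro: pathin_gpt pathin_prev)

lemma wpath_end_in: "wp x w y \<Longrightarrow> x \<in> V \<Longrightarrow> y \<in> V"
  by (induction w arbitrary: x) auto

lemma pathin_epath: "wp x w y \<Longrightarrow> x \<in> V \<Longrightarrow> pathin G (ep x w)"
proof (induction w arbitrary: x)
  case Nil
  then show ?case by (simp add: pathin_def)
next
  case (Cons a w)
  then show ?case by (auto intro!: pathin_pconcat pathin_lpath)
qed

lemma phtpy_epath_append:
  assumes "wp x u y" "wp y v z" "x \<in> V"
  shows "phtpy G (Inl x) (Inl z) (ep x (u @ v)) (pconcat (ep x u) (ep y v))"
  using assms
proof (induction u arbitrary: x)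
  case Nil
  then have "phtpy G (Inl x) (ep x v 1) (pconcat (\<lambda>_. Inl x) (ep x v)) (ep x v)"
    by (intro phtpy_const_left pathin_epath) auto
  with Nil show ?case by (auto intro: phtpy_sym)
next
  case (Cons a u)
  then have a: "fst a \<in> Ed" "ls a = x" "wp (lnd a) u y" "lnd a \<in> V" by auto
  have "phtpy G (Inl x) (Inl z) (ep x ((a # u) @ v)) (pconcat (lp a) (pconcat (ep (lnd a) u) (ep y v)))"
    using phtpy_pconcat[OF phtpy_refl[OF pathin_lpath[OF a(1)]], of "Inl z"] Cons.IH[OF a(3) Cons.prems(2) a(4)] a(2)
    by simp
  also have "phtpy G (Inl x) (Inl z) (pconcat (lp a) (pconcat (ep (lnd a) u) (ep y v)))
      (pconcat (pconcat (lp a) (ep (lnd a) u)) (ep y v))"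
    using phtpy_assoc[OF pathin_lpath[OF a(1)] pathin_epath[OF a(3,4)]
        pathin_epath[OF Cons.prems(2) wpath_end_in[OF a(3,4)]]] a Cons.prems
    by (intro phtpy_sym[of G _ _ "pconcat (pconcat _ _) _"]) simp
  finally show ?case by simp
qed

text \<open>Pushing a letter either prolongs the path or removes a backtracking \<open>a\<close>,
  \<open>linv a\<close>, which contracts along itself.\<close>

lemma phtpy_epath_fred:
  assumes "wp x w y" "x \<in> V"
  shows "phtpy G (Inl x) (Inl y) (ep x w) (ep x (fred w))"
  using assms
proof (induction w arbitrary: x)
  case Nil
  then show ?case using phtpy_refl[of G "\<lambda>_. Inl y"] by (simp add: pathin_def)
next
  case (Cons a w)
  then have a: "fst a \<in> Ed" "ls a = x" "wp (lnd a) w y" "lnd a \<in> V" by auto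
  have 1: "phtpy G (Inl x) (Inl y) (ep x (a # w)) (ep x (a # fred w))"
    using phtpy_pconcat[OF phtpy_refl[OF pathin_lpath[OF a(1)]], of "Inl y"] Cons.IH[OF a(3,4)] a(2) by simp
  show ?case
  proof (cases "\<exists>v. fred w = linv a # v")
    case True
    then obtain v where v: "fred w = linv a # v" by blast
    then have vp: "wp x v y" using wpath_fred[OF a(3)] a by simp
    have "phtpy G (Inl x) (Inl y) (ep x (a # linv a # v)) (pconcat (pconcat (lp a) (prev (lp a))) (ep x v))"
      using phtpy_assoc[OF pathin_lpath[OF a(1)] pathin_prev[OF pathin_lpath[OF a(1)]] pathin_epath[OF vp Cons.prems(2)]]
        vp a
      by (intro phtpy_sym[of G _ _ "pconcat (pconcat _ _) _"]) simp
    also have "phtpy G (Inl x) (Inl y) \<dots> (pconcat (\<lambda>_. Inl x) (ep x v))"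
      by (rule phtpy_pconcat)
         (use phtpy_prev_right[OF pathin_lpath[OF a(1)]] phtpy_refl[OF pathin_epath[OF vp Cons.prems(2)]] a vp in simp_all)
    also have "phtpy G (Inl x) (Inl y) \<dots> (ep x v)"
      using phtpy_const_left[OF pathin_epath[OF vp Cons.prems(2)], of "Inl x"] vp by simp
    finally show ?thesis using phtpy_trans[OF 1] v by (simp add: push_def)
  next
    case False
    then have "push a (fred w) = a # fred w" by (auto simp: push_def split: list.split)
    with 1 show ?thesis by simp
  qed
qed

lemma phtpy_epath_feq:
  assumes "wp x u y" "wp x v y" "x \<in> V" "feq u v"
  shows "phtpy G (Inl x) (Inl y) (ep x u) (ep x v)"
  using phtpy_epath_fred[OF assms(1,3)] phtpy_sym[OF phtpy_epath_fred[OF assms(2,3)]] assms(4)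
  unfolding feq_def by (metis phtpy_trans)

lemma phtpy_epath_single:
  assumes "fst a \<in> Ed"
  shows "phtpy G (Inl (ls a)) (Inl (lnd a)) (ep (ls a) [a]) (lp a)"
  using phtpy_const_right[OF pathin_lpath[OF assms], of "Inl (lnd a)"] by simp

lemma phtpy_epath_winv:
  assumes "wp x w y" "x \<in> V"
  shows "phtpy G (Inl y) (Inl x) (ep y (winv w)) (prev (ep x w))"
  using assms
proof (induction w arbitrary: x)
  case Nil
  then show ?case using phtpy_refl[of G "\<lambda>_. Inl y"] by (simp add: pathin_def prev_def)
next
  case (Cons a w)
  then have a: "fst a \<in> Ed" "ls a = x" "wp (lnd a) w y" "lnd a \<in> V" by auto
  have "phtpy G (Inl y) (Inl x) (ep y (winv (a # w))) (pconcat (ep y (winv w)) (ep (lnd a) [linv a]))"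
    using phtpy_epath_append[OF wpath_winv[OF a(3)], of "[linv a]" x] a wpath_end_in[OF a(3,4)] by simp
  also have "phtpy G (Inl y) (Inl x) \<dots> (pconcat (prev (ep (lnd a) w)) (prev (lp a)))"
    using phtpy_pconcat[OF Cons.IH[OF a(3,4)]] phtpy_epath_single[of "linv a"] a by simp
  also have "phtpy G (Inl y) (Inl x) \<dots> (prev (ep x (a # w)))"
    using phtpy_sym[OF prev_pconcat[OF pathin_lpath[OF a(1)] pathin_epath[OF a(3,4)]]] a by simp
  finally show ?case .
qed

lemma edge_map_Inl [simp]: "edge_map src tgt P (Inl v) = Inl v"
  by (simp add: edge_map_def)

lemma edge_map_gpt:
  assumes "wpath E src tgt (src e) (P e) (tgt e)"
  shows "edge_map src tgt P (gp e t) = ep (src e) (P e) t"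
  using assms by (auto simp: edge_map_def gpt_def)

text \<open>An edge map commutes with concatenation, so it acts on edge paths letter by letter.
  Composition of edge maps and their action on loops thus become calculations with
  \<open>sub\<close>.\<close>

lemma phtpy_edge_map_epath:
  assumes "wpath E src tgt x w y" "\<And>e. e \<in> fst ` set w \<Longrightarrow> wp (src e) (P e) (tgt e)" "x \<in> V"
    and "fst ` set w \<subseteq> E" "src ` E \<subseteq> V" "tgt ` E \<subseteq> V"
  shows "phtpy G (Inl x) (Inl y) (edge_map src tgt P \<circ> ep x w) (ep x (sub P w))"
  using assms
proof (induction w arbitrary: x)
  case Nil
  then show ?case using phtpy_refl[of G "\<lambda>_. Inl y"] by (simp add: pathin_def comp_def)
next
  case (Cons a w)
  let ?f = "edge_map src tgt P"
  let ?Pa = "if snd a then winv (P (fst a)) else P (fst a)"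
  have a: "fst a \<in> E" "ls a = x" "wpath E src tgt (lnd a) w y" "lnd a \<in> V"
    using Cons.prems by (auto simp: lend_def)
  have P: "wp (src (fst a)) (P (fst a)) (tgt (fst a))" using Cons.prems(2) by simp
  have Pa: "wp x ?Pa (lnd a)" using P a(2) by (auto simp: lst_def lend_def intro: wpath_winv)
  have "src (fst a) \<in> V" using a(1) Cons.prems by auto
  have "?f \<circ> lp a = (if snd a then prev (ep (src (fst a)) (P (fst a))) else ep (src (fst a)) (P (fst a)))"
    using edge_map_gpt[where P = P and e = "fst a", OF P] by (auto simp: lpath_def prev_def fun_eq_iff)
  then have fa: "phtpy G (Inl x) (Inl (lnd a)) (?f \<circ> lp a) (ep x ?Pa)"
    using phtpy_sym[OF phtpy_epath_winv[OF P \<open>src (fst a) \<in> V\<close>]] a(2)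
      phtpy_refl[OF pathin_epath[OF P \<open>src (fst a) \<in> V\<close>]] P
    by (auto simp: lst_def lend_def)
  have e: "?f \<circ> ep x (a # w) = pconcat (?f \<circ> lp a) (?f \<circ> ep (lnd a) w)"
    by (auto simp: pconcat_def fun_eq_iff)
  have 1: "phtpy G (Inl x) (Inl y) (pconcat (?f \<circ> lp a) (?f \<circ> ep (lnd a) w)) (pconcat (ep x ?Pa) (ep (lnd a) (sub P w)))"
    by (rule phtpy_pconcat[OF fa Cons.IH]) (use a Cons.prems in auto)
  have 2: "phtpy G (Inl x) (Inl y) (pconcat (ep x ?Pa) (ep (lnd a) (sub P w))) (ep x (?Pa @ sub P w))"
    by (rule phtpy_sym[OF phtpy_epath_append[OF Pa wpath_sub[OF a(3)]]]) (use Cons.prems in auto)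
  show ?case
    unfolding e sub_simps(3) by (rule phtpy_trans[OF 1 2])
qed

end

section \<open>Homotopic edge paths are freely equal\<close>

text \<open>Instead of evenly covered neighbourhoods only local sections through every point of the fibres are
  required.\<close>
locale cover =
  fixes E :: "'c topology" and T :: "'a topology" and p :: "'c \<Rightarrow> 'a"
  assumes cont: "continuous_map E T p"
    and haus: "Hausdorff_space E"
    and locinj: "\<And>e. e \<in> topspace E \<Longrightarrow> \<exists>U. openin E U \<and> e \<in> U \<and> inj_on p U"
    and even_section: "\<And>x. x \<in> topspace T \<Longrightarrow> \<exists>U. openin T U \<and> x \<in> U \<and> (\<forall>e\<in>topspace E. p e \<in> U \<longrightarrow>
       (\<exists>s. continuous_map (subtopology T U) E s \<and> s (p e) = e \<and> (\<forall>y\<in>U. p (s y) = y)))"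
begin

text \<open>The coincidence set of two lifts is closed because \<open>E\<close> is Hausdorff and
  open because \<open>p\<close> is locally injective.\<close>

lemma lift_unique:
  assumes Z: "connected_space Z" and f: "continuous_map Z E f" and g: "continuous_map Z E g"
    and eq: "\<And>z. z \<in> topspace Z \<Longrightarrow> p (f z) = p (g z)"
    and z0: "z0 \<in> topspace Z" "f z0 = g z0" and z: "z \<in> topspace Z"
  shows "f z = g z"
proof -
  define S where "S = {z \<in> topspace Z. f z = g z}"
  have "closedin Z S" unfolding S_def by (rule closedin_continuous_maps_eq[OF haus f g])
  moreover have "openin Z S"
  proof (subst openin_subopen, intro ballI)
    fix z assume z: "z \<in> S"
    then have "f z \<in> topspace E" using Pi_mem[OF continuous_map_funspace[OF f], of z] by (simp add: S_def)
    then obtain U where U: "openin E U" "f z \<in> U" "inj_on p U" using locinj by blast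
    have "openin Z ({z \<in> topspace Z. f z \<in> U} \<inter> {z \<in> topspace Z. g z \<in> U})"
      by (intro openin_Int openin_continuous_map_preimage[OF f] openin_continuous_map_preimage[OF g] U)
    moreover have "z \<in> {z \<in> topspace Z. f z \<in> U} \<inter> {z \<in> topspace Z. g z \<in> U}"
      using z U by (auto simp: S_def)
    moreover have "{z \<in> topspace Z. f z \<in> U} \<inter> {z \<in> topspace Z. g z \<in> U} \<subseteq> S"
      using inj_onD[OF U(3)] eq by (auto simp: S_def)
    ultimately show "\<exists>T. openin Z T \<and> z \<in> T \<and> T \<subseteq> S" by blast
  qed
  ultimately have "S = {} \<or> S = topspace Z"
    using Z unfolding connected_space_clopen_in by blast
  then show ?thesis using z0 z unfolding S_def by blast
qed

text \<open>Bisection in the second coordinate. Gluing two pieces keeps the smaller width, so only a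
  strip around \<open>s0\<close> is lifted and not the whole square.\<close>

lemma lift_strip:
  assumes H: "continuous_map (top_of_set ({0..1::real} \<times> {0..1::real})) T H"
    and s0: "s0 \<in> {0..1}" and e: "e \<in> topspace E" "p e = H (s0, 0)"
  shows "\<exists>d>0. \<exists>K. continuous_map (top_of_set (({0..1} \<inter> {s0-d<..<s0+d}) \<times> {0..1})) E K \<and> K (s0, 0) = e \<and>
     (\<forall>z\<in>({0..1} \<inter> {s0-d<..<s0+d}) \<times> {0..1}. p (K z) = H z)"
proof -
  define B where "B d = {0..1} \<inter> {s0-d<..<s0+d}" for d
  have B: "is_interval (B d)" for d
    unfolding B_def by (simp add: is_interval_Int is_interval_cc is_interval_oo)
  have s0B: "s0 \<in> B d" if "d > 0" for d using that s0 by (auto simp: B_def)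
  define P where "P a b \<longleftrightarrow> (0 \<le> a \<longrightarrow> a \<le> b \<longrightarrow> b \<le> 1 \<longrightarrow> (\<forall>e\<in>topspace E. p e = H (s0, a) \<longrightarrow>
    (\<exists>d>0. \<exists>K. continuous_map (top_of_set (B d \<times> {a..b})) E K \<and> K (s0, a) = e \<and>
     (\<forall>z\<in>B d \<times> {a..b}. p (K z) = H z))))" for a b :: real
  have "(0::real) \<le> 1" by simp
  then have "P 0 1"
  proof (induction rule: Bolzano)
    case (trans a b c)
    show ?case
      unfolding P_def
    proof (intro impI ballI)
      fix e assume ac: "0 \<le> a" "a \<le> c" "c \<le> 1" and e: "e \<in> topspace E" "p e = H (s0, a)"
      obtain d1 K1 where 1: "d1 > 0" "continuous_map (top_of_set (B d1 \<times> {a..b})) E K1" "K1 (s0, a) = e"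
          "\<And>z. z \<in> B d1 \<times> {a..b} \<Longrightarrow> p (K1 z) = H z"
        using trans e ac unfolding P_def by (meson order_trans)
      have "(s0, b) \<in> B d1 \<times> {a..b}" using s0B[OF 1(1)] trans by auto
      then have "K1 (s0, b) \<in> topspace E" "p (K1 (s0, b)) = H (s0, b)"
        using continuous_map_funspace[OF 1(2)] 1(4) by auto
      then obtain d2 K2 where 2: "d2 > 0" "continuous_map (top_of_set (B d2 \<times> {b..c})) E K2" "K2 (s0, b) = K1 (s0, b)"
          "\<And>z. z \<in> B d2 \<times> {b..c} \<Longrightarrow> p (K2 z) = H z"
        using trans ac unfolding P_def by (meson order_trans)
      define d where "d = min d1 d2"
      have d: "d > 0" "B d \<subseteq> B d1" "B d \<subseteq> B d2" using 1(1) 2(1) by (auto simp: d_def B_def)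
      have K1: "continuous_map (top_of_set (B d \<times> {a..b})) E K1"
        by (rule continuous_map_from_subtopology_mono[OF 1(2)]) (use d in auto)
      have K2: "continuous_map (top_of_set (B d \<times> {b..c})) E K2"
        by (rule continuous_map_from_subtopology_mono[OF 2(2)]) (use d in auto)
      \<comment> \<open>The pieces are chosen to agree at \<open>(s0, b)\<close> only; connectedness
        of \<open>B d\<close> spreads this along the whole seam.\<close>
      have K12: "K1 (s, b) = K2 (s, b)" if "s \<in> B d" for s
      proof (rule lift_unique[of "top_of_set (B d)" "\<lambda>s. K1 (s, b)" "\<lambda>s. K2 (s, b)" s0])
        show "connected_space (top_of_set (B d))" using B by (simp add: connected_space_subtopology)
        have i1: "continuous_map (top_of_set (B d)) (top_of_set (B d \<times> {a..b})) (\<lambda>s. (s, b))"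
          and i2: "continuous_map (top_of_set (B d)) (top_of_set (B d \<times> {b..c})) (\<lambda>s. (s, b))"
          using trans by (auto intro!: continuous_intros)
        show "continuous_map (top_of_set (B d)) E (\<lambda>s. K1 (s, b))"
          using continuous_map_compose[OF i1 K1] by (simp add: comp_def)
        show "continuous_map (top_of_set (B d)) E (\<lambda>s. K2 (s, b))"
          using continuous_map_compose[OF i2 K2] by (simp add: comp_def)
        show "p (K1 (z, b)) = p (K2 (z, b))" if "z \<in> topspace (top_of_set (B d))" for z
          using 1(4)[of "(z, b)"] 2(4)[of "(z, b)"] that subsetD[OF d(2), of z] subsetD[OF d(3), of z] trans by simp
      qed (use that s0B[OF d(1)] 2(3) in auto)
      define K where "K z = (if snd z \<le> b then K1 z else K2 z)" for z
      have "continuous_map (top_of_set (B d \<times> {a..c})) E K"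
        unfolding K_def
      proof (rule continuous_map_cases_le)
        have eq: "subtopology (top_of_set (B d \<times> {a..c})) {x \<in> topspace (top_of_set (B d \<times> {a..c})). snd x \<le> b} = top_of_set (B d \<times> {a..b})"
           "subtopology (top_of_set (B d \<times> {a..c})) {x \<in> topspace (top_of_set (B d \<times> {a..c})). b \<le> snd x} = top_of_set (B d \<times> {b..c})"
          using trans(3,4) by (auto simp: subtopology_subtopology intro!: arg_cong[of _ _ "subtopology euclidean"])
        show "continuous_map (subtopology (top_of_set (B d \<times> {a..c})) {x \<in> topspace (top_of_set (B d \<times> {a..c})). snd x \<le> b}) E K1"
          unfolding eq by (rule K1)
        show "continuous_map (subtopology (top_of_set (B d \<times> {a..c})) {x \<in> topspace (top_of_set (B d \<times> {a..c})). b \<le> snd x}) E K2"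
          unfolding eq by (rule K2)
        show "K1 x = K2 x" if "x \<in> topspace (top_of_set (B d \<times> {a..c}))" "snd x = b" for x
          using K12[of "fst x"] that by auto
      qed (auto intro!: continuous_intros)
      moreover have "K (s0, a) = e" using 1(3) trans(3) by (simp add: K_def)
      moreover have "p (K z) = H z" if "z \<in> B d \<times> {a..c}" for z
        using 1(4)[of z] 2(4)[of z] that d by (auto simp: K_def)
      ultimately show "\<exists>d>0. \<exists>K. continuous_map (top_of_set (B d \<times> {a..c})) E K \<and> K (s0, a) = e \<and>
         (\<forall>z\<in>B d \<times> {a..c}. p (K z) = H z)"
        using d(1) by blast
    qed
  next
    case (local x)
    then have "(s0, x) \<in> {0..1} \<times> {0..1}" using s0 by auto
    then have "H (s0, x) \<in> topspace T" using continuous_map_funspace[OF H] by auto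
    then obtain U where U: "openin T U" "H (s0, x) \<in> U" "\<And>e. e \<in> topspace E \<Longrightarrow> p e \<in> U \<Longrightarrow>
       \<exists>s. continuous_map (subtopology T U) E s \<and> s (p e) = e \<and> (\<forall>y\<in>U. p (s y) = y)"
      using even_section by meson
    have "openin (top_of_set ({0..1} \<times> {0..1})) {z \<in> {0..1} \<times> {0..1}. H z \<in> U}"
      using openin_continuous_map_preimage[OF H U(1)] by simp
    then obtain r where r: "r > 0" "ball (s0, x) r \<inter> {0..1} \<times> {0..1} \<subseteq> {z \<in> {0..1} \<times> {0..1}. H z \<in> U}"
      using \<open>(s0, x) \<in> {0..1} \<times> {0..1}\<close> U(2) unfolding openin_contains_ball by blast
    \<comment> \<open>Less than \<open>r/2\<close> in each coordinate keeps the box inside the ball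
      of radius \<open>r\<close>.\<close>
    show ?case
    proof (intro exI[of _ "r/2"] conjI allI impI)
      fix a b assume ab: "a \<le> x \<and> x \<le> b \<and> b - a < r/2"
      have inU: "H z \<in> U" if in_box: "z \<in> B (r/2) \<times> {a..b}" "0 \<le> a" "b \<le> 1" for z
      proof -
        obtain s t where z: "z = (s, t)" "s \<in> {0..1}" "s0 - r/2 < s" "s < s0 + r/2" "a \<le> t" "t \<le> b"
          using in_box by (cases z) (auto simp: B_def)
        have "dist (s0, x) (s, t) \<le> \<bar>s0 - s\<bar> + \<bar>x - t\<bar>"
          using sqrt_sum_squares_le_sum_abs by (simp add: dist_Pair_Pair dist_real_def)
        also have "\<dots> < r" using z ab by (simp add: abs_if)
        finally have "z \<in> ball (s0, x) r \<inter> {0..1} \<times> {0..1}" using z in_box by auto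
        with r show ?thesis by auto
      qed
      show "P a b"
        unfolding P_def
      proof (intro impI ballI)
        fix e assume *: "0 \<le> a" "a \<le> b" "b \<le> 1" and e: "e \<in> topspace E" "p e = H (s0, a)"
        have "H (s0, a) \<in> U" using inU[of "(s0, a)"] s0B[of "r/2"] r(1) * by auto
        then obtain s where s: "continuous_map (subtopology T U) E s" "s (p e) = e" "\<forall>y\<in>U. p (s y) = y"
          using U(3)[of e] e by auto
        have "continuous_map (top_of_set (B (r/2) \<times> {a..b})) (subtopology T U) H"
          using inU * by (intro continuous_map_into_subtopology continuous_map_from_subtopology_mono[OF H]) (auto simp: B_def)
        from continuous_map_compose[OF this s(1)]
        show "\<exists>d>0. \<exists>K. continuous_map (top_of_set (B d \<times> {a..b})) E K \<and> K (s0, a) = e \<and>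
         (\<forall>z\<in>B d \<times> {a..b}. p (K z) = H z)"
          using r(1) s e inU * by (intro exI[of _ "r/2"] conjI exI[of _ "s \<circ> H"]) auto
      qed
    qed (use r in auto)
  qed
  then show ?thesis using e unfolding P_def B_def by auto
qed

text \<open>No lift of the entire homotopy is built. By the strips, the end of a lift of
  \<open>H (s, t)\<close> in \<open>t\<close> is locally constant in \<open>s\<close>, hence
  constant by bisection.\<close>

lemma phtpy_lift_end:
  assumes qr: "phtpy T a b q r"
    and q': "pathin E q'" "\<And>t. t \<in> {0..1} \<Longrightarrow> p (q' t) = q t"
    and r': "pathin E r'" "\<And>t. t \<in> {0..1} \<Longrightarrow> p (r' t) = r t"
    and start: "q' 0 = r' 0"
  shows "q' 1 = r' 1"
proof -
  obtain H where H: "continuous_map (top_of_set ({0..1::real} \<times> {0..1::real})) T H"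
    "\<And>x. H (0, x) = q x" "\<And>x. H (1, x) = r x" "\<And>t. t \<in> {0..1} \<Longrightarrow> H (t, 0) = a \<and> H (t, 1) = b"
    using phtpyE[OF qr] by metis
  define e where "e = q' 0"
  have "(0::real) \<in> {0..1}" by simp
  then have e: "e \<in> topspace E" using continuous_map_funspace[OF q'(1)[unfolded pathin_def]] by (auto simp: e_def)
  have pe: "p e = a" using q'(2)[of 0] H(2)[of 0] H(4)[of 0] by (simp add: e_def)
  define lift where "lift s f \<longleftrightarrow> pathin E f \<and> f 0 = e \<and> (\<forall>t\<in>{0..1}. p (f t) = H (s, t))" for s f
  define P where "P s s' \<longleftrightarrow> (0 \<le> s \<longrightarrow> s \<le> s' \<longrightarrow> s' \<le> 1 \<longrightarrow> (\<forall>f f'. lift s f \<longrightarrow> lift s' f' \<longrightarrow> f 1 = f' 1))" for s s'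
  have strip: "\<exists>d>0. \<forall>s\<in>{0..1}. \<bar>s - s0\<bar> < d \<longrightarrow> (\<exists>f. lift s f) \<and> (\<forall>f g. lift s0 f \<longrightarrow> lift s g \<longrightarrow> f 1 = g 1)"
    if s0: "s0 \<in> {0..1}" for s0
  proof -
    obtain d K where d: "d > 0" and K: "continuous_map (top_of_set (({0..1} \<inter> {s0-d<..<s0+d}) \<times> {0..1})) E K"
      "K (s0, 0) = e" "\<And>z. z \<in> ({0..1} \<inter> {s0-d<..<s0+d}) \<times> {0..1} \<Longrightarrow> p (K z) = H z"
      using lift_strip[OF H(1) s0 e] pe H(4)[OF s0] by metis
    define B where "B = {0..1} \<inter> {s0-d<..<s0+d}"
    have B: "connected_space (top_of_set B)" "s0 \<in> B"
      using d s0 unfolding B_def by (auto simp: connected_space_subtopology is_interval_Int is_interval_cc is_interval_oo)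
    have I: "connected_space (top_of_set {0..1::real})" by (simp add: connected_space_subtopology)
    have Kt: "continuous_map (top_of_set B) E (\<lambda>s. K (s, t))" if "t \<in> {0..1}" for t
    proof -
      have "continuous_map (top_of_set B) (top_of_set (B \<times> {0..1})) (\<lambda>s. (s, t))"
        using that by (auto intro!: continuous_intros)
      from continuous_map_compose[OF this K(1)[folded B_def]] show ?thesis by (simp add: comp_def)
    qed
    \<comment> \<open>For \<open>t\<close> equal to 0 or 1 the path \<open>H (s, t)\<close> in
      \<open>s\<close> is constant, so its lift is constant too.\<close>
    have const: "K (s, t) = K (s0, t)" if t: "t = 0 \<or> t = 1" and s: "s \<in> B" for s t
    proof (rule lift_unique[OF B(1) Kt, of t "\<lambda>_. K (s0, t)" s0])
      have "K (s0, t) \<in> topspace E"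
        using continuous_map_funspace[OF K(1)[folded B_def]] B(2) t by auto
      then show "continuous_map (top_of_set B) E (\<lambda>_. K (s0, t))" by simp
      show "p (K (z, t)) = p (K (s0, t))" if "z \<in> topspace (top_of_set B)" for z
        using K(3)[of "(z, t)"] K(3)[of "(s0, t)"] H(4)[of z] H(4)[of s0] that t B(2) unfolding B_def by auto
    qed (use t s B in auto)
    have lK: "lift s (\<lambda>t. K (s, t))" if "s \<in> B" for s
      unfolding lift_def
    proof (intro conjI ballI)
      have "continuous_map (top_of_set {0..1}) (top_of_set (B \<times> {0..1})) (\<lambda>t. (s, t))"
        using that by (auto intro!: continuous_intros)
      from continuous_map_compose[OF this K(1)[folded B_def]] show "pathin E (\<lambda>t. K (s, t))"
        by (simp add: comp_def pathin_def)
      show "K (s, 0) = e" using const[of 0 s] that K(2) by simp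
    qed (use K(3) that in \<open>auto simp: B_def\<close>)
    have uniq: "f 1 = g 1" if "lift s f" "lift s g" for s f g
      by (rule lift_unique[OF I, of f g 0]) (use that in \<open>auto simp: lift_def pathin_def\<close>)
    have "f 1 = g 1" if "s \<in> B" "lift s0 f" "lift s g" for s f g
      using uniq[OF that(2) lK[OF B(2)]] uniq[OF that(3) lK[OF that(1)]] const[of 1 s] that(1) by simp
    moreover have "s \<in> B" if "s \<in> {0..1}" "\<bar>s - s0\<bar> < d" for s using that by (auto simp: B_def)
    ultimately show ?thesis using d lK by blast
  qed
  have "(0::real) \<le> 1" by simp
  then have "P 0 1"
  proof (induction rule: Bolzano)
    case (trans a b c)
    show ?case unfolding P_def
    proof (intro impI allI)
      fix f f' assume *: "0 \<le> a" "a \<le> c" "c \<le> 1" "lift a f" "lift c f'"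
      then have "b \<in> {0..1}" using trans by auto
      \<comment> \<open>Without a lift at \<open>b\<close> the two induction hypotheses would be
        vacuous.\<close>
      then obtain g where "lift b g" using strip[of b] by force
      then have "f 1 = g 1" "g 1 = f' 1" using trans * unfolding P_def by (meson order_trans)+
      then show "f 1 = f' 1" by simp
    qed
  next
    case (local x)
    then obtain d where d: "d > 0" "\<And>s f g. s \<in> {0..1} \<Longrightarrow> \<bar>s - x\<bar> < d \<Longrightarrow> lift x f \<Longrightarrow> lift s g \<Longrightarrow> f 1 = g 1"
       "\<exists>f. lift x f"
      using strip[of x] by force
    show ?case
    proof (intro exI[of _ d] conjI allI impI)
      fix a b assume ab: "a \<le> x \<and> x \<le> b \<and> b - a < d"
      show "P a b"
        unfolding P_def
      proof (intro impI allI)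
        fix f f' assume *: "0 \<le> a" "a \<le> b" "b \<le> 1" "lift a f" "lift b f'"
        obtain g where "lift x g" using d(3) by blast
        then show "f 1 = f' 1" using d(2)[of a g f] d(2)[of b g f'] * ab by auto
      qed
    qed (use d in auto)
  qed
  moreover have "lift 0 q'" using q' H(2) by (auto simp: lift_def e_def)
  moreover have "lift 1 r'" using r' H(3) start by (auto simp: lift_def e_def)
  ultimately show ?thesis unfolding P_def by auto
qed

end

text \<open>The universal cover: its fibre consists of the reduced words, and crossing an edge \<open>e\<close> pushes the
  letter \<open>e\<close>, so the lift of an edge path \<open>w\<close> from the empty word ends at the reduction of \<open>rev w\<close>.\<close>
definition cov_src :: "('e \<Rightarrow> 'v) \<Rightarrow> 'e \<times> ('e \<times> bool) list \<Rightarrow> 'v \<times> ('e \<times> bool) list" where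
  "cov_src src d = (src (fst d), snd d)"

definition cov_tgt :: "('e \<Rightarrow> 'v) \<Rightarrow> 'e \<times> ('e \<times> bool) list \<Rightarrow> 'v \<times> ('e \<times> bool) list" where
  "cov_tgt tgt d = (tgt (fst d), push (fst d, False) (snd d))"

definition cov_proj :: "('v \<times> 'b) + ('e \<times> 'b) \<times> real \<Rightarrow> 'v + 'e \<times> real" where
  "cov_proj = map_sum fst (map_prod fst id)"

text \<open>The edge \<open>(e, c)\<close> leads from sheet \<open>c\<close> to sheet
  \<open>push (e, False) c\<close>; crossing \<open>e\<close> backwards from sheet \<open>b\<close>
  therefore uses the copy labelled \<open>push (e, True) b\<close>.\<close>

primrec cov_lift :: "('e \<times> bool) list \<Rightarrow> ('e \<times> bool) list \<Rightarrow> (('e \<times> ('e \<times> bool) list) \<times> bool) list" where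
  "cov_lift b [] = []"
| "cov_lift b (a # w) = ((fst a, if snd a then push a b else b), snd a) # cov_lift (push a b) w"

lemma cov_proj_gpt: "cov_proj (gpt (cov_src src) (cov_tgt tgt) d t) = gpt src tgt (fst d) t"
  by (auto simp: gpt_def cov_proj_def cov_src_def cov_tgt_def)

lemma cov_proj_simps [simp]: "cov_proj (Inl u) = Inl (fst u)" "cov_proj (Inr (d, t)) = Inr (fst d, t)"
  by (simp_all add: cov_proj_def)

lemma wpath_cov_lift:
  assumes "isred b" "wpath E src tgt x w y"
  shows "wpath (E \<times> Collect isred) (cov_src src) (cov_tgt tgt) (x, b) (cov_lift b w) (y, foldl (\<lambda>b a. push a b) b w)"
  using assms
proof (induction w arbitrary: x b)
  case (Cons a w)
  obtain e c where a: "a = (e, c)" by (cases a)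
  have "push (e, False) (push (e, True) b) = b"
    using push_linv'[OF Cons.prems(1), of "(e, False)"] by (simp add: linv_def)
  then show ?case
    using Cons.IH[OF isred_push[OF Cons.prems(1), of a]] Cons.prems isred_push[OF Cons.prems(1), of a]
    by (cases c) (auto simp: a cov_src_def cov_tgt_def)
qed simp

lemma cov_proj_lpath: "cov_proj (lpath (cov_src src) (cov_tgt tgt) a t) = lpath src tgt (fst (fst a), snd a) t"
  by (auto simp: lpath_def prev_def cov_proj_gpt)

lemma cov_proj_epath:
  assumes "isred b" "wpath E src tgt x w y"
  shows "cov_proj (epath (cov_src src) (cov_tgt tgt) (x, b) (cov_lift b w) t) = epath src tgt x w t"
  using assms
proof (induction w arbitrary: x b t)
  case (Cons a w)
  let ?d = "((fst a, if snd a then push a b else b), snd a)"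
  have "wpath (E \<times> Collect isred) (cov_src src) (cov_tgt tgt) (x, b) (cov_lift b (a # w)) (y, foldl (\<lambda>b a. push a b) b (a # w))"
    by (rule wpath_cov_lift[OF Cons.prems])
  then have "fst (lend (cov_src src) (cov_tgt tgt) ?d) = lend src tgt a"
    by (simp add: lend_def cov_src_def cov_tgt_def)
  moreover have "snd (lend (cov_src src) (cov_tgt tgt) ?d) = push a b"
    by (cases a) (auto simp: lend_def cov_src_def cov_tgt_def)
  ultimately have "lend (cov_src src) (cov_tgt tgt) ?d = (lend src tgt a, push a b)"
    by (simp add: prod_eq_iff)
  then show ?case
    using Cons.IH[OF isred_push[OF Cons.prems(1), of a], of "lend src tgt a"] Cons.prems
    by (auto simp: pconcat_def cov_proj_lpath)
qed simp

lemma foldl_push: "foldl (\<lambda>b a. push a b) [] w = fred (rev w)"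
  by (simp add: fred_def foldr_conv_foldl)

context graph
begin

text \<open>A radius of at most 1/2 keeps the two ends of an edge apart, even of a loop: 1/2 serves
  for sections of the covering, 1/3 for the contraction by \<open>collapse\<close>.\<close>

definition pstar :: "real \<Rightarrow> 'v \<Rightarrow> ('v + 'e \<times> real) set" where
  "pstar r v = insert (Inl v) ({Inr (e, t) | e t. e \<in> Ed \<and> src e = v \<and> 0 < t \<and> t < r} \<union>
     {Inr (e, t) | e t. e \<in> Ed \<and> tgt e = v \<and> 1 - r < t \<and> t < 1})"

lemma pstar_gpt:
  assumes "0 < r" "r \<le> 1/2" "e \<in> Ed" "t \<in> {0..1}"
  shows "gp e t \<in> pstar r v \<longleftrightarrow> src e = v \<and> t < r \<or> tgt e = v \<and> 1 - r < t"
  using assms by (auto simp: gpt_def pstar_def)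

lemma openin_pstar:
  assumes "0 < r" "r \<le> 1/2" "v \<in> V"
  shows "openin G (pstar r v)"
  unfolding openin_graph_top gopen_def
proof (intro conjI ballI)
  show "pstar r v \<subseteq> gcarrier V Ed" using assms by (auto simp: pstar_def gcarrier_def)
  fix e assume e: "e \<in> Ed"
  have "{t \<in> {0..1}. gp e t \<in> pstar r v} = {0..1} \<inter> ((if src e = v then {..<r} else {}) \<union> (if tgt e = v then {1-r<..} else {}))"
    using pstar_gpt[OF assms(1,2) e] by auto
  moreover have "open ((if src e = v then {..<r} else {}) \<union> (if tgt e = v then {1-r<..} else {}))" by auto
  ultimately show "openin (top_of_set {0..1}) {t \<in> {0..1}. gp e t \<in> pstar r v}"
    using openin_open by metis
qed

text \<open>Every reduced word lies over every vertex, whether or not it can be read along an edge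
  path. The space is in general disconnected, and each lifted path stays in one component.\<close>

abbreviation "CG \<equiv> graph_top (V \<times> Collect isred) (Ed \<times> Collect isred) (cov_src src) (cov_tgt tgt)"

section \<open>The covering projection and its local sections\<close>

lemma graph_cov: "graph (V \<times> Collect isred) (Ed \<times> Collect isred) (cov_src src) (cov_tgt tgt)"
  by unfold_locales (auto simp: is_graph_def cov_src_def cov_tgt_def intro: isred_push)

text \<open>The sheet is prescribed at the centre \<open>v\<close>. An incoming half edge has to end
  in sheet \<open>b\<close>, hence carries the label \<open>push (e, True) b\<close>; the midpoint,
  where the label of a loop would jump, lies outside the star.\<close>

lemma cov_section_star:
  assumes v: "v \<in> V" and b: "isred b"
  defines "s \<equiv> (\<lambda>y. case y of Inl u \<Rightarrow> Inl (u, b) | Inr (e, t) \<Rightarrow> Inr ((e, if t < 1/2 then b else push (e, True) b), t))"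
  shows "continuous_map (subtopology G (pstar (1/2) v)) CG s"
proof -
  interpret C: graph "V \<times> Collect isred" "Ed \<times> Collect isred" "cov_src src" "cov_tgt tgt"
    by (rule graph_cov)
  have U: "openin G (pstar (1/2) v)" using openin_pstar[of "1/2"] v by simp
  have pp: "push (e, False) (push (e, True) b) = b" for e
    using push_linv'[OF b, of "(e, False)"] by (simp add: linv_def)
  have s1: "s (gp e t) = C.gp (e, b) t" if "src e = v" "t < 1/2" for e t
    using that by (auto simp: s_def gpt_def cov_src_def)
  have s2: "s (gp e t) = C.gp (e, push (e, True) b) t" if "tgt e = v" "1/2 < t" for e t
    using that by (auto simp: s_def gpt_def cov_tgt_def pp)
  have mem: "s y \<in> topspace CG" if "y \<in> pstar (1/2) v" for y
    using that v b by (auto simp: s_def pstar_def C.topspace_graph gcarrier_def intro: isred_push)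
  have "openin G {y \<in> pstar (1/2) v. s y \<in> W}" if W: "openin CG W" for W
    unfolding openin_graph_top gopen_def
  proof (intro conjI ballI)
    show "{y \<in> pstar (1/2) v. s y \<in> W} \<subseteq> gcarrier V Ed" using openin_subset[OF U] by auto
    fix e assume e: "e \<in> Ed"
    let ?O = "\<lambda>c. {t \<in> {0..1}. C.gp (e, c) t \<in> W}"
    have o': "openin (top_of_set {0..1}) (?O c)" if "isred c" for c
      using W e that unfolding openin_graph_top gopen_def by auto
    have o: "openin (top_of_set {0..1}) (?O b)" "openin (top_of_set {0..1}) (?O (push (e, True) b))"
      by (rule o'[OF b], rule o'[OF isred_push[OF b]])
    have eq: "{t \<in> {0..1}. gp e t \<in> {y \<in> pstar (1/2) v. s y \<in> W}} =
      (if src e = v then {0..1} \<inter> {..<1/2} else {}) \<inter> ?O b \<union>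
      (if tgt e = v then {0..1} \<inter> {1/2<..} else {}) \<inter> ?O (push (e, True) b)"
      using pstar_gpt[of "1/2" e _ v] e s1[of e] s2[of e] by auto
    have "openin (top_of_set {0..1}) (if src e = v then {0..1} \<inter> {..<1/2::real} else {})"
      "openin (top_of_set {0..1}) (if tgt e = v then {0..1} \<inter> {(1/2::real)<..} else {})"
      by (auto intro: openin_open_Int)
    with o show "openin (top_of_set {0..1}) {t \<in> {0..1}. gp e t \<in> {y \<in> pstar (1/2) v. s y \<in> W}}"
      unfolding eq by (intro openin_Un openin_Int)
  qed
  moreover have "topspace (subtopology G (pstar (1/2) v)) = pstar (1/2) v"
    using openin_subset[OF U] by auto
  ultimately show ?thesis
    unfolding continuous_map_def using mem by (auto simp: openin_open_subtopology[OF U])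
qed

lemma cov_section_cell:
  assumes e: "e \<in> Ed" and b: "isred b"
  defines "s \<equiv> (\<lambda>y. case y of Inl u \<Rightarrow> Inl (u, b) | Inr (e, t) \<Rightarrow> Inr ((e, b), t))"
  shows "continuous_map (subtopology G (ecell e)) CG s"
proof -
  interpret C: graph "V \<times> Collect isred" "Ed \<times> Collect isred" "cov_src src" "cov_tgt tgt"
    by (rule graph_cov)
  have U: "openin G (ecell e)" using openin_ecell e by simp
  have mem: "s y \<in> topspace CG" if "y \<in> ecell e" for y
    using that e b by (auto simp: s_def ecell_def C.topspace_graph gcarrier_def)
  have "openin G {y \<in> ecell e. s y \<in> W}" if W: "openin CG W" for W
    unfolding openin_graph_top gopen_def
  proof (intro conjI ballI)
    show "{y \<in> ecell e. s y \<in> W} \<subseteq> gcarrier V Ed" using openin_subset[OF U] by auto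
    fix d assume d: "d \<in> Ed"
    have o: "openin (top_of_set {0..1}) {t \<in> {0..1}. C.gp (e, b) t \<in> W}"
      using W e b unfolding openin_graph_top gopen_def by auto
    have eq: "{t \<in> {0..1}. gp d t \<in> {y \<in> ecell e. s y \<in> W}} =
      (if d = e then {0<..<1} else {}) \<inter> {t \<in> {0..1}. C.gp (e, b) t \<in> W}"
      by (auto simp: gpt_def ecell_def s_def)
    have "openin (top_of_set {0..1}) (if d = e then {0<..<1::real} else {})"
      by (auto intro: open_subset)
    with o show "openin (top_of_set {0..1}) {t \<in> {0..1}. gp d t \<in> {y \<in> ecell e. s y \<in> W}}"
      unfolding eq by (intro openin_Int)
  qed
  moreover have "topspace (subtopology G (ecell e)) = ecell e"
    using openin_subset[OF U] by auto
  ultimately show ?thesis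
    unfolding continuous_map_def using mem by (auto simp: openin_open_subtopology[OF U])
qed

lemma cover_graph: "cover CG G cov_proj"
proof -
  interpret C: graph "V \<times> Collect isred" "Ed \<times> Collect isred" "cov_src src" "cov_tgt tgt"
    by (rule graph_cov)
  show ?thesis
  proof
    show "continuous_map CG G cov_proj"
      by (rule C.continuous_map_graphI) (auto simp: cov_proj_gpt intro: pathin_gpt)
    show "Hausdorff_space CG" by (rule C.Hausdorff_graph)
  next
    fix x assume "x \<in> topspace CG"
    then have "x \<in> gcarrier (V \<times> Collect isred) (Ed \<times> Collect isred)" by simp
    then show "\<exists>U. openin CG U \<and> x \<in> U \<and> inj_on cov_proj U"
    proof (cases rule: C.gcarrier_cases)
      case (1 v)
      have "inj_on cov_proj (C.pstar (1/2) v)"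
      proof (rule inj_on_inverseI)
        fix y assume y: "y \<in> C.pstar (1/2) v"
        have pp: "push (e, True) (push (e, False) c) = c" if "isred c" for e :: 'e and c
          using push_linv'[OF that, of "(e, True)"] by (simp add: linv_def)
        from y consider "y = Inl v" | e c t where "y = Inr ((e, c), t)" "(src e, c) = v" "t < 1/2"
          | e c t where "y = Inr ((e, c), t)" "(tgt e, push (e, False) c) = v" "isred c" "1/2 < t"
          by (auto simp: C.pstar_def cov_src_def cov_tgt_def)
        then show "(case cov_proj y of Inl u \<Rightarrow> Inl (u, snd v)
            | Inr (e, t) \<Rightarrow> Inr ((e, if t < 1/2 then snd v else push (e, True) (snd v)), t)) = y"
          by cases (auto simp: pp)
      qed
      then show ?thesis
        using C.openin_pstar[of "1/2" v] 1 by (intro exI[of _ "C.pstar (1/2) v"]) (auto simp: C.pstar_def)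
    next
      case (2 d t)
      have "inj_on cov_proj (C.ecell d)" by (auto simp: inj_on_def C.ecell_def)
      then show ?thesis
        using C.openin_ecell[of d] 2 by (intro exI[of _ "C.ecell d"]) (auto simp: C.ecell_def)
    qed
  next
    fix x assume "x \<in> topspace G"
    then have "x \<in> gcarrier V Ed" by simp
    then show "\<exists>U. openin G U \<and> x \<in> U \<and> (\<forall>e\<in>topspace CG. cov_proj e \<in> U \<longrightarrow>
       (\<exists>s. continuous_map (subtopology G U) CG s \<and> s (cov_proj e) = e \<and> (\<forall>y\<in>U. cov_proj (s y) = y)))"
    proof (cases rule: gcarrier_cases)
      case (1 v)
      show ?thesis
      proof (intro exI[of _ "pstar (1/2) v"] conjI ballI impI)
        show "openin G (pstar (1/2) v)" using openin_pstar[of "1/2"] 1 by simp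
        show "x \<in> pstar (1/2) v" using 1 by (simp add: pstar_def)
        fix z assume z: "z \<in> topspace CG" "cov_proj z \<in> pstar (1/2) v"
        \<comment> \<open>The sheet over the centre of the star: on the far half of an edge it is
          the sheet of the terminal vertex.\<close>
        define b where "b = (case z of Inl u \<Rightarrow> snd u | Inr (d, t) \<Rightarrow> if t < 1/2 then snd d else push (fst d, False) (snd d))"
        have b: "isred b" using z(1) by (auto simp: b_def gcarrier_def intro: isred_push)
        have [simp]: "push (e, True) (push (e, False) c) = c" if "isred c" for e :: 'e and c
          using push_linv'[OF that, of "(e, True)"] by (simp add: linv_def)
        let ?s = "\<lambda>y. case y of Inl u \<Rightarrow> Inl (u, b) | Inr (e, t) \<Rightarrow> Inr ((e, if t < 1/2 then b else push (e, True) b), t)"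
        have "?s (cov_proj z) = z" using z by (auto simp: b_def gcarrier_def)
        moreover have "cov_proj (?s y) = y" for y by (auto split: sum.split)
        ultimately show "\<exists>s. continuous_map (subtopology G (pstar (1/2) v)) CG s \<and> s (cov_proj z) = z \<and>
          (\<forall>y\<in>pstar (1/2) v. cov_proj (s y) = y)"
          using cov_section_star[OF 1(1) b] by blast
      qed
    next
      case (2 e t)
      show ?thesis
      proof (intro exI[of _ "ecell e"] conjI ballI impI)
        show "openin G (ecell e)" "x \<in> ecell e" using openin_ecell 2 by (auto simp: ecell_def)
        fix z assume z: "z \<in> topspace CG" "cov_proj z \<in> ecell e"
        then obtain b t where b: "z = Inr ((e, b), t)" "isred b" by (auto simp: ecell_def gcarrier_def)
        let ?s = "\<lambda>y. case y of Inl u \<Rightarrow> Inl (u, b) | Inr (e, t) \<Rightarrow> Inr ((e, b), t)"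
        have "?s (cov_proj z) = z" using b by simp
        moreover have "cov_proj (?s y) = y" for y by (auto split: sum.split)
        ultimately show "\<exists>s. continuous_map (subtopology G (ecell e)) CG s \<and> s (cov_proj z) = z \<and>
          (\<forall>y\<in>ecell e. cov_proj (s y) = y)"
          using cov_section_cell[OF 2(1) b(2)] by blast
      qed
    qed
  qed
qed

text \<open>This is the freeness of pi_1: the lifts of both paths from sheet \<open>[]\<close> have
  the same end, and the sheet reached determines the free class.\<close>

theorem homotopic_epath_imp_feq:
  assumes u: "wp x u y" and v: "wp x v y" and x: "x \<in> V" and h: "phtpy G (Inl x) (Inl y) (ep x u) (ep x v)"
  shows "feq u v"
proof -
  interpret C: graph "V \<times> Collect isred" "Ed \<times> Collect isred" "cov_src src" "cov_tgt tgt"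
    by (rule graph_cov)
  have lift: "C.wp (x, []) (cov_lift [] w) (y, fred (rev w))"
    "pathin CG (C.ep (x, []) (cov_lift [] w))" "\<And>t. cov_proj (C.ep (x, []) (cov_lift [] w) t) = ep x w t"
    if "wp x w y" for w
  proof -
    show 1: "C.wp (x, []) (cov_lift [] w) (y, fred (rev w))"
      using wpath_cov_lift[OF successively.simps(1)[THEN iffD2, OF TrueI] that] unfolding foldl_push .
    show "pathin CG (C.ep (x, []) (cov_lift [] w))"
      by (rule C.pathin_epath[OF 1]) (use x in simp)
    show "cov_proj (C.ep (x, []) (cov_lift [] w) t) = ep x w t" for t
      by (rule cov_proj_epath[OF successively.simps(1)[THEN iffD2, OF TrueI] that])
  qed
  have "C.ep (x, []) (cov_lift [] u) 1 = C.ep (x, []) (cov_lift [] v) 1"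
    by (rule cover.phtpy_lift_end[OF cover_graph h])
       (use lift[OF u] lift[OF v] in auto)
  then have "fred (rev u) = fred (rev v)"
    using lift(1)[OF u] lift(1)[OF v] by simp
  then show ?thesis using feq_rev[of "rev u" "rev v"] by (simp add: feq_def)
qed

end

section \<open>Every path between vertices is homotopic to an edge path\<close>

context graph
begin

definition anc :: "'v + 'e \<times> real \<Rightarrow> 'v" where
  "anc x = (case x of Inl v \<Rightarrow> v | Inr (e, t) \<Rightarrow> if t \<le> 1/2 then src e else tgt e)"

definition anc_path :: "'v + 'e \<times> real \<Rightarrow> real \<Rightarrow> 'v + 'e \<times> real" where
  "anc_path x s = (case x of Inl v \<Rightarrow> Inl v | Inr (e, t) \<Rightarrow> gp e ((1 - s) * t + s * of_bool (1/2 < t)))"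

text \<open>\<open>collapse\<close> stretches the middle third of every edge over the whole edge; on the stars of radius
  \<open>1/3\<close> it is the straight-line contraction to the centre, with the advantage of being globally continuous.\<close>
definition collapse :: "real \<times> ('v + 'e \<times> real) \<Rightarrow> 'v + 'e \<times> real" where
  "collapse z = (case snd z of Inl v \<Rightarrow> Inl v
     | Inr (e, t) \<Rightarrow> gp e ((1 - fst z) * t + fst z * max 0 (min 1 (3 * t - 1))))"

lemma anc_in: "x \<in> gcarrier V Ed \<Longrightarrow> anc x \<in> V"
  by (auto simp: anc_def gcarrier_def)

lemma convex_comb_01: "0 \<le> s \<Longrightarrow> s \<le> 1 \<Longrightarrow> 0 \<le> a \<Longrightarrow> a \<le> 1 \<Longrightarrow> 0 \<le> b \<Longrightarrow> b \<le> 1 \<Longrightarrow>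
    (1 - s) * a + s * b \<in> {0..1::real}"
  using convex_bound_le[of a 1 b "1 - s" s] by auto

lemma pathin_anc_path: "x \<in> gcarrier V Ed \<Longrightarrow> pathin G (anc_path x)"
proof (erule gcarrier_cases)
  fix e t assume *: "e \<in> Ed" "0 < t" "t < 1" "x = Inr (e, t)"
  have "(1 - s) * t + s * of_bool (1/2 < t) \<in> {0..1}" if "s \<in> {0..1}" for s
    by (rule convex_comb_01) (use that * in auto)
  then show ?thesis
    unfolding anc_path_def * sum.case prod.case
    by (intro pathin_reparam[OF pathin_gpt[OF *(1)]] image_subsetI continuous_intros)
qed (auto simp: anc_path_def[abs_def] pathin_def)

lemma anc_path_ends [simp]:
  assumes "x \<in> gcarrier V Ed" shows "anc_path x 0 = x" "anc_path x 1 = Inl (anc x)"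
  using assms by (auto simp: anc_path_def anc_def gcarrier_def gpt_def)

lemma continuous_map_collapse: "continuous_map (prod_topology (top_of_set {0..1}) G) G collapse"
proof (rule continuous_map_prod_graphI)
  fix v assume "v \<in> V"
  then show "pathin G (\<lambda>s. collapse (s, Inl v))" by (simp add: collapse_def pathin_def)
next
  fix e assume e: "e \<in> Ed"
  let ?k = "\<lambda>z::real\<times>real. (1 - fst z) * snd z + fst z * max 0 (min 1 (3 * snd z - 1))"
  have k: "?k z \<in> {0..1}" if "z \<in> {0..1} \<times> {0..1}" for z
    by (rule convex_comb_01) (use that in auto)
  have "continuous_map (top_of_set ({0..1} \<times> {0..1})) (top_of_set {0..1}) ?k"
    using k by (auto intro!: continuous_intros simp del: atLeastAtMost_iff)
  from continuous_map_compose[OF this pathin_gpt[OF e, unfolded pathin_def]]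
  have "continuous_map (top_of_set ({0..1} \<times> {0..1})) G (\<lambda>z. gp e (?k z))" by (simp add: comp_def)
  moreover have "collapse (fst z, gp e (snd z)) = gp e (?k z)" for z
    by (auto simp: collapse_def gpt_def)
  ultimately show "continuous_map (top_of_set ({0..1} \<times> {0..1})) G (\<lambda>z. collapse (fst z, gp e (snd z)))"
    by simp
qed

lemma collapse_pstar:
  assumes "x \<in> pstar (1/3) v" "0 \<le> s" "s \<le> 1"
  shows "collapse (s, x) = anc_path x s" "anc x = v"
  using assms by (auto simp: collapse_def anc_path_def anc_def pstar_def max_def min_def)

lemma collapse_0: "x \<in> gcarrier V Ed \<Longrightarrow> collapse (0, x) = x"
  by (auto simp: collapse_def gcarrier_def gpt_def)

definition seg :: "(real \<Rightarrow> 'a) \<Rightarrow> real \<Rightarrow> real \<Rightarrow> real \<Rightarrow> 'a" where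
  "seg q a b = (\<lambda>t. q (a + t * (b - a)))"

lemma seg_in_interval: "0 \<le> t \<Longrightarrow> t \<le> 1 \<Longrightarrow> a \<le> b \<Longrightarrow> a + t * (b - a) \<in> {a..b::real}"
  using mult_left_le_one_le[of "b - a" t] mult_nonneg_nonneg[of t "b - a"]
  unfolding atLeastAtMost_iff by linarith

lemma pathin_seg:
  assumes "pathin T q" "0 \<le> a" "a \<le> b" "b \<le> 1"
  shows "pathin T (seg q a b)"
proof -
  have "a + t * (b - a) \<in> {0..1}" if "t \<in> {0..1}" for t
    using seg_in_interval[of t a b] that assms by auto
  then show ?thesis
    unfolding seg_def by (intro pathin_reparam[OF assms(1)] image_subsetI continuous_intros)
qed

text \<open>Subpaths need not end at vertices, so they are completed by the short paths to the
  anchors \<open>anc\<close>. In this form the property is additive in the interval, as bisection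
  requires.\<close>

definition edge_like :: "(real \<Rightarrow> 'v + 'e \<times> real) \<Rightarrow> real \<Rightarrow> real \<Rightarrow> bool" where
  "edge_like q a b \<longleftrightarrow> (\<exists>w. wp (anc (q a)) w (anc (q b)) \<and>
     phtpy G (q a) (Inl (anc (q b))) (pconcat (seg q a b) (anc_path (q b))) (pconcat (anc_path (q a)) (ep (anc (q a)) w)))"

text \<open>Applying \<open>collapse\<close> along the path gives a square whose far side is
  constant at the centre; its two boundary routes are the required paths, with the empty
  word.\<close>

lemma edge_like_star:
  assumes q: "pathin G q" and ab: "0 \<le> a" "a \<le> b" "b \<le> 1" and v: "v \<in> V"
    and star: "\<And>t. t \<in> {a..b} \<Longrightarrow> q t \<in> pstar (1/3) v"
  shows "edge_like q a b"
proof -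
  have c: "pathin G (seg q a b)" using pathin_seg[OF q ab] .
  have st: "seg q a b t \<in> pstar (1/3) v" if "t \<in> {0..1}" for t
    using star seg_in_interval[of t a b] that ab unfolding seg_def by auto
  have gc: "seg q a b t \<in> gcarrier V Ed" if "t \<in> {0..1}" for t
    using st[OF that] v by (auto simp: pstar_def gcarrier_def)
  have e: "seg q a b 0 = q a" "seg q a b 1 = q b" by (auto simp: seg_def)
  have "continuous_map (top_of_set ({0..1} \<times> {0..1})) (prod_topology (top_of_set {0..1}) G) (\<lambda>z::real\<times>real. (fst z, seg q a b (snd z)))"
  proof (rule continuous_map_pairedI)
    show "continuous_map (top_of_set ({0..1} \<times> {0..1})) (top_of_set {0..1}) (fst :: real \<times> real \<Rightarrow> real)"
      by (auto intro!: continuous_intros)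
    have "continuous_map (top_of_set ({0..1} \<times> {0..1})) (top_of_set {0..1}) (snd :: real \<times> real \<Rightarrow> real)"
      by (auto intro!: continuous_intros)
    from continuous_map_compose[OF this c[unfolded pathin_def]]
    show "continuous_map (top_of_set ({0..1::real} \<times> {0..1})) G (\<lambda>z. seg q a b (snd z))" by (simp add: comp_def)
  qed
  from continuous_map_compose[OF this continuous_map_collapse]
  have Q: "continuous_map (top_of_set ({0..1} \<times> {0..1})) G (\<lambda>z. collapse (fst z, seg q a b (snd z)))"
    by (simp add: comp_def)
  have anc: "anc (q a) = v" "anc (q b) = v"
    using collapse_pstar(2)[OF star, of _ 0] ab by auto
  have gq: "q a \<in> gcarrier V Ed" "q b \<in> gcarrier V Ed" using gc[of 0] gc[of 1] e by auto
  have *: "collapse (s, q b) = anc_path (q b) s" "collapse (s, q a) = anc_path (q a) s" if "s \<in> {0..1}" for s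
    using collapse_pstar(1)[OF star, of _ s] ab that by auto
  have "phtpy G (collapse (0, q a)) (collapse (1, q b))
      (pconcat (seg q a b) (anc_path (q b))) (pconcat (anc_path (q a)) (\<lambda>_. Inl v))"
    using phtpy_square[OF Q] unfolding fst_conv snd_conv e
  proof (rule phtpy_cong)
    fix t :: real assume t: "t \<in> {0..1}"
    show "pconcat (seg q a b) (anc_path (q b)) t = pconcat (\<lambda>t. collapse (0, seg q a b t)) (\<lambda>s. collapse (s, q b)) t"
      using *(1)[of "2 * t - 1"] collapse_0[OF gc[of "2 * t"]] t by (auto simp: pconcat_def)
    have "collapse (1, seg q a b s) = Inl v" if "s \<in> {0..1}" for s
      using collapse_pstar[OF st[OF that], of 1] anc_path_ends[OF gc[OF that]] by simp
    then show "pconcat (anc_path (q a)) (\<lambda>_. Inl v) t = pconcat (\<lambda>s. collapse (s, q a)) (\<lambda>t. collapse (1, seg q a b t)) t"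
      using *(2)[of "2 * t"] t by (auto simp: pconcat_def)
  qed
  then show ?thesis
    unfolding edge_like_def using anc gq collapse_0 *(1)[of 1] by (intro exI[of _ "[]"]) auto
qed

text \<open>The coordinate is continuous because open subsets of a cell are open in the
  graph.\<close>

lemma ecell_coordinate:
  assumes c: "pathin G c" and e: "e \<in> Ed" and cell: "\<And>t. t \<in> {0..1} \<Longrightarrow> c t \<in> ecell e"
  obtains u where "pathin euclideanreal u" "\<And>t. t \<in> {0..1} \<Longrightarrow> c t = Inr (e, u t)" "\<And>t. t \<in> {0..1} \<Longrightarrow> 0 < u t \<and> u t < 1"
proof
  define u where "u t = (case c t of Inr (d, s) \<Rightarrow> s | _ \<Rightarrow> 0)" for t
  show u: "c t = Inr (e, u t)" "0 < u t \<and> u t < 1" if "t \<in> {0..1}" for t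
    using cell[OF that] by (auto simp: u_def ecell_def)
  show "pathin euclideanreal u"
    unfolding pathin_def continuous_map_def
  proof (intro conjI allI impI)
    fix U :: "real set" assume "openin euclidean U"
    then have "openin G {Inr (e, t) | t. t \<in> U \<inter> {0<..<1}}"
      by (intro openin_ecell_part e) auto
    from openin_continuous_map_preimage[OF c[unfolded pathin_def] this]
    have "openin (top_of_set {0..1}) {t \<in> {0..1}. c t \<in> {Inr (e, t) | t. t \<in> U \<inter> {0<..<1}}}" by simp
    also have "{t \<in> {0..1}. c t \<in> {Inr (e, t) | t. t \<in> U \<inter> {0<..<1}}} = {t \<in> topspace (top_of_set {0..1}). u t \<in> U}"
      using u by auto
    finally show "openin (top_of_set {0..1}) {t \<in> topspace (top_of_set {0..1}). u t \<in> U}" .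
  qed simp
qed

text \<open>Inside a cell both sides are \<open>gp e\<close> composed with real paths having the
  same ends, and the interval is convex. The word is empty or a single letter, depending on whether
  both ends lie in the same half of the edge.\<close>

lemma edge_like_cell:
  assumes q: "pathin G q" and ab: "0 \<le> a" "a \<le> b" "b \<le> 1" and e: "e \<in> Ed"
    and cell: "\<And>t. t \<in> {a..b} \<Longrightarrow> q t \<in> ecell e"
  shows "edge_like q a b"
proof -
  have c: "pathin G (seg q a b)" using pathin_seg[OF q ab] .
  have "seg q a b t \<in> ecell e" if "t \<in> {0..1}" for t
    using cell seg_in_interval[of t a b] that ab unfolding seg_def by auto
  then obtain u where u: "pathin euclideanreal u" "\<And>t. t \<in> {0..1} \<Longrightarrow> seg q a b t = Inr (e, u t)"
    "\<And>t. t \<in> {0..1} \<Longrightarrow> 0 < u t \<and> u t < 1"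
    using ecell_coordinate[OF c e] by metis
  have gu: "seg q a b t = gp e (u t)" if "t \<in> {0..1}" for t
    using u(2,3)[OF that] by (simp add: gpt_def)
  have qab: "q a = Inr (e, u 0)" "q b = Inr (e, u 1)" using u(2)[of 0] u(2)[of 1] by (simp_all add: seg_def)
  define A B where "A = (of_bool (1/2 < u 0) :: real)" and "B = (of_bool (1/2 < u 1) :: real)"
  have ancA: "anc (q a) = (if A = 0 then src e else tgt e)" "anc (q b) = (if B = 0 then src e else tgt e)"
    by (auto simp: anc_def A_def B_def qab)
  obtain w k where k: "wp (anc (q a)) w (anc (q b))" "pathin euclideanreal k" "k 0 = A" "k 1 = B"
    "\<And>t. t \<in> {0..1} \<Longrightarrow> k t \<in> {0..1}" "\<And>t. ep (anc (q a)) w t = gp e (k t)"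
  proof -
    \<comment> \<open>The waiting phase of \<open>epath\<close> after its single letter is
      reproduced in the coordinate.\<close>
    have id: "pathin euclideanreal (pconcat (\<lambda>t. t) (\<lambda>_. 1))" "pathin euclideanreal (pconcat (\<lambda>t. 1 - t) (\<lambda>_. 0))"
      by (intro pathin_pconcat; force simp: pathin_def intro!: continuous_intros)+
    consider "A = B" | "A = 0" "B = 1" | "A = 1" "B = 0"
      by (cases "1/2 < u 0"; cases "1/2 < u 1") (auto simp: A_def B_def)
    then show thesis
    proof cases
      case 1
      show thesis
        by (rule that[of "[]" "\<lambda>_. A"]) (use 1 ancA in \<open>auto simp: A_def B_def pathin_def\<close>)
    next
      case 2
      show thesis
        by (rule that[of "[(e, False)]" "pconcat (\<lambda>t. t) (\<lambda>_. 1)"])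
           (use 2 e ancA id in \<open>auto simp: pconcat_def lpath_def\<close>)
    next
      case 3
      show thesis
        by (rule that[of "[(e, True)]" "pconcat (\<lambda>t. 1 - t) (\<lambda>_. 0)"])
           (use 3 e ancA id in \<open>auto simp: pconcat_def lpath_def prev_def\<close>)
    qed
  qed
  let ?f = "pconcat u (\<lambda>s. (1 - s) * u 1 + s * B)" and ?g = "pconcat (\<lambda>s. (1 - s) * u 0 + s * A) k"
  have 1: "pathin euclideanreal ?f" "pathin euclideanreal ?g"
    by (intro pathin_pconcat u k; auto simp: pathin_def k intro!: continuous_intros)+
  have u01: "u t \<in> {0..1}" if "t \<in> {0..1}" for t using u(3)[OF that] by auto
  have cB: "(1 - s) * u 1 + s * B \<in> {0..1}" "(1 - s) * u 0 + s * A \<in> {0..1}" if "s \<in> {0..1}" for s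
    by (rule convex_comb_01; use that u01[of 1] u01[of 0] in \<open>auto simp: A_def B_def\<close>)+
  have 2: "?f t \<in> {0..1}" "?g t \<in> {0..1}" if "t \<in> {0..1}" for t
    using that u01[of "2 * t"] cB[of "2 * t - 1"] cB[of "2 * t"] k(5)[of "2 * t - 1"]
    by (auto simp: pconcat_def)
  have L: "pconcat (seg q a b) (anc_path (q b)) t = gp e (?f t)" if "t \<in> {0..1}" for t
    using gu[of "2 * t"] that by (auto simp: pconcat_def anc_path_def qab B_def)
  have R: "pconcat (anc_path (q a)) (ep (anc (q a)) w) t = gp e (?g t)" for t
    using k(6) by (auto simp: pconcat_def anc_path_def qab A_def)
  have "phtpy G (pconcat (seg q a b) (anc_path (q b)) 0) (pconcat (seg q a b) (anc_path (q b)) 1)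
    (pconcat (seg q a b) (anc_path (q b))) (pconcat (anc_path (q a)) (ep (anc (q a)) w))"
    by (rule phtpy_reparam[OF pathin_gpt[OF e], where f="?f" and g="?g"])
       (use 1 2 k L R in \<open>auto simp: pathin_def simp del: atLeastAtMost_iff\<close>)
  moreover have "q b \<in> gcarrier V Ed" using cell[of b] e ab by (auto simp: ecell_def gcarrier_def)
  ultimately show ?thesis
    unfolding edge_like_def using k(1) by (intro exI[of _ w]) (simp add: seg_def)
qed

text \<open>The second piece is traded for the anchor path at \<open>b\<close> followed by its word;
  that anchor path completes the first piece, and the words concatenate.\<close>

lemma edge_like_trans:
  assumes q: "pathin G q" and abc: "0 \<le> a" "a \<le> b" "b \<le> c" "c \<le> 1" and E: "edge_like q a b" "edge_like q b c"
  shows "edge_like q a c"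
proof -
  have qin: "q t \<in> gcarrier V Ed" if "t \<in> {0..1}" for t
    using Pi_mem[OF continuous_map_funspace[OF q[unfolded pathin_def]], of t] that by simp
  have qabc: "q a \<in> gcarrier V Ed" "q b \<in> gcarrier V Ed" "q c \<in> gcarrier V Ed" using qin abc by auto
  obtain w1 where w1: "wp (anc (q a)) w1 (anc (q b))"
     "phtpy G (q a) (Inl (anc (q b))) (pconcat (seg q a b) (anc_path (q b))) (pconcat (anc_path (q a)) (ep (anc (q a)) w1))"
    using E(1) unfolding edge_like_def by blast
  obtain w2 where w2: "wp (anc (q b)) w2 (anc (q c))"
     "phtpy G (q b) (Inl (anc (q c))) (pconcat (seg q b c) (anc_path (q c))) (pconcat (anc_path (q b)) (ep (anc (q b)) w2))"
    using E(2) unfolding edge_like_def by blast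
  have s [simp]: "seg q x y 0 = q x" "seg q x y 1 = q y" for x y by (auto simp: seg_def)
  note ps = pathin_seg[OF q, of a b] pathin_seg[OF q, of b c] pathin_seg[OF q, of a c]
  have p: "pathin G (seg q a b)" "pathin G (seg q b c)" "pathin G (seg q a c)" using ps abc by auto
  have pa: "pathin G (anc_path (q a))" "pathin G (anc_path (q b))" "pathin G (anc_path (q c))"
    using qabc pathin_anc_path by auto
  have pe: "pathin G (ep (anc (q a)) w1)" "pathin G (ep (anc (q b)) w2)"
    using pathin_epath w1(1) w2(1) anc_in qabc by blast+
  note ends = anc_path_ends[OF qabc(1)] anc_path_ends[OF qabc(2)] anc_path_ends[OF qabc(3)]
    epath_0[OF w1(1)] epath_1[OF w1(1)] epath_0[OF w2(1)] epath_1[OF w2(1)]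
  let ?a = "q a" and ?c = "Inl (anc (q c))"
  have ac: "phtpy G ?a (q c) (seg q a c) (pconcat (seg q a b) (seg q b c))"
  proof -
    let ?f = "\<lambda>t. a + t * (c - a)" and ?g = "pconcat (\<lambda>t. a + t * (b - a)) (\<lambda>t. b + t * (c - b))"
    have g: "pathin euclideanreal ?g"
      by (intro pathin_pconcat) (auto simp: pathin_def intro!: continuous_intros)
    have f01: "?f t \<in> {0..1}" if "t \<in> {0..1}" for t
      using seg_in_interval[of t a c] that abc by auto
    have g01: "?g t \<in> {0..1}" if "t \<in> {0..1}" for t
      using seg_in_interval[of "2 * t" a b] seg_in_interval[of "2 * t - 1" b c] that abc by (auto simp: pconcat_def)
    have "phtpy G (seg q a c 0) (seg q a c 1) (seg q a c) (pconcat (seg q a b) (seg q b c))"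
    proof (rule phtpy_reparam[OF q, where f="?f" and g="?g"])
      show "continuous_on {0..1} ?f" by (intro continuous_intros)
      show "continuous_on {0..1} ?g" using g by (simp add: pathin_def)
      show "?f ` {0..1} \<subseteq> {0..1}" "?g ` {0..1} \<subseteq> {0..1}" using f01 g01 by blast+
      show "pconcat (seg q a b) (seg q b c) t = q (?g t)" for t by (simp add: seg_def pconcat_def)
    qed (simp_all add: seg_def pconcat_def)
    then show ?thesis by simp
  qed
  have r: "phtpy G (r 0) (r 1) r r" if "pathin G r" for r :: "real \<Rightarrow> 'v + 'e \<times> real"
    using phtpy_refl[OF that] .
  have "phtpy G ?a ?c (pconcat (seg q a c) (anc_path (q c))) (pconcat (pconcat (seg q a b) (seg q b c)) (anc_path (q c)))"
    using phtpy_pconcat[OF ac] r[OF pa(3)] ends by simp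
  also have "phtpy G ?a ?c \<dots> (pconcat (seg q a b) (pconcat (seg q b c) (anc_path (q c))))"
    using phtpy_assoc[OF p(1,2) pa(3)] ends by simp
  also have "phtpy G ?a ?c \<dots> (pconcat (seg q a b) (pconcat (anc_path (q b)) (ep (anc (q b)) w2)))"
    using phtpy_pconcat[OF r[OF p(1)]] w2(2) by simp
  also have "phtpy G ?a ?c \<dots> (pconcat (pconcat (seg q a b) (anc_path (q b))) (ep (anc (q b)) w2))"
    using phtpy_sym[OF phtpy_assoc[OF p(1) pa(2) pe(2)]] ends by simp
  also have "phtpy G ?a ?c \<dots> (pconcat (pconcat (anc_path (q a)) (ep (anc (q a)) w1)) (ep (anc (q b)) w2))"
    using phtpy_pconcat[OF w1(2)] r[OF pe(2)] ends by simp
  also have "phtpy G ?a ?c \<dots> (pconcat (anc_path (q a)) (pconcat (ep (anc (q a)) w1) (ep (anc (q b)) w2)))"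
    using phtpy_assoc[OF pa(1) pe] ends by simp
  also have "phtpy G ?a ?c \<dots> (pconcat (anc_path (q a)) (ep (anc (q a)) (w1 @ w2)))"
    using phtpy_pconcat[OF r[OF pa(1)]] phtpy_sym[OF phtpy_epath_append[OF w1(1) w2(1) anc_in[OF qabc(1)]]] ends by simp
  finally show ?thesis
    unfolding edge_like_def using wpath_appendI[OF w1(1) w2(1)] by blast
qed

text \<open>Bisection with stars of radius 1/3 and open cells as neighbourhoods; at the vertices
  \<open>q 0\<close> and \<open>q 1\<close> the anchor paths are constant and drop out.\<close>

theorem path_homotopic_epath:
  assumes q: "pathin G q" and x: "q 0 = Inl x" and y: "q 1 = Inl y"
  obtains w where "wp x w y" "phtpy G (Inl x) (Inl y) q (ep x w)"
proof -
  have qin: "q t \<in> gcarrier V Ed" if "t \<in> {0..1}" for t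
    using Pi_mem[OF continuous_map_funspace[OF q[unfolded pathin_def]], of t] that by simp
  have xV: "x \<in> V" using qin[of 0] x by simp
  define P where "P a b \<longleftrightarrow> (0 \<le> a \<longrightarrow> a \<le> b \<longrightarrow> b \<le> 1 \<longrightarrow> edge_like q a b)" for a b
  have "(0::real) \<le> 1" by simp
  then have "P 0 1"
  proof (induction rule: Bolzano)
    case (trans a b c)
    then show ?case unfolding P_def using edge_like_trans[OF q, of a b c] by auto
  next
    case (local t)
    then have t: "t \<in> {0..1}" by simp
    obtain U where U: "openin G U" "q t \<in> U"
      "\<And>a b. 0 \<le> a \<Longrightarrow> a \<le> b \<Longrightarrow> b \<le> 1 \<Longrightarrow> (\<And>s. s \<in> {a..b} \<Longrightarrow> q s \<in> U) \<Longrightarrow> edge_like q a b"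
      using qin[OF t]
    proof (cases rule: gcarrier_cases)
      case (1 v)
      then show ?thesis
        using edge_like_star[OF q _ _ _ 1(1)] by (intro that[of "pstar (1/3) v"] openin_pstar) (auto simp: pstar_def)
    next
      case (2 e s)
      then show ?thesis
        using edge_like_cell[OF q _ _ _ 2(1)] by (intro that[of "ecell e"] openin_ecell) (auto simp: ecell_def)
    qed
    have "openin (top_of_set {0..1}) {s \<in> {0..1}. q s \<in> U}"
      using openin_continuous_map_preimage[OF q[unfolded pathin_def] U(1)] by simp
    then obtain d where d: "d > 0" "ball t d \<inter> {0..1} \<subseteq> {s \<in> {0..1}. q s \<in> U}"
      using t U(2) unfolding openin_contains_ball by blast
    show ?case
    proof (intro exI[of _ d] conjI allI impI)
      fix a b assume ab: "a \<le> t \<and> t \<le> b \<and> b - a < d"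
      have "q s \<in> U" if "0 \<le> a" "b \<le> 1" "s \<in> {a..b}" for s
      proof -
        have "s \<in> ball t d \<inter> {0..1}" using that ab by (auto simp: dist_real_def)
        with d show ?thesis by blast
      qed
      then show "P a b" unfolding P_def using U(3) by auto
    qed (use d in auto)
  qed
  then obtain w where w: "wp x w y" "phtpy G (Inl x) (Inl y) (pconcat q (\<lambda>_. Inl y)) (pconcat (\<lambda>_. Inl x) (ep x w))"
    unfolding P_def edge_like_def by (auto simp: x y anc_def anc_path_def[abs_def] seg_def)
  have "phtpy G (Inl x) (Inl y) q (pconcat q (\<lambda>_. Inl y))"
    using phtpy_sym[OF phtpy_const_right[OF q y]] x by simp
  also note w(2)
  also have "phtpy G (Inl x) (Inl y) (pconcat (\<lambda>_. Inl x) (ep x w)) (ep x w)"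
    using phtpy_const_left[OF pathin_epath[OF w(1) xV]] w(1) by simp
  finally show thesis using that w(1) by blast
qed

text \<open>The endpoints of an edge are reachable together, so reachability of the anchor cannot
  change along an edge, and the reachable points form a clopen set.\<close>

lemma connected_wpath:
  assumes con: "connected_space G" and x: "x \<in> V" and y: "y \<in> V"
  shows "\<exists>w. wp x w y"
proof -
  define R where "R = {z \<in> gcarrier V Ed. \<exists>w. wp x w (anc z)}"
  have st: "(\<exists>w. wp x w (src e)) \<longleftrightarrow> (\<exists>w. wp x w (tgt e))" if "e \<in> Ed" for e
  proof
    assume "\<exists>w. wp x w (src e)"
    then obtain w where "wp x w (src e)" ..
    then have "wp x (w @ [(e, False)]) (tgt e)" using that by (intro wpath_appendI) auto
    then show "\<exists>w. wp x w (tgt e)" ..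
  next
    assume "\<exists>w. wp x w (tgt e)"
    then obtain w where "wp x w (tgt e)" ..
    then have "wp x (w @ [(e, True)]) (src e)" using that by (intro wpath_appendI) auto
    then show "\<exists>w. wp x w (src e)" ..
  qed
  have anc: "anc (gp e t) \<in> {src e, tgt e}" for e t by (auto simp: anc_def gpt_def)
  have R: "gp e t \<in> R \<longleftrightarrow> (\<exists>w. wp x w (src e))" if "e \<in> Ed" "t \<in> {0..1}" for e t
    using anc[of e t] st[OF that(1)] gpt_in[OF that] by (auto simp: R_def)
  have o: "openin G S" if "S \<subseteq> gcarrier V Ed" "\<And>e t. e \<in> Ed \<Longrightarrow> t \<in> {0..1} \<Longrightarrow> gp e t \<in> S \<longleftrightarrow> Q e" for S Q
    unfolding openin_graph_top gopen_def
  proof (intro conjI ballI that(1))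
    fix e assume "e \<in> Ed"
    then have eq: "{t \<in> {0..1}. gp e t \<in> S} = (if Q e then {0..1} else {})" using that(2) by auto
    show "openin (top_of_set {0..1}) {t \<in> {0..1}. gp e t \<in> S}" unfolding eq by simp
  qed
  have "openin G R" by (rule o[where Q = "\<lambda>e. \<exists>w. wp x w (src e)"]) (use R in \<open>auto simp: R_def\<close>)
  moreover have "openin G (gcarrier V Ed - R)"
    by (rule o[where Q = "\<lambda>e. \<not> (\<exists>w. wp x w (src e))"]) (use R gpt_in in auto)
  then have "closedin G R" by (simp add: closedin_def R_def)
  ultimately have "R = {} \<or> R = gcarrier V Ed"
    using con unfolding connected_space_clopen_in by auto
  moreover have "Inl x \<in> R" using x by (auto simp: R_def anc_def intro: exI[of _ "[]"])
  ultimately have "Inl y \<in> R" using y by auto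
  then show ?thesis by (auto simp: R_def anc_def)
qed

end

section \<open>Spanning trees\<close>

locale rooted_graph = graph V Ed src tgt
  for V :: "'v set" and Ed :: "'e set" and src tgt :: "'e \<Rightarrow> 'v" +
  fixes x0 :: 'v
  assumes x0: "x0 \<in> V" and reach: "\<And>y. y \<in> V \<Longrightarrow> \<exists>w. wpath Ed src tgt x0 w y"
begin

definition dst :: "'v \<Rightarrow> nat" where
  "dst v = (LEAST n. \<exists>w. wp x0 w v \<and> length w = n)"

definition par :: "'v \<Rightarrow> 'e \<times> bool" where
  "par v = (SOME a. fst a \<in> Ed \<and> lnd a = v \<and> Suc (dst (ls a)) = dst v)"

text \<open>The number of steps is an explicit argument, which makes the descent along parents
  primitive recursive; \<open>tau\<close> starts it at \<open>dst v\<close>.\<close>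

primrec tree_path_n :: "nat \<Rightarrow> 'v \<Rightarrow> ('e \<times> bool) list" where
  "tree_path_n 0 v = []"
| "tree_path_n (Suc n) v = tree_path_n n (ls (par v)) @ [par v]"

definition tau :: "'v \<Rightarrow> ('e \<times> bool) list" where
  "tau v = tree_path_n (dst v) v"

definition TE :: "'e set" where
  "TE = (\<lambda>v. fst (par v)) ` (V - {x0})"

text \<open>The classical loop around \<open>e\<close>. It is formed for tree edges too, where it is
  freely trivial (\<open>feq_Lam_TE\<close>), so that it can be substituted into arbitrary edge
  words.\<close>

definition Lam :: "'e \<Rightarrow> ('e \<times> bool) list" where
  "Lam e = tau (src e) @ [(e, False)] @ winv (tau (tgt e))"

lemma dst_le: "wp x0 w v \<Longrightarrow> dst v \<le> length w"
  unfolding dst_def by (rule Least_le) blast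

lemma dst_attained: "v \<in> V \<Longrightarrow> \<exists>w. wp x0 w v \<and> length w = dst v"
  unfolding dst_def by (rule LeastI_ex) (use reach in blast)

lemma dst_x0 [simp]: "dst x0 = 0"
  using dst_le[of "[]" x0] by simp

text \<open>Cutting the last letter off a shortest path to \<open>v\<close> leaves a path that is
  again shortest.\<close>

lemma par:
  assumes "v \<in> V" "v \<noteq> x0"
  shows "fst (par v) \<in> Ed" "lnd (par v) = v" "Suc (dst (ls (par v))) = dst v"
proof -
  obtain w where w: "wp x0 w v" "length w = dst v" using dst_attained assms by blast
  have "w \<noteq> []" using w assms by auto
  then obtain u a where wu: "w = u @ [a]" by (metis rev_exhaust)
  with w have a: "fst a \<in> Ed" "wp x0 u (ls a)" "lnd a = v" by (auto simp: wpath_append)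
  obtain u' where u': "wp x0 u' (ls a)" "length u' = dst (ls a)" using dst_attained[OF lst_in[OF a(1)]] by blast
  have "wp x0 (u' @ [a]) v" using u' a by (auto intro: wpath_appendI)
  from dst_le[OF this] dst_le[OF a(2)] have "Suc (dst (ls a)) = dst v"
    using u' w wu by simp
  with a have "\<exists>a. fst a \<in> Ed \<and> lnd a = v \<and> Suc (dst (ls a)) = dst v" by blast
  from someI_ex[OF this] show "fst (par v) \<in> Ed" "lnd (par v) = v" "Suc (dst (ls (par v))) = dst v"
    unfolding par_def by blast+
qed

lemma tau_x0 [simp]: "tau x0 = []"
  by (simp add: tau_def)

lemma tau_par:
  assumes "v \<in> V" "v \<noteq> x0"
  shows "tau v = tau (ls (par v)) @ [par v]"
  unfolding tau_def par(3)[OF assms, symmetric] by simp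

lemma dst_induct [consumes 1, case_names root step]:
  assumes "v \<in> V" "Q x0" "\<And>v. v \<in> V \<Longrightarrow> v \<noteq> x0 \<Longrightarrow> Q (ls (par v)) \<Longrightarrow> Q v"
  shows "Q v"
  using assms(1)
proof (induction "dst v" arbitrary: v rule: less_induct)
  case less
  show ?case
  proof (cases "v = x0")
    case False
    then have "Q (ls (par v))" using less.prems par[of v] by (intro less.hyps) auto
    then show ?thesis by (rule assms(3)[OF less.prems False])
  qed (use assms(2) in simp)
qed

lemma wpath_tau: "v \<in> V \<Longrightarrow> wp x0 (tau v) v"
proof (induction rule: dst_induct)
  case (step v)
  then show ?case using par[of v] by (auto simp: tau_par intro: wpath_appendI)
qed simp

lemma wpath_Lam: "e \<in> Ed \<Longrightarrow> wp x0 (Lam e) x0"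
  unfolding Lam_def by (auto intro!: wpath_appendI wpath_tau wpath_winv)

lemma TE_tau:
  assumes "e \<in> TE"
  shows "tau (tgt e) = tau (src e) @ [(e, False)] \<or> tau (src e) = tau (tgt e) @ [(e, True)]"
proof -
  obtain v where v: "v \<in> V" "v \<noteq> x0" "e = fst (par v)" using assms by (auto simp: TE_def)
  show ?thesis
    using tau_par[OF v(1,2)] par(2)[OF v(1,2)] v(3) by (cases "par v"; cases "snd (par v)") auto
qed

lemma feq_Lam_TE: assumes "e \<in> TE" shows "feq (Lam e) []"
  using TE_tau[OF assms]
proof
  assume "tau (tgt e) = tau (src e) @ [(e, False)]"
  then show ?thesis using feq_winv_right[of "tau (tgt e)"] by (simp add: Lam_def)
next
  assume "tau (src e) = tau (tgt e) @ [(e, True)]"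
  then have "feq (Lam e) (tau (tgt e) @ winv (tau (tgt e)))"
    using feq_cancel2[of "tau (tgt e)" "(e, True)" "winv (tau (tgt e))"] by (simp add: Lam_def linv_def)
  then show ?thesis using feq_trans feq_winv_right by blast
qed

text \<open>The return path of each letter cancels against the outgoing path of the next, so only
  the outer tree paths survive.\<close>

lemma feq_sub_Lam:
  assumes "wp u w v" "u \<in> V"
  shows "feq (sub Lam w) (tau u @ w @ winv (tau v))"
  using assms
proof (induction w arbitrary: u)
  case Nil
  then show ?case by (simp add: feq_sym)
next
  case (Cons a w)
  let ?m = "lnd a"
  have L: "(if snd a then winv (Lam (fst a)) else Lam (fst a)) = tau u @ [a] @ winv (tau ?m)"
    using Cons.prems by (cases a) (auto simp: Lam_def linv_def)
  have "feq (sub Lam (a # w)) ((tau u @ [a] @ winv (tau ?m)) @ tau ?m @ w @ winv (tau v))"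
    unfolding sub_simps(3) L by (intro feq_append feq_refl Cons.IH) (use Cons.prems in auto)
  also have "feq \<dots> (tau u @ (a # w) @ winv (tau v))"
    using feq_cancel_winv'[of "tau u @ [a]" "tau ?m" "w @ winv (tau v)"] by simp
  finally show ?case .
qed

subsection \<open>Generation of the fundamental group by the non-tree edges\<close>

abbreviation "FG \<equiv> fundamental_group G (Inl x0)"
abbreviation cl :: "('e \<times> bool) list \<Rightarrow> (real \<Rightarrow> 'v + 'e \<times> real) set" where
  "cl w \<equiv> loop_class G (Inl x0) (ep x0 w)"

lemma group_FG: "group FG"
  by (rule group_fundamental_group) (use x0 in simp)

lemma loop_at_epath: "wp x0 w x0 \<Longrightarrow> loop_at G (Inl x0) (ep x0 w)"
  using pathin_epath x0 by (simp add: loop_at_def)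

lemma cl_append:
  assumes "wp x0 u x0" "wp x0 v x0"
  shows "cl (u @ v) = cl u \<otimes>\<^bsub>FG\<^esub> cl v"
  using loop_class_eqI[OF phtpy_epath_append[OF assms x0]] assms
  by (simp add: fundamental_group_mult loop_at_epath)

lemma cl_feq:
  assumes "wp x0 u x0" "wp x0 v x0" "feq u v"
  shows "cl u = cl v"
  using loop_class_eqI[OF phtpy_epath_feq[OF assms(1,2) x0 assms(3)]] .

lemma cl_Nil: "cl [] = \<one>\<^bsub>FG\<^esub>"
  by (simp add: one_fundamental_group)

lemma cl_in: "wp x0 w x0 \<Longrightarrow> cl w \<in> carrier FG"
  using loop_at_epath by (auto simp: carrier_fundamental_group)

lemma cl_winv:
  assumes "wp x0 w x0"
  shows "cl (winv w) = inv\<^bsub>FG\<^esub> cl w"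
proof -
  interpret group FG by (rule group_FG)
  have w: "wp x0 (winv w) x0" using wpath_winv[OF assms] .
  have "cl (winv w @ w) = cl []"
    by (rule cl_feq) (use w assms in \<open>auto intro: wpath_appendI\<close>)
  then have "cl (winv w) \<otimes>\<^bsub>FG\<^esub> cl w = \<one>\<^bsub>FG\<^esub>"
    using cl_append[OF w assms] cl_Nil by simp
  then show ?thesis using inv_equality cl_in w assms by simp
qed

text \<open>For a loop at \<open>x0\<close> the outer tree paths in \<open>feq_sub_Lam\<close> are
  empty, so the loop is a product of loops \<open>Lam e\<close> and their inverses; those of tree
  edges are trivial.\<close>

lemma generate_nontree:
  "generate FG ((\<lambda>e. cl (Lam e)) ` (Ed - TE)) = carrier FG" (is "generate FG ?S = _")
proof
  interpret group FG by (rule group_FG)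
  have S: "?S \<subseteq> carrier FG" using cl_in wpath_Lam by auto
  then show "generate FG ?S \<subseteq> carrier FG" by (rule generate_incl)
  have g1: "cl (Lam e) \<in> generate FG ?S" if "e \<in> Ed" for e
  proof (cases "e \<in> TE")
    case True
    then have "cl (Lam e) = cl []" using that wpath_Lam feq_Lam_TE by (intro cl_feq) auto
    then show ?thesis using cl_Nil generate.one by metis
  qed (use that in \<open>auto intro: generate.incl\<close>)
  have sub_in: "wp x0 (sub Lam w) x0 \<and> cl (sub Lam w) \<in> generate FG ?S" if "fst ` set w \<subseteq> Ed" for w
    using that
  proof (induction w)
    case Nil
    show ?case using generate.one[of FG] cl_Nil by simp
  next
    case (Cons a w)
    let ?L = "if snd a then winv (Lam (fst a)) else Lam (fst a)"
    have L: "wp x0 ?L x0" using Cons.prems wpath_Lam wpath_winv[OF wpath_Lam] by auto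
    have "cl ?L \<in> generate FG ?S"
      using Cons.prems g1 cl_winv[OF wpath_Lam] generate_m_inv_closed[OF S] by auto
    then show ?case
      using Cons L cl_append[OF L] by (auto intro: wpath_appendI generate.eng)
  qed
  show "carrier FG \<subseteq> generate FG ?S"
  proof
    fix A assume "A \<in> carrier FG"
    then obtain q where q: "loop_at G (Inl x0) q" "A = loop_class G (Inl x0) q"
      by (auto simp: carrier_fundamental_group)
    then obtain w where w: "wp x0 w x0" "phtpy G (Inl x0) (Inl x0) q (ep x0 w)"
      using path_homotopic_epath[of q x0 x0] by (auto simp: loop_at_def)
    have s: "wp x0 (sub Lam w) x0" "cl (sub Lam w) \<in> generate FG ?S"
      using sub_in[OF wpath_letters[OF w(1)]] by auto
    have "A = cl w" using loop_class_eqI[OF w(2)] q by simp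
    also have "\<dots> = cl (sub Lam w)"
      using feq_sub_Lam[OF w(1) x0] by (intro cl_feq w s feq_sym[of "sub Lam w"]) simp
    finally show "A \<in> generate FG ?S" using s by simp
  qed
qed

theorem infinite_nontree:
  assumes "infinite_rank FG"
  shows "infinite (Ed - TE)"
proof
  assume fin: "finite (Ed - TE)"
  have sub: "(\<lambda>e. cl (Lam e)) ` (Ed - TE) \<subseteq> carrier FG" using cl_in wpath_Lam by auto
  have "\<exists>S. finite S \<and> S \<subseteq> carrier FG \<and> generate FG S = carrier FG"
    by (intro exI[of _ "(\<lambda>e. cl (Lam e)) ` (Ed - TE)"] conjI finite_imageI fin sub generate_nontree)
  with assms show False unfolding infinite_rank_def by (rule notE)
qed

subsection \<open>Cancellation along the tree\<close>

text \<open>If the edge were used in opposite directions, each vertex would be the parent of the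
  other, and each distance would exceed the other by one.\<close>

lemma par_edge_unique:
  assumes "v \<in> V" "v \<noteq> x0" "v' \<in> V" "v' \<noteq> x0" "fst (par v) = fst (par v')"
  shows "v = v'"
proof (cases "snd (par v) = snd (par v')")
  case True
  then have "par v = par v'" using assms(5) by (simp add: prod_eq_iff)
  then show ?thesis using par(2)[OF assms(1,2)] par(2)[OF assms(3,4)] by metis
next
  case False
  then have "par v' = linv (par v)" using assms(5) by (auto simp: linv_def prod_eq_iff)
  then have "ls (par v') = v" "ls (par v) = v'"
    using par(2)[OF assms(1,2)] par(2)[OF assms(3,4)] by (metis lst_linv, metis lst_linv linv_linv)
  then have "Suc (dst v') = dst v" "Suc (dst v) = dst v'"
    using par(3)[OF assms(1,2)] par(3)[OF assms(3,4)] by metis+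
  then show ?thesis by simp
qed

text \<open>The cut is made just after the last occurrence of \<open>d\<close>, at the vertex whose
  parent edge is \<open>d\<close>.\<close>

lemma tau_split:
  assumes "a \<in> V" "d \<in> fst ` set (tau a)"
  shows "\<exists>v s. v \<in> V \<and> v \<noteq> x0 \<and> fst (par v) = d \<and> tau a = tau v @ s \<and> d \<notin> fst ` set s"
  using assms
proof (induction rule: dst_induct)
  case (step a)
  show ?case
  proof (cases "d = fst (par a)")
    case True
    then show ?thesis using step by (intro exI[of _ a] exI[of _ "[]"]) auto
  next
    case False
    then have "d \<in> fst ` set (tau (ls (par a)))" using step tau_par[of a] by auto
    from step.IH[OF this] obtain v s where v: "v \<in> V" "v \<noteq> x0" "fst (par v) = d"
       "tau (ls (par a)) = tau v @ s" "d \<notin> fst ` set s" by blast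
    then show ?thesis using False step tau_par[of a] by (intro exI[of _ v] exI[of _ "s @ [par a]"]) auto
  qed
qed simp

text \<open>If both tree paths use \<open>d\<close>, they share the prefix up to its far end
  (\<open>par_edge_unique\<close>), and this prefix cancels, leaving remainders without
  \<open>d\<close>.\<close>

lemma tau_cancel:
  assumes "a \<in> V" "b \<in> V" "d \<in> fst ` set (tau a) \<longleftrightarrow> d \<in> fst ` set (tau b)"
  shows "d \<notin> fst ` set (fred (winv (tau a) @ tau b))"
proof (cases "d \<in> fst ` set (tau a)")
  case True
  then obtain v s where v: "v \<in> V" "v \<noteq> x0" "fst (par v) = d" "tau a = tau v @ s" "d \<notin> fst ` set s"
    using tau_split[OF assms(1)] by blast
  obtain v' s' where v': "v' \<in> V" "v' \<noteq> x0" "fst (par v') = d" "tau b = tau v' @ s'" "d \<notin> fst ` set s'"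
    using tau_split[OF assms(2)] True assms(3) by blast
  have "v' = v" using par_edge_unique v v' by metis
  then have "feq (winv (tau a) @ tau b) (winv s @ s')"
    using feq_cancel_winv'[of "winv s" "tau v" s'] v v' by simp
  then have "fred (winv (tau a) @ tau b) = fred (winv s @ s')" by (simp add: feq_def)
  moreover have "fst ` set (fred (winv s @ s')) \<subseteq> fst ` set s \<union> fst ` set s'"
    using letters_fred[of "winv s @ s'"] by (simp add: image_Un)
  ultimately show ?thesis using v(5) v'(5) by auto
next
  case False
  then show ?thesis
    using letters_fred[of "winv (tau a) @ tau b"] assms(3) by (auto simp: image_Un)
qed

end

section \<open>The combinatorial action of the wreath product\<close>

text \<open>Sequential compactness of the power set of a countable set: a diagonal subsequence
  eventually decides membership of each point.\<close>

lemma convergent_subsequence_of_sets: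
  fixes S :: "nat \<Rightarrow> 'd set"
  assumes "countable (\<Union>j. S j)"
  obtains r :: "nat \<Rightarrow> nat" where "strict_mono r"
    "\<And>d. finite {j. d \<in> S (r j)} \<or> finite {j. d \<notin> S (r j)}"
proof -
  let ?D = "\<Union>j. S j"
  define q where "q n j \<longleftrightarrow> from_nat_into ?D n \<in> S j" for n j
  define P where "P n s \<longleftrightarrow> (\<forall>j. q n (s j)) \<or> (\<forall>j. \<not> q n (s j))" for n and s :: "nat \<Rightarrow> nat"
  interpret subseqs P
  proof
    fix n and s :: "nat \<Rightarrow> nat"
    show "\<exists>r'. strict_mono r' \<and> P n (s \<circ> r')"
    proof (cases "infinite {j. q n (s j)}")
      case True
      then show ?thesis
        using strict_mono_enumerate[OF True] enumerate_in_set[OF True]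
        by (intro exI[of _ "enumerate {j. q n (s j)}"]) (auto simp: P_def)
    next
      case False
      have "{j. q n (s j)} \<union> {j. \<not> q n (s j)} = UNIV" by auto
      then have inf: "infinite {j. \<not> q n (s j)}" using False by (metis finite_Un infinite_UNIV_nat)
      then show ?thesis
        using strict_mono_enumerate[OF inf] enumerate_in_set[OF inf]
        by (intro exI[of _ "enumerate {j. \<not> q n (s j)}"]) (auto simp: P_def)
    qed
  qed
  have P: "P k (diagseq \<circ> ((+) (Suc k)))" for k
    by (rule diagseq_holds) (auto simp: P_def)
  show thesis
  proof (rule that[of diagseq])
    show "strict_mono diagseq" by (rule subseq_diagseq)
    fix d
    show "finite {j. d \<in> S (diagseq j)} \<or> finite {j. d \<notin> S (diagseq j)}"
    proof (cases "d \<in> ?D")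
      case True
      then obtain n where n: "d = from_nat_into ?D n"
        using from_nat_into_surj[OF assms] by metis
      have shift: "\<exists>i. j = Suc n + i" if "\<not> j < Suc n" for j
        using that le_Suc_ex not_less by blast
      \<comment> \<open>After the first \<open>Suc n\<close> terms of the diagonal sequence,
        membership of the \<open>n\<close>-th point no longer changes.\<close>
      from P[of n] have "{j. d \<in> S (diagseq j)} \<subseteq> {..<Suc n} \<or> {j. d \<notin> S (diagseq j)} \<subseteq> {..<Suc n}"
        unfolding P_def q_def n[symmetric] using shift by (auto simp: comp_def)
      then show ?thesis using finite_subset[OF _ finite_lessThan] by blast
    qed auto
  qed
qed

text \<open>What the wreath construction needs from \<open>A\<close>: a faithful action by words on
  a free group of rank \<open>N\<close>. Products are respected up to reduction, the unit acts
  literally, and \<open>N > 0\<close> leaves a letter on which the shift is visible.\<close>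

locale letter_action = A: group A for A :: "('g, 'm) monoid_scheme" +
  fixes N :: nat and sg :: "'g \<Rightarrow> nat \<Rightarrow> (nat \<times> bool) list"
  assumes N: "N > 0"
    and sg_letters: "\<And>a i. a \<in> carrier A \<Longrightarrow> i < N \<Longrightarrow> fst ` set (sg a i) \<subseteq> {..<N}"
    and sg_mult: "\<And>a b i. a \<in> carrier A \<Longrightarrow> b \<in> carrier A \<Longrightarrow> i < N \<Longrightarrow>
       feq (sub (sg a) (sg b i)) (sg (a \<otimes>\<^bsub>A\<^esub> b) i)"
    and sg_one: "\<And>i. i < N \<Longrightarrow> sg \<one>\<^bsub>A\<^esub> i = [(i, False)]"
    and sg_faithful: "\<And>a. a \<in> carrier A \<Longrightarrow> (\<And>i. i < N \<Longrightarrow> feq (sg a i) [(i, False)]) \<Longrightarrow> a = \<one>\<^bsub>A\<^esub>"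

text \<open>The moved edges are \<open>io i m\<close> with \<open>i < N\<close>: the \<open>m\<close>-th copy of the \<open>i\<close>-th generator.  The edges
  \<open>io i m\<close> with \<open>i \<ge> N\<close> stay fixed; they are needed to detect inner automorphisms.  Convergence of the
  endpoints in the end compactification of the tree is what makes the shift proper.\<close>
locale wreath_data = rooted_graph V Ed src tgt x0 + letter_action A N sg
  for V :: "'v set" and Ed :: "'e set" and src tgt :: "'e \<Rightarrow> 'v" and x0 :: 'v
    and A :: "('g, 'm) monoid_scheme" and N sg +
  fixes io :: "nat \<Rightarrow> int \<Rightarrow> 'e"
  assumes io_inj: "\<And>i m j k. io i m = io j k \<longleftrightarrow> i = j \<and> m = k"
    and io_in: "\<And>i m. io i m \<in> Ed" and io_nontree [simp]: "\<And>i m. io i m \<notin> TE"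
    and io_src: "\<And>d. finite {(i, m). d \<in> fst ` set (tau (src (io i m)))} \<or> finite {(i, m). d \<notin> fst ` set (tau (src (io i m)))}"
    and io_tgt: "\<And>d. finite {(i, m). d \<in> fst ` set (tau (tgt (io i m)))} \<or> finite {(i, m). d \<notin> fst ` set (tau (tgt (io i m)))}"
begin

definition moved :: "'e set" where
  "moved = {io i m | i m. i < N}"

definition idx :: "'e \<Rightarrow> nat \<times> int" where
  "idx e = (THE p. e = io (fst p) (snd p))"

text \<open>Shift first, then act at the new index: this order yields the twist
  \<open>g (i - k)\<close> of the wreath product. Tree edges go to \<open>[]\<close>, so that
  \<open>al\<close> is an endomorphism of the free group on the non-tree edges, read on all edge
  words.\<close>

definition al :: "(int \<Rightarrow> 'g) \<Rightarrow> int \<Rightarrow> 'e \<Rightarrow> ('e \<times> bool) list" where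
  "al f k e = (if e \<in> moved then sub (\<lambda>j. [(io j (snd (idx e) + k), False)]) (sg (f (snd (idx e) + k)) (fst (idx e)))
     else if e \<in> TE then [] else [(e, False)])"

text \<open>The detour over \<open>x0\<close> turns an action on loops into an edge path with the
  endpoints of \<open>e\<close>. Reduction removes the common part of the tree paths; otherwise
  edges near the root could be hit infinitely often.\<close>

definition pg :: "(int \<Rightarrow> 'g) \<Rightarrow> int \<Rightarrow> 'e \<Rightarrow> ('e \<times> bool) list" where
  "pg f k e = fred (winv (tau (src e)) @ sub Lam (al f k e) @ tau (tgt e))"

lemma idx_io [simp]: "idx (io i m) = (i, m)"
  unfolding idx_def by (rule the_equality) (auto simp: io_inj)

lemma io_moved [simp]: "io i m \<in> moved \<longleftrightarrow> i < N"
  by (auto simp: moved_def io_inj)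

lemma al_io: "i < N \<Longrightarrow> al f k (io i m) = sub (\<lambda>j. [(io j (m + k), False)]) (sg (f (m + k)) i)"
  by (simp add: al_def)

lemma al_TE [simp]: "e \<in> TE \<Longrightarrow> al f k e = []"
  by (auto simp: al_def moved_def)

lemma al_fixed: "e \<notin> TE \<Longrightarrow> e \<notin> moved \<Longrightarrow> al f k e = [(e, False)]"
  by (simp add: al_def)

lemma al_letters:
  assumes "e \<in> Ed" shows "fst ` set (al f k e) \<subseteq> Ed - TE"
proof (cases "e \<in> moved")
  case True
  then obtain i m where "e = io i m" "i < N" by (auto simp: moved_def)
  then show ?thesis using io_in by (auto simp: al_io letters_sub)
next
  case False
  then show ?thesis using assms by (cases "e \<in> TE") (auto simp: al_fixed)
qed

text \<open>From copy \<open>m\<close> the composite arrives at \<open>m + l + k\<close>, where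
  \<open>f\<close> acts; \<open>g\<close> has acted at \<open>m + l\<close>, the same index
  decreased by \<open>k\<close>.\<close>

lemma al_mult:
  assumes f: "\<And>i. f i \<in> carrier A" and g: "\<And>i. g i \<in> carrier A"
  shows "feq (sub (al f k) (al g l e)) (al (\<lambda>i. f i \<otimes>\<^bsub>A\<^esub> g (i - k)) (k + l) e)"
proof (cases "e \<in> moved")
  case True
  then obtain i m where e: "e = io i m" and i: "i < N" by (auto simp: moved_def)
  let ?s = "\<lambda>j. [(io j (m + l + k), False)]"
  have "sub (al f k) (al g l e) = sub (\<lambda>j. al f k (io j (m + l))) (sg (g (m + l)) i)"
    using i by (simp add: e al_io sub_sub)
  also have "\<dots> = sub (\<lambda>j. sub ?s (sg (f (m + l + k)) j)) (sg (g (m + l)) i)"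
  proof (rule sub_cong)
    fix j assume "j \<in> fst ` set (sg (g (m + l)) i)"
    then have "j < N" using sg_letters[OF g[of "m + l"] i] by blast
    then show "al f k (io j (m + l)) = sub ?s (sg (f (m + l + k)) j)" by (simp add: al_io)
  qed
  also have "\<dots> = sub ?s (sub (sg (f (m + l + k))) (sg (g (m + l)) i))"
    by (simp add: sub_sub)
  also have "feq \<dots> (sub ?s (sg (f (m + l + k) \<otimes>\<^bsub>A\<^esub> g (m + l)) i))"
    by (intro feq_sub sg_mult f g i)
  also have "\<dots> = al (\<lambda>i. f i \<otimes>\<^bsub>A\<^esub> g (i - k)) (k + l) e"
    using i by (simp add: e al_io algebra_simps)
  finally show ?thesis .
next
  case False
  then show ?thesis by (cases "e \<in> TE") (simp_all add: al_fixed)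
qed

lemma al_one: "e \<notin> TE \<Longrightarrow> al (\<lambda>_. \<one>\<^bsub>A\<^esub>) 0 e = [(e, False)]"
  by (cases "e \<in> moved") (auto simp: moved_def al_io sg_one al_fixed)

section \<open>From words in non-tree edges to edge paths\<close>

lemma tau_letters: "v \<in> V \<Longrightarrow> fst ` set (tau v) \<subseteq> TE"
proof (induction rule: dst_induct)
  case (step v)
  then show ?case using tau_par[of v] by (auto simp: TE_def)
qed simp

lemma sub_al_tau:
  assumes "v \<in> V" shows "sub (al f k) (tau v) = []"
proof -
  have "sub (al f k) (tau v) = sub (\<lambda>_. []) (tau v)"
    using tau_letters[OF assms] by (intro sub_cong) auto
  also have "sub (\<lambda>_. []) w = []" for w :: "('e \<times> bool) list" by (induction w) auto
  finally show ?thesis .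
qed

lemma sub_al_Lam: "e \<in> Ed \<Longrightarrow> sub (al f k) (Lam e) = al f k e"
  by (simp add: Lam_def sub_winv sub_al_tau)

lemma sub_al_sub_Lam: "fst ` set w \<subseteq> Ed \<Longrightarrow> sub (al f k) (sub Lam w) = sub (al f k) w"
  unfolding sub_sub by (rule sub_cong) (auto simp: sub_al_Lam)

lemma feq_pg: "feq (pg f k e) (winv (tau (src e)) @ sub Lam (al f k e) @ tau (tgt e))"
  by (simp add: pg_def)

lemma wpath_sub_Lam: "fst ` set w \<subseteq> Ed \<Longrightarrow> wp x0 (sub Lam w) x0"
proof (induction w)
  case (Cons a w)
  then show ?case using wpath_Lam wpath_winv[OF wpath_Lam] by (auto intro!: wpath_appendI)
qed simp

lemma wpath_pg: "e \<in> Ed \<Longrightarrow> wp (src e) (pg f k e) (tgt e)"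
  unfolding pg_def using al_letters[of e f k]
  by (intro wpath_fred wpath_appendI[OF wpath_winv[OF wpath_tau] wpath_appendI[OF wpath_sub_Lam wpath_tau]]) auto

lemma sub_al_pg: "e \<in> Ed \<Longrightarrow> feq (sub (al f k) (pg g l e)) (sub (al f k) (al g l e))"
proof -
  assume e: "e \<in> Ed"
  have "feq (sub (al f k) (pg g l e)) (sub (al f k) (winv (tau (src e)) @ sub Lam (al g l e) @ tau (tgt e)))"
    by (intro feq_sub feq_pg)
  also have "\<dots> = sub (al f k) (al g l e)"
    using e sub_al_sub_Lam[OF subset_trans[OF al_letters[OF e, of g l] Diff_subset]]
    by (simp add: sub_winv sub_al_tau)
  finally show ?thesis .
qed

text \<open>The tree paths between consecutive letters cancel, as for \<open>Lam\<close>; on loops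
  at \<open>x0\<close> the assignment \<open>pg\<close> therefore acts as \<open>al\<close>
  does.\<close>

lemma feq_sub_pg:
  assumes "wp u w v" "u \<in> V"
  shows "feq (sub (pg f k) w) (winv (tau u) @ sub Lam (sub (al f k) w) @ tau v)"
  using assms
proof (induction w arbitrary: u)
  case Nil
  then show ?case by (simp add: feq_sym)
next
  case (Cons a w)
  let ?m = "lnd a" and ?L = "sub Lam (sub (al f k) [a])"
  have a: "fst a \<in> Ed" using Cons.prems by simp
  have "feq (if snd a then winv (pg f k (fst a)) else pg f k (fst a)) (winv (tau u) @ ?L @ tau ?m)"
  proof (cases "snd a")
    case True
    then show ?thesis
      using feq_winv[OF feq_pg[of f k "fst a"]] Cons.prems by (auto simp: sub_winv lst_def lend_def)
  next
    case False
    then show ?thesis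
      using feq_pg[of f k "fst a"] Cons.prems by (auto simp: lst_def lend_def)
  qed
  then have "feq (sub (pg f k) (a # w)) ((winv (tau u) @ ?L @ tau ?m) @ (winv (tau ?m) @ sub Lam (sub (al f k) w) @ tau v))"
    unfolding sub_simps(3) by (rule feq_append) (use Cons in auto)
  also have "feq \<dots> (winv (tau u) @ ?L @ sub Lam (sub (al f k) w) @ tau v)"
    using feq_cancel_winv[of "winv (tau u) @ ?L" "tau ?m" "sub Lam (sub (al f k) w) @ tau v"] by simp
  also have "\<dots> = winv (tau u) @ sub Lam (sub (al f k) (a # w)) @ tau v" by simp
  finally show ?case .
qed

lemma pg_mult:
  assumes f: "\<And>i. f i \<in> carrier A" and g: "\<And>i. g i \<in> carrier A" and e: "e \<in> Ed"
  shows "feq (sub (pg f k) (pg g l e)) (pg (\<lambda>i. f i \<otimes>\<^bsub>A\<^esub> g (i - k)) (k + l) e)"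
proof -
  have "feq (sub (pg f k) (pg g l e)) (winv (tau (src e)) @ sub Lam (sub (al f k) (pg g l e)) @ tau (tgt e))"
    by (rule feq_sub_pg[OF wpath_pg[OF e]]) (use e in simp)
  also have "feq \<dots> (winv (tau (src e)) @ sub Lam (sub (al f k) (al g l e)) @ tau (tgt e))"
    by (intro feq_append feq_refl feq_sub sub_al_pg e)
  also have "feq \<dots> (winv (tau (src e)) @ sub Lam (al (\<lambda>i. f i \<otimes>\<^bsub>A\<^esub> g (i - k)) (k + l) e) @ tau (tgt e))"
    by (intro feq_append feq_refl feq_sub al_mult f g)
  also have "feq \<dots> (pg (\<lambda>i. f i \<otimes>\<^bsub>A\<^esub> g (i - k)) (k + l) e)"
    by (rule feq_sym[OF feq_pg])
  finally show ?thesis .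
qed

lemma pg_single:
  assumes e: "e \<in> Ed" and al: "e \<notin> TE \<Longrightarrow> al f k e = [(e, False)]"
  shows "pg f k e = [(e, False)]"
proof -
  have "feq (winv (tau (src e)) @ sub Lam (al f k e) @ tau (tgt e)) [(e, False)]"
  proof (cases "e \<in> TE")
    case True
    have "feq (winv (tau (src e)) @ tau (tgt e)) [(e, False)]"
      using TE_tau[OF True]
    proof
      assume "tau (tgt e) = tau (src e) @ [(e, False)]"
      then show ?thesis using feq_cancel_winv'[of "[]" "tau (src e)" "[(e, False)]"] by simp
    next
      assume "tau (src e) = tau (tgt e) @ [(e, True)]"
      then show ?thesis using feq_cancel_winv'[of "[(e, False)]" "tau (tgt e)" "[]"] by (simp add: linv_def)
    qed
    then show ?thesis using True by simp
  next
    case False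
    then have "winv (tau (src e)) @ sub Lam (al f k e) @ tau (tgt e) =
      winv (tau (src e)) @ tau (src e) @ [(e, False)] @ winv (tau (tgt e)) @ tau (tgt e)"
      using al by (simp add: Lam_def)
    also have "feq \<dots> ([(e, False)] @ winv (tau (tgt e)) @ tau (tgt e) @ [])"
      using feq_cancel_winv'[of "[]" "tau (src e)"] by simp
    also have "feq \<dots> [(e, False)]"
      using feq_cancel_winv'[of "[(e, False)]" "tau (tgt e)" "[]"] by simp
    finally show ?thesis .
  qed
  then show ?thesis by (simp add: pg_def feq_def push_def)
qed

lemma pg_one: "e \<in> Ed \<Longrightarrow> pg (\<lambda>_. \<one>\<^bsub>A\<^esub>) 0 e = [(e, False)]"
  by (intro pg_single al_one)

text \<open>With a trivial coordinate the image is a tree path to the shifted edge, that edge, and a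
  tree path back. By \<open>tau_cancel\<close> such a tree path retains only edges on exactly one of
  its two root paths.\<close>

lemma pg_shift_letters:
  assumes i: "i < N" and one: "f (m + k) = \<one>\<^bsub>A\<^esub>" and d: "d \<in> fst ` set (pg f k (io i m))"
  shows "d = io i (m + k) \<or>
    (d \<in> fst ` set (tau (src (io i m)))) \<noteq> (d \<in> fst ` set (tau (src (io i (m + k))))) \<or>
    (d \<in> fst ` set (tau (tgt (io i m)))) \<noteq> (d \<in> fst ` set (tau (tgt (io i (m + k)))))"
proof (rule ccontr)
  let ?e = "io i m" and ?e' = "io i (m + k)"
  assume n: "\<not> ?thesis"
  let ?u = "winv (tau (src ?e)) @ tau (src ?e')" and ?v = "winv (tau (tgt ?e')) @ tau (tgt ?e)"
  have "al f k ?e = [(?e', False)]" using i one by (simp add: al_io sg_one)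
  then have "pg f k ?e = fred (?u @ [(?e', False)] @ ?v)" by (simp add: pg_def Lam_def)
  also have "\<dots> = fred (fred ?u @ [(?e', False)] @ fred ?v)"
    using feq_append[OF feq_fred(2)[of ?u] feq_append[OF feq_refl[of "[(?e', False)]"] feq_fred(2)[of ?v]]]
    by (simp add: feq_def)
  finally have eq: "pg f k ?e = fred (fred ?u @ [(?e', False)] @ fred ?v)" .
  have "d \<in> fst ` set (fred ?u @ [(?e', False)] @ fred ?v)"
    by (rule subsetD[OF letters_fred d[unfolded eq]])
  moreover have "d \<notin> fst ` set (fred ?u)" "d \<notin> fst ` set (fred ?v)"
    by (rule tau_cancel; use n io_in in auto)+
  ultimately show False using n by auto
qed

lemma finite_pg:
  assumes fin: "finite {i. f i \<noteq> \<one>\<^bsub>A\<^esub>}"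
  shows "finite {e \<in> Ed. d \<in> fst ` set (pg f k e)}"
proof -
  \<comment> \<open>A change under the shift requires that one of the two indices is exceptional,
    and the exceptional set \<open>R\<close> is finite.\<close>
  have conv: "finite {(i, m). Q i m \<noteq> Q i (m + k)}"
    if "finite {(i, m). Q i m} \<or> finite {(i, m). \<not> Q i m}" for Q :: "nat \<Rightarrow> int \<Rightarrow> bool"
  proof -
    have inj: "inj (\<lambda>p::nat \<times> int. (fst p, snd p + k))" by (auto simp: inj_def)
    from that have "\<exists>R. finite R \<and> {(i, m). Q i m \<noteq> Q i (m + k)} \<subseteq> R \<union> (\<lambda>p. (fst p, snd p + k)) -` R"
    proof
      assume "finite {(i, m). Q i m}"
      then show ?thesis by (intro exI[of _ "{(i, m). Q i m}"]) auto
    next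
      assume "finite {(i, m). \<not> Q i m}"
      then show ?thesis by (intro exI[of _ "{(i, m). \<not> Q i m}"]) auto
    qed
    then show ?thesis using finite_vimageI[OF _ inj] by (meson finite_UnI finite_subset)
  qed
  let ?S = "\<lambda>i m. d \<in> fst ` set (tau (src (io i m)))" and ?T = "\<lambda>i m. d \<in> fst ` set (tau (tgt (io i m)))"
  \<comment> \<open>The causes for \<open>d\<close> in the image of a moved edge: a nontrivial
    coordinate, the shifted edge itself, or a tree path between sources or targets. Unmoved edges
    contribute at most \<open>d\<close>.\<close>
  let ?J = "{..<N} \<times> (\<lambda>m. m - k) ` {i. f i \<noteq> \<one>\<^bsub>A\<^esub>} \<union> {(i, m). io i (m + k) = d} \<union>
    {(i, m). ?S i m \<noteq> ?S i (m + k)} \<union> {(i, m). ?T i m \<noteq> ?T i (m + k)}"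
  have "finite {(i, m). io i (m + k) = d}"
  proof (rule finite_subset)
    show "{(i, m). io i (m + k) = d} \<subseteq> {(fst (idx d), snd (idx d) - k)}" by auto
  qed simp
  then have "finite ?J"
    using fin conv[of ?S] conv[of ?T] io_src[of d] io_tgt[of d] by auto
  moreover have "{e \<in> Ed. d \<in> fst ` set (pg f k e)} \<subseteq> insert d ((\<lambda>(i, m). io i m) ` ?J)"
  proof
    fix e assume e: "e \<in> {e \<in> Ed. d \<in> fst ` set (pg f k e)}"
    show "e \<in> insert d ((\<lambda>(i, m). io i m) ` ?J)"
    proof (cases "e \<in> moved")
      case True
      then obtain i m where im: "e = io i m" "i < N" by (auto simp: moved_def)
      have "(i, m) \<in> ?J"
      proof (cases "f (m + k) = \<one>\<^bsub>A\<^esub>")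
        case True
        then show ?thesis using pg_shift_letters[of i f m k d] True e im by auto
      next
        case False
        then have "m \<in> (\<lambda>m. m - k) ` {i. f i \<noteq> \<one>\<^bsub>A\<^esub>}" by (intro image_eqI[of _ _ "m + k"]) auto
        then show ?thesis using im by auto
      qed
      then show ?thesis using im by blast
    next
      case False
      then have "pg f k e = [(e, False)]" using e by (intro pg_single al_fixed) auto
      then show ?thesis using e by auto
    qed
  qed
  ultimately show ?thesis by (meson finite.insertI finite_imageI finite_subset)
qed

lemma inner_trivial:
  assumes f: "\<And>i. f i \<in> carrier A" and w: "wp x0 w x0"
    and comm: "\<And>u. wp x0 u x0 \<Longrightarrow> feq (sub (pg f k) u @ w) (w @ u)"
  shows "f = (\<lambda>_. \<one>\<^bsub>A\<^esub>) \<and> k = 0"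
proof -
  \<comment> \<open>The neutral action deletes tree letters: it is the collapse of the spanning
    tree, under which \<open>Lam e\<close> becomes the single letter \<open>e\<close>.\<close>
  let ?\<kappa> = "al (\<lambda>_. \<one>\<^bsub>A\<^esub>) 0"
  have \<kappa>: "sub ?\<kappa> v = v" if "fst ` set v \<subseteq> Ed - TE" for v
    using sub_cong[of v ?\<kappa> "\<lambda>x. [(x, False)]"] al_one that sub_single[of v] by auto
  define w' where "w' = fred (sub ?\<kappa> w)"
  have 1: "feq (al f k e @ w') (w' @ [(e, False)])" if e: "e \<in> Ed - TE" for e
  proof -
    have al: "fst ` set (al f k e) \<subseteq> Ed - TE" using al_letters e by blast
    have "feq (sub (pg f k) (Lam e)) (sub Lam (al f k e))"
      using feq_sub_pg[OF wpath_Lam x0, of e f k] e by (simp add: sub_al_Lam)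
    then have "feq (sub ?\<kappa> (sub (pg f k) (Lam e))) (sub ?\<kappa> (sub Lam (al f k e)))"
      by (rule feq_sub)
    also have "\<dots> = al f k e"
      using al by (subst sub_al_sub_Lam) (auto simp: \<kappa>)
    finally have a: "feq (sub ?\<kappa> (sub (pg f k) (Lam e))) (al f k e)" .
    have "feq (al f k e @ w') (sub ?\<kappa> (sub (pg f k) (Lam e)) @ sub ?\<kappa> w)"
      unfolding w'_def by (intro feq_append feq_sym[OF a] feq_fred)
    also have "\<dots> = sub ?\<kappa> (sub (pg f k) (Lam e) @ w)" by simp
    also have "feq \<dots> (sub ?\<kappa> (w @ Lam e))"
      by (intro feq_sub comm wpath_Lam) (use e in auto)
    also have "\<dots> = sub ?\<kappa> w @ [(e, False)]"
      using e by (simp add: sub_al_Lam al_one)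
    also have "feq \<dots> (w' @ [(e, False)])"
      unfolding w'_def by (intro feq_append feq_refl feq_fred)
    finally show ?thesis .
  qed
  \<comment> \<open>The row \<open>io N\<close> is fixed and infinite, so one of its edges avoids
    the finite word \<open>w'\<close>, as \<open>feq_commute_letter_Nil\<close> demands.\<close>
  have "inj (io N)" by (auto simp: inj_def io_inj)
  then have "infinite (range (io N))" using finite_imageD infinite_UNIV_int by blast
  then obtain e where e: "e \<in> range (io N)" "e \<notin> fst ` set w'"
    using finite_subset[of "range (io N)" "fst ` set w'"] by blast
  then have "al f k e = [(e, False)]" "e \<in> Ed - TE" using io_in by (auto intro!: al_fixed)
  then have "feq (w' @ [(e, False)]) ((e, False) # w')" using 1[of e] by (simp add: feq_sym)
  then have w': "w' = []"
    using feq_commute_letter_Nil[of w' e] e(2) by (simp add: w'_def isred_fred)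
  have 2: "feq (sub (\<lambda>j. [(io j (m + k), False)]) (sg (f (m + k)) i)) [(io i m, False)]" if "i < N" for i m
    using 1[of "io i m"] io_in that by (simp add: w' al_io)
  \<comment> \<open>The image of \<open>io 0 0\<close> uses letters of copy \<open>k\<close> only,
    yet it must reduce to a letter of copy 0.\<close>
  have k: "k = 0"
  proof (rule ccontr)
    assume k: "k \<noteq> 0"
    have "fred [(io 0 0, False)] = [(io 0 0, False)]" by (simp add: push_def)
    then have "io 0 0 \<in> fst ` set (fred (sub (\<lambda>j. [(io j k, False)]) (sg (f k) 0)))"
      using 2[of 0 0] N by (simp add: feq_def)
    then have "io 0 0 \<in> fst ` set (sub (\<lambda>j. [(io j k, False)]) (sg (f k) 0))"
      by (rule subsetD[OF letters_fred])
    then show False using k by (auto simp: letters_sub io_inj)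
  qed
  have "f m = \<one>\<^bsub>A\<^esub>" for m
  proof (rule sg_faithful[OF f])
    fix i assume i: "i < N"
    \<comment> \<open>Forgetting the copy brings the words back to the letters on which
      \<open>sg\<close> is defined.\<close>
    let ?r = "\<lambda>e. [(fst (idx e), False)]"
    have "feq (sub ?r (sub (\<lambda>j. [(io j m, False)]) (sg (f m) i))) (sub ?r [(io i m, False)])"
      using feq_sub[OF 2[OF i, of m], of ?r] k by simp
    then show "feq (sg (f m) i) [(i, False)]" by (simp add: sub_sub sub_single)
  qed
  with k show ?thesis by auto
qed

end

text \<open>Two extractions, one for the sources and then one for the targets; passing to the second
  subsequence keeps the first convergence. The result is reindexed by pairs through an injective
  encoding.\<close>

lemma (in rooted_graph) ex_io:
  assumes inf: "infinite (Ed - TE)"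
  obtains io :: "nat \<Rightarrow> int \<Rightarrow> 'e" where
    "\<And>i m j k. io i m = io j k \<longleftrightarrow> i = j \<and> m = k" "\<And>i m. io i m \<in> Ed - TE"
    "\<And>d. finite {(i, m). d \<in> fst ` set (tau (src (io i m)))} \<or> finite {(i, m). d \<notin> fst ` set (tau (src (io i m)))}"
    "\<And>d. finite {(i, m). d \<in> fst ` set (tau (tgt (io i m)))} \<or> finite {(i, m). d \<notin> fst ` set (tau (tgt (io i m)))}"
proof -
  obtain e0 :: "nat \<Rightarrow> 'e" where e0: "inj e0" "range e0 \<subseteq> Ed - TE"
    using infinite_countable_subset[OF inf] by blast
  let ?S = "\<lambda>j. fst ` set (tau (src (e0 j)))" and ?T = "\<lambda>j. fst ` set (tau (tgt (e0 j)))"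
  have cS: "countable (\<Union>j. ?S j)" by (intro countable_UN) (auto intro: countable_finite)
  obtain r :: "nat \<Rightarrow> nat" where r: "strict_mono r" "\<And>d. finite {j. d \<in> ?S (r j)} \<or> finite {j. d \<notin> ?S (r j)}"
    by (rule convergent_subsequence_of_sets[OF cS]) (rule that)
  have cT: "countable (\<Union>j. ?T (r j))" by (intro countable_UN) (auto intro: countable_finite)
  obtain r' :: "nat \<Rightarrow> nat" where r': "strict_mono r'" "\<And>d. finite {j. d \<in> ?T (r (r' j))} \<or> finite {j. d \<notin> ?T (r (r' j))}"
    by (rule convergent_subsequence_of_sets[OF cT]) (rule that)
  define c where "c i m = r' (prod_encode (i, int_encode m))" for i m
  have inj_r: "inj r" "inj r'" using r(1) r'(1) strict_mono_imp_inj_on by auto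
  define enc where "enc p = prod_encode (fst p, int_encode (snd p))" for p
  have inj_enc: "inj enc" by (auto simp: inj_def enc_def prod_eq_iff inj_eq[OF inj_int_encode])
  have fin: "finite {(i, m). Q (c i m)}" if "finite {j. Q (r' j)}" for Q
  proof -
    have "{(i, m). Q (c i m)} = enc -` {j. Q (r' j)}" by (auto simp: enc_def c_def)
    then show ?thesis using finite_vimageI[OF that inj_enc] by simp
  qed
  have fin': "finite {j. Q (r' j)}" if "finite {j. Q j}" for Q
    using finite_vimageI[OF that inj_r(2)] by (simp add: vimage_def)
  show thesis
  proof (rule that[of "\<lambda>i m. e0 (r (c i m))"])
    show "e0 (r (c i m)) = e0 (r (c j k)) \<longleftrightarrow> i = j \<and> m = k" for i m j k
      using inj_eq[OF e0(1)] inj_eq[OF inj_r(1)] inj_eq[OF inj_r(2)] by (simp add: c_def inj_eq[OF inj_int_encode])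
    show "e0 (r (c i m)) \<in> Ed - TE" for i m using e0(2) by auto
    show "finite {(i, m). d \<in> ?S (r (c i m))} \<or> finite {(i, m). d \<notin> ?S (r (c i m))}" for d
      using r(2)[of d] fin[OF fin', of "\<lambda>j. d \<in> ?S (r j)"] fin[OF fin', of "\<lambda>j. d \<notin> ?S (r j)"] by blast
    show "finite {(i, m). d \<in> ?T (r (c i m))} \<or> finite {(i, m). d \<notin> ?T (r (c i m))}" for d
      using r'(2)[of d] fin[of "\<lambda>j. d \<in> ?T (r j)"] fin[of "\<lambda>j. d \<notin> ?T (r j)"] by blast
  qed
qed

section \<open>Proper homotopy classes\<close>

abbreviation cyl :: "'a topology \<Rightarrow> (real \<times> 'a) topology" where
  "cyl T \<equiv> prod_topology (top_of_set {0..1}) T"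

lemma proper_cmapD:
  assumes "proper_cmap T Y f"
  shows "continuous_map T Y f" "compactin Y K \<Longrightarrow> compactin T {x \<in> topspace T. f x \<in> K}"
  using assms by (auto simp: proper_cmap_def)

lemma compactin_I [simp]: "compactin (top_of_set {0..1}) {0..1::real}"
  by (simp add: compactin_subtopology)

lemma proper_homotopicE:
  assumes "proper_homotopic T f g"
  obtains H where "proper_cmap (cyl T) T H" "\<And>x. H (0, x) = f x" "\<And>x. H (1, x) = g x"
  using assms unfolding proper_homotopic_def by blast

text \<open>The compact preimage is cut with the closed slice at level \<open>c\<close> and then
  projected.\<close>

lemma proper_cmap_slice:
  assumes H: "proper_cmap (cyl T) T H" and c: "c \<in> {0..1}"
  shows "proper_cmap T T (\<lambda>x. H (c, x))"
  unfolding proper_cmap_def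
proof (intro conjI allI impI)
  have "continuous_map T (cyl T) (\<lambda>x. (c, x))"
    using c by (intro continuous_map_pairedI) auto
  from continuous_map_compose[OF this proper_cmapD(1)[OF H]]
  show "continuous_map T T (\<lambda>x. H (c, x))" by (simp add: comp_def)
  fix K assume "compactin T K"
  then have C: "compactin (cyl T) {z \<in> topspace (cyl T). H z \<in> K}" (is "compactin _ ?C")
    using proper_cmapD(2)[OF H] by blast
  have "closedin (top_of_set {0..1}) {c}" using c by (simp add: closed_subset)
  then have "closedin (cyl T) ({c} \<times> topspace T)" by (simp add: closedin_prod_Times_iff)
  then have "compactin (cyl T) (({c} \<times> topspace T) \<inter> ?C)" using C by (rule closed_Int_compactin)
  from image_compactin[OF this continuous_map_snd]
  have "compactin T (snd ` (({c} \<times> topspace T) \<inter> ?C))" .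
  also have "snd ` (({c} \<times> topspace T) \<inter> ?C) = {x \<in> topspace T. H (c, x) \<in> K}"
    using c by (force simp: image_iff)
  finally show "compactin T {x \<in> topspace T. H (c, x) \<in> K}" .
qed

lemma proper_homotopic_imp_proper:
  assumes "proper_homotopic T f g"
  shows "proper_cmap T T f" "proper_cmap T T g"
proof -
  obtain H where H: "proper_cmap (cyl T) T H" "\<And>x. H (0, x) = f x" "\<And>x. H (1, x) = g x"
    using proper_homotopicE[OF assms] by metis
  show "proper_cmap T T f" "proper_cmap T T g"
    using proper_cmap_slice[OF H(1), of 0] proper_cmap_slice[OF H(1), of 1] H(2,3) by simp_all
qed

lemma proper_cmap_compose:
  assumes "proper_cmap T Y f" "proper_cmap Y Z g"
  shows "proper_cmap T Z (g \<circ> f)"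
  unfolding proper_cmap_def
proof (intro conjI allI impI)
  show "continuous_map T Z (g \<circ> f)" using assms by (auto simp: proper_cmap_def intro: continuous_map_compose)
  fix K assume "compactin Z K"
  then have "compactin T {x \<in> topspace T. f x \<in> {y \<in> topspace Y. g y \<in> K}}"
    by (intro proper_cmapD(2)[OF assms(1) proper_cmapD(2)[OF assms(2)]])
  also have "{x \<in> topspace T. f x \<in> {y \<in> topspace Y. g y \<in> K}} = {x \<in> topspace T. (g \<circ> f) x \<in> K}"
    using continuous_map_funspace[OF proper_cmapD(1)[OF assms(1)]] by auto
  finally show "compactin T {x \<in> topspace T. (g \<circ> f) x \<in> K}" .
qed

lemma proper_cmap_id: "proper_cmap T T id"
  unfolding proper_cmap_def
proof (intro conjI allI impI)
  fix K assume K: "compactin T K"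
  then have "{x \<in> topspace T. id x \<in> K} = K" using compactin_subset_topspace by auto
  with K show "compactin T {x \<in> topspace T. id x \<in> K}" by simp
qed simp

lemma proper_cmap_snd: "proper_cmap (cyl T) T snd"
  unfolding proper_cmap_def
proof (intro conjI allI impI)
  fix K assume K: "compactin T K"
  then have "{z \<in> topspace (cyl T). snd z \<in> K} = {0..1} \<times> K" using compactin_subset_topspace by fastforce
  with K show "compactin (cyl T) {z \<in> topspace (cyl T). snd z \<in> K}" by (simp add: compactin_Times)
qed (rule continuous_map_snd)

lemma proper_homotopic_refl: "proper_cmap T T f \<Longrightarrow> proper_homotopic T f f"
  using proper_cmap_compose[OF proper_cmap_snd] unfolding proper_homotopic_def
  by (intro exI[of _ "f \<circ> snd"]) auto

lemma proper_homotopic_sym: assumes "proper_homotopic T f g" shows "proper_homotopic T g f"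
proof -
  obtain H where H: "proper_cmap (cyl T) T H" "\<And>x. H (0, x) = f x" "\<And>x. H (1, x) = g x"
    using proper_homotopicE[OF assms] by metis
  let ?r = "\<lambda>z. (1 - fst z, snd z)"
  have r: "continuous_map (cyl T) (cyl T) ?r"
  proof (intro continuous_map_pairedI continuous_map_snd)
    have "continuous_map (top_of_set {0..1}) (top_of_set {0..1}) (\<lambda>s::real. 1 - s)"
      by (auto intro!: continuous_intros)
    from continuous_map_compose[OF continuous_map_fst this]
    show "continuous_map (cyl T) (top_of_set {0..1}) (\<lambda>z. 1 - fst z)" by (simp add: comp_def)
  qed
  have "proper_cmap (cyl T) (cyl T) ?r"
    unfolding proper_cmap_def
  proof (intro conjI allI impI r)
    fix K assume K: "compactin (cyl T) K"
    have "{z \<in> topspace (cyl T). ?r z \<in> K} = ?r ` K"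
    proof (intro equalityI subsetI)
      fix z assume "z \<in> {z \<in> topspace (cyl T). ?r z \<in> K}"
      then show "z \<in> ?r ` K" by (intro image_eqI[of _ _ "?r z"]) auto
    qed (use compactin_subset_topspace[OF K] in force)
    then show "compactin (cyl T) {z \<in> topspace (cyl T). ?r z \<in> K}" using image_compactin[OF K r] by simp
  qed
  from proper_cmap_compose[OF this H(1)] show ?thesis
    unfolding proper_homotopic_def using H(2,3) by (intro exI[of _ "H \<circ> ?r"]) auto
qed

lemma proper_homotopic_trans:
  assumes "proper_homotopic T f g" "proper_homotopic T g h"
  shows "proper_homotopic T f h"
proof -
  obtain H where H: "proper_cmap (cyl T) T H" "\<And>x. H (0, x) = f x" "\<And>x. H (1, x) = g x"
    using proper_homotopicE[OF assms(1)] by metis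
  obtain K where K: "proper_cmap (cyl T) T K" "\<And>x. K (0, x) = g x" "\<And>x. K (1, x) = h x"
    using proper_homotopicE[OF assms(2)] by metis
  let ?a = "\<lambda>z. (2 * fst z, snd z)" and ?b = "\<lambda>z. (2 * fst z - 1, snd z)"
  define J where "J z = (if fst z \<le> 1/2 then H (?a z) else K (?b z))" for z
  have fst0: "continuous_map (cyl T) euclideanreal fst"
    by (metis continuous_map_fst continuous_map_in_subtopology)
  then have fstc: "continuous_map (subtopology (cyl T) S) euclideanreal fst" for S
    by (rule continuous_map_from_subtopology)
  have cont: "continuous_map (cyl T) T J"
    unfolding J_def
  proof (rule continuous_map_cases_le)
    show "continuous_map (cyl T) euclideanreal fst" "continuous_map (cyl T) euclideanreal (\<lambda>_. 1/2)"
      using fst0 by simp_all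
    let ?A = "{x \<in> topspace (cyl T). fst x \<le> 1/2}" and ?B = "{x \<in> topspace (cyl T). 1/2 \<le> fst x}"
    have "continuous_map (subtopology (cyl T) ?A) (cyl T) ?a"
      by (intro continuous_map_pairedI continuous_map_into_subtopology continuous_map_real_mult fstc
          continuous_map_from_subtopology[OF continuous_map_snd]) auto
    from continuous_map_compose[OF this proper_cmapD(1)[OF H(1)]]
    show "continuous_map (subtopology (cyl T) ?A) T (\<lambda>z. H (?a z))" by (simp add: comp_def)
    have "continuous_map (subtopology (cyl T) ?B) (cyl T) ?b"
      by (intro continuous_map_pairedI continuous_map_into_subtopology continuous_map_real_mult continuous_map_diff fstc
          continuous_map_from_subtopology[OF continuous_map_snd]) auto
    from continuous_map_compose[OF this proper_cmapD(1)[OF K(1)]]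
    show "continuous_map (subtopology (cyl T) ?B) T (\<lambda>z. K (?b z))" by (simp add: comp_def)
    fix z :: "real \<times> 'a" assume "z \<in> topspace (cyl T)" "fst z = 1/2"
    then have e: "2 * fst z = 1" by simp
    show "H (?a z) = K (?b z)" unfolding e H(3) by (simp add: K(2))
  qed
  have "proper_cmap (cyl T) T J"
    unfolding proper_cmap_def
  proof (intro conjI allI impI cont)
    fix C assume C: "compactin T C"
    \<comment> \<open>Inverses of the two reparametrizations: the preimage under \<open>J\<close> is
      the union of their images of two compact sets.\<close>
    let ?a' = "\<lambda>z. (fst z / 2, snd z)" and ?b' = "\<lambda>z. ((fst z + 1) / 2, snd z)"
    let ?CH = "{z \<in> topspace (cyl T). H z \<in> C}" and ?CK = "{z \<in> topspace (cyl T). K z \<in> C}"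
    have c: "continuous_map (cyl T) (cyl T) (\<lambda>z. (q (fst z), snd z))"
      if "continuous_map (top_of_set {0..1}) (top_of_set {0..1}) q" for q
      using continuous_map_compose[OF continuous_map_fst that, of T]
      by (intro continuous_map_pairedI continuous_map_snd) (simp add: comp_def)
    have "continuous_map (cyl T) (cyl T) ?a'" "continuous_map (cyl T) (cyl T) ?b'"
      by (rule c; auto intro!: continuous_intros)+
    then have "compactin (cyl T) (?a' ` ?CH \<union> ?b' ` ?CK)"
      using proper_cmapD(2)[OF H(1) C] proper_cmapD(2)[OF K(1) C]
      by (intro compactin_Un image_compactin[of "cyl T" _ "cyl T"])
    also have "?a' ` ?CH \<union> ?b' ` ?CK = {z \<in> topspace (cyl T). J z \<in> C}"
    proof (intro equalityI subsetI)
      fix z assume z: "z \<in> {z \<in> topspace (cyl T). J z \<in> C}"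
      show "z \<in> ?a' ` ?CH \<union> ?b' ` ?CK"
      proof (cases "fst z \<le> 1/2")
        case True
        then show ?thesis using z by (intro UnI1 image_eqI[of _ _ "?a z"]) (auto simp: J_def)
      next
        case False
        then show ?thesis using z by (intro UnI2 image_eqI[of _ _ "?b z"]) (auto simp: J_def)
      qed
    next
      fix z assume "z \<in> ?a' ` ?CH \<union> ?b' ` ?CK"
      then show "z \<in> {z \<in> topspace (cyl T). J z \<in> C}"
      proof
        assume "z \<in> ?a' ` ?CH"
        then show ?thesis by (auto simp: J_def)
      next
        assume "z \<in> ?b' ` ?CK"
        then obtain s x where sx: "s \<in> {0..1}" "x \<in> topspace T" "K (s, x) \<in> C" "z = ((s + 1) / 2, x)" by auto
        show ?thesis
        \<comment> \<open>\<open>s = 0\<close> is the seam at height 1/2, where \<open>J\<close> is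
          defined by \<open>H\<close> and not by \<open>K\<close>.\<close>
        proof (cases "s = 0")
          case True
          then show ?thesis using sx H(3) K(2) by (auto simp: J_def)
        next
          case False
          then have "2 * ((s + 1) / 2) - 1 = s" "\<not> (s + 1) / 2 \<le> 1/2" using sx by (auto simp: field_simps)
          then show ?thesis using sx by (auto simp: J_def)
        qed
      qed
    qed
    finally show "compactin (cyl T) {z \<in> topspace (cyl T). J z \<in> C}" .
  qed
  then show ?thesis
    unfolding proper_homotopic_def using H(2) K(3) by (intro exI[of _ J]) (auto simp: J_def)
qed

lemma proper_homotopic_compose_left:
  assumes "proper_homotopic T f f'" "proper_cmap T T g"
  shows "proper_homotopic T (g \<circ> f) (g \<circ> f')"
proof -
  obtain H where H: "proper_cmap (cyl T) T H" "\<And>x. H (0, x) = f x" "\<And>x. H (1, x) = f' x"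
    using proper_homotopicE[OF assms(1)] by metis
  show ?thesis
    unfolding proper_homotopic_def using proper_cmap_compose[OF H(1) assms(2)] H(2,3)
    by (intro exI[of _ "g \<circ> H"]) auto
qed

text \<open>Properness of the induced map of the cylinder: the preimage of a compact
  \<open>K\<close> lies over the compact preimage of the projection of \<open>K\<close>, and it is
  closed because \<open>T\<close> is Hausdorff.\<close>

lemma proper_homotopic_compose_right:
  assumes "proper_homotopic T g g'" and f: "proper_cmap T T f" and haus: "Hausdorff_space T"
  shows "proper_homotopic T (g \<circ> f) (g' \<circ> f)"
proof -
  obtain H where H: "proper_cmap (cyl T) T H" "\<And>x. H (0, x) = g x" "\<And>x. H (1, x) = g' x"
    using proper_homotopicE[OF assms(1)] by metis
  let ?r = "\<lambda>z. (fst z, f (snd z))"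
  have r: "continuous_map (cyl T) (cyl T) ?r"
    using continuous_map_compose[OF continuous_map_snd proper_cmapD(1)[OF f]]
    by (intro continuous_map_pairedI continuous_map_fst) (auto simp: comp_def)
  have haus2: "Hausdorff_space (cyl T)"
    using haus by (simp add: Hausdorff_space_prod_topology Hausdorff_space_subtopology)
  have "proper_cmap (cyl T) (cyl T) ?r"
    unfolding proper_cmap_def
  proof (intro conjI allI impI r)
    fix K assume K: "compactin (cyl T) K"
    have "compactin T {x \<in> topspace T. f x \<in> snd ` K}"
      by (intro proper_cmapD(2)[OF f] image_compactin[OF K continuous_map_snd])
    then have "compactin (cyl T) ({0..1} \<times> {x \<in> topspace T. f x \<in> snd ` K})"
      by (simp add: compactin_Times)
    then show "compactin (cyl T) {z \<in> topspace (cyl T). ?r z \<in> K}"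
    proof (rule closed_compactin)
      show "closedin (cyl T) {z \<in> topspace (cyl T). ?r z \<in> K}"
        by (intro closedin_continuous_map_preimage[OF r] compactin_imp_closedin haus2 K)
    qed force
  qed
  from proper_cmap_compose[OF this H(1)] show ?thesis
    unfolding proper_homotopic_def using H(2,3) by (intro exI[of _ "H \<circ> ?r"]) auto
qed

section \<open>Products of mapping classes\<close>

lemma phe_class_eqI:
  assumes "proper_homotopic T f g" shows "phe_class T f = phe_class T g"
  unfolding phe_class_def using assms proper_homotopic_trans proper_homotopic_sym by blast

lemma phe_class_some:
  assumes "proper_cmap T T f"
  shows "proper_homotopic T f (SOME g. g \<in> phe_class T f)"
  using someI[of "\<lambda>g. g \<in> phe_class T f" f] assms proper_homotopic_refl by (auto simp: phe_class_def)

text \<open>Representatives are chosen by \<open>SOME\<close>; replacing the left one precomposes a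
  homotopy with a proper map, and this is where the Hausdorff property enters.\<close>

lemma MapGrp_mult:
  assumes "Hausdorff_space T" "proper_cmap T T f" "proper_cmap T T g"
  shows "phe_class T f \<otimes>\<^bsub>MapGrp T\<^esub> phe_class T g = phe_class T (f \<circ> g)"
proof -
  let ?f = "SOME a. a \<in> phe_class T f" and ?g = "SOME a. a \<in> phe_class T g"
  have f: "proper_homotopic T f ?f" and g: "proper_homotopic T g ?g"
    using phe_class_some assms by auto
  have "proper_homotopic T (f \<circ> g) (f \<circ> ?g)"
    by (rule proper_homotopic_compose_left[OF g assms(2)])
  moreover have "proper_homotopic T (f \<circ> ?g) (?f \<circ> ?g)"
    by (rule proper_homotopic_compose_right[OF f proper_homotopic_imp_proper(2)[OF g] assms(1)])
  ultimately have "phe_class T (f \<circ> g) = phe_class T (?f \<circ> ?g)"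
    using phe_class_eqI proper_homotopic_trans by metis
  then show ?thesis by (simp add: MapGrp_def)
qed

lemma PMapGrp_simps:
  "\<one>\<^bsub>PMapGrp T\<^esub> = phe_class T id" "A \<otimes>\<^bsub>PMapGrp T\<^esub> B = A \<otimes>\<^bsub>MapGrp T\<^esub> B"
  "carrier (PMapGrp T) = {phe_class T f | f. proper_htpy_equiv T f \<and> (\<forall>g\<in>phe_class T f. \<forall>\<epsilon>\<in>Ends T. end_act T g \<epsilon> = \<epsilon>)}"
  by (auto simp: PMapGrp_def MapGrp_def)

text \<open>Associativity of composition makes the inverses formed in \<open>PMapGrp T\<close> unique, so the image of a
  group is a subgroup although \<open>PMapGrp T\<close> itself is not shown to be a group.\<close>
lemma embeds_in_PMapGrp:
  assumes haus: "Hausdorff_space T" and W: "group W"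
    and proper: "\<And>g. g \<in> carrier W \<Longrightarrow> proper_cmap T T (F g)"
    and mult: "\<And>g h. g \<in> carrier W \<Longrightarrow> h \<in> carrier W \<Longrightarrow> proper_homotopic T (F g \<circ> F h) (F (g \<otimes>\<^bsub>W\<^esub> h))"
    and one: "proper_homotopic T (F \<one>\<^bsub>W\<^esub>) id"
    and ends: "\<And>g f \<epsilon>. g \<in> carrier W \<Longrightarrow> proper_homotopic T (F g) f \<Longrightarrow> \<epsilon> \<in> Ends T \<Longrightarrow> end_act T f \<epsilon> = \<epsilon>"
    and faithful: "\<And>g. g \<in> carrier W \<Longrightarrow> proper_homotopic T (F g) id \<Longrightarrow> g = \<one>\<^bsub>W\<^esub>"
  shows "\<exists>H. subgroup H (PMapGrp T) \<and> (PMapGrp T)\<lparr>carrier := H\<rparr> \<cong> W"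
proof -
  interpret W: group W by fact
  define c where "c g = phe_class T (F g)" for g
  have c_mult: "c g \<otimes>\<^bsub>MapGrp T\<^esub> c h = c (g \<otimes>\<^bsub>W\<^esub> h)" if "g \<in> carrier W" "h \<in> carrier W" for g h
    unfolding c_def using MapGrp_mult[OF haus proper proper] phe_class_eqI[OF mult] that by simp
  have c_one: "c \<one>\<^bsub>W\<^esub> = phe_class T id" unfolding c_def by (rule phe_class_eqI[OF one])
  have phe: "proper_htpy_equiv T (F g)" if g: "g \<in> carrier W" for g
    unfolding proper_htpy_equiv_def
  proof (intro conjI exI)
    show "proper_cmap T T (F g)" "proper_cmap T T (F (inv\<^bsub>W\<^esub> g))" using proper g by auto
    show "proper_homotopic T (F (inv\<^bsub>W\<^esub> g) \<circ> F g) id" "proper_homotopic T (F g \<circ> F (inv\<^bsub>W\<^esub> g)) id"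
      using mult[of "inv\<^bsub>W\<^esub> g" g] mult[of g "inv\<^bsub>W\<^esub> g"] g one proper_homotopic_trans by auto
  qed
  \<comment> \<open>\<open>PMapGrp\<close> tests every representative of a class, hence the
    assumption on ends ranges over all maps properly homotopic to \<open>F g\<close>.\<close>
  have c_in: "c g \<in> carrier (PMapGrp T)" if g: "g \<in> carrier W" for g
    unfolding PMapGrp_simps c_def using phe[OF g] ends[OF g] by (auto simp: phe_class_def)
  have inj: "inj_on c (carrier W)"
  proof (rule inj_onI)
    fix g h assume gh: "g \<in> carrier W" "h \<in> carrier W" "c g = c h"
    let ?k = "inv\<^bsub>W\<^esub> g \<otimes>\<^bsub>W\<^esub> h"
    have "c ?k = c (inv\<^bsub>W\<^esub> g) \<otimes>\<^bsub>MapGrp T\<^esub> c g" using c_mult gh by simp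
    also have "\<dots> = phe_class T id" using c_mult[of "inv\<^bsub>W\<^esub> g" g] gh c_one by simp
    finally have eq: "phe_class T (F ?k) = phe_class T id" by (simp only: c_def)
    have "id \<in> phe_class T (F ?k)"
      unfolding eq using proper_homotopic_refl[OF proper_cmap_id, of T] proper_cmap_id[of T] by (simp add: phe_class_def)
    then have "?k = \<one>\<^bsub>W\<^esub>" using faithful[of ?k] gh by (simp add: phe_class_def)
    then show "g = h" using gh by (metis W.inv_closed W.inv_equality W.inv_inv)
  qed
  have inv: "inv\<^bsub>PMapGrp T\<^esub> (c g) = c (inv\<^bsub>W\<^esub> g)" if g: "g \<in> carrier W" for g
    unfolding m_inv_def[of "PMapGrp T"]
  proof (rule the_equality)
    show "c (inv\<^bsub>W\<^esub> g) \<in> carrier (PMapGrp T) \<and> c g \<otimes>\<^bsub>PMapGrp T\<^esub> c (inv\<^bsub>W\<^esub> g) = \<one>\<^bsub>PMapGrp T\<^esub> \<and>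
      c (inv\<^bsub>W\<^esub> g) \<otimes>\<^bsub>PMapGrp T\<^esub> c g = \<one>\<^bsub>PMapGrp T\<^esub>"
      using c_in c_mult[of g "inv\<^bsub>W\<^esub> g"] c_mult[of "inv\<^bsub>W\<^esub> g" g] c_one g by (simp add: PMapGrp_simps(1,2))
    fix y assume y: "y \<in> carrier (PMapGrp T) \<and> c g \<otimes>\<^bsub>PMapGrp T\<^esub> y = \<one>\<^bsub>PMapGrp T\<^esub> \<and> y \<otimes>\<^bsub>PMapGrp T\<^esub> c g = \<one>\<^bsub>PMapGrp T\<^esub>"
    then obtain f where f: "proper_cmap T T f" "y = phe_class T f"
      by (auto simp: PMapGrp_simps(3) proper_htpy_equiv_def)
    let ?g' = "F (inv\<^bsub>W\<^esub> g)"
    have p: "proper_cmap T T ?g'" "proper_cmap T T (F g)" using proper g by auto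
    have 1: "phe_class T (F g \<circ> f) = phe_class T id"
      using y MapGrp_mult[OF haus p(2) f(1)] by (simp add: PMapGrp_simps(1,2) c_def f(2))
    have 2: "phe_class T (?g' \<circ> F g) = phe_class T id"
      using c_mult[of "inv\<^bsub>W\<^esub> g" g] g c_one MapGrp_mult[OF haus p] by (simp add: c_def)
    \<comment> \<open>The usual computation \<open>y = (g' g) y = g' (g y) = g'\<close>, carried out
      on classes.\<close>
    have "y = phe_class T id \<otimes>\<^bsub>MapGrp T\<^esub> y"
      using MapGrp_mult[OF haus proper_cmap_id f(1)] by (simp add: f(2))
    also have "\<dots> = phe_class T ((?g' \<circ> F g) \<circ> f)"
      using MapGrp_mult[OF haus proper_cmap_compose[OF p(2,1)] f(1)] by (simp add: 2 f(2))
    also have "\<dots> = phe_class T ?g' \<otimes>\<^bsub>MapGrp T\<^esub> phe_class T (F g \<circ> f)"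
      using MapGrp_mult[OF haus p(1) proper_cmap_compose[OF f(1) p(2)]] by (simp add: comp_assoc)
    also have "\<dots> = phe_class T ?g'"
      using MapGrp_mult[OF haus p(1) proper_cmap_id] by (simp add: 1)
    finally show "y = c (inv\<^bsub>W\<^esub> g)" by (simp add: c_def)
  qed
  have "subgroup (c ` carrier W) (PMapGrp T)"
  proof
    show "c ` carrier W \<subseteq> carrier (PMapGrp T)" using c_in by auto
    show "\<one>\<^bsub>PMapGrp T\<^esub> \<in> c ` carrier W"
      using c_one by (metis PMapGrp_simps(1) W.one_closed imageI)
    fix x y assume "x \<in> c ` carrier W" "y \<in> c ` carrier W"
    then obtain g h where g: "g \<in> carrier W" "x = c g" and h: "h \<in> carrier W" "y = c h" by auto
    show "x \<otimes>\<^bsub>PMapGrp T\<^esub> y \<in> c ` carrier W"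
      using g h c_mult by (auto simp: PMapGrp_simps(2))
    show "inv\<^bsub>PMapGrp T\<^esub> x \<in> c ` carrier W"
      using inv g by auto
  qed
  moreover have "(PMapGrp T)\<lparr>carrier := c ` carrier W\<rparr> \<cong> W"
  proof (rule is_isoI)
    let ?i = "inv_into (carrier W) c"
    show "?i \<in> iso ((PMapGrp T)\<lparr>carrier := c ` carrier W\<rparr>) W"
      unfolding iso_def hom_def mem_Collect_eq
    proof (intro conjI ballI funcsetI)
      show "bij_betw ?i (carrier ((PMapGrp T)\<lparr>carrier := c ` carrier W\<rparr>)) (carrier W)"
        using bij_betw_inv_into[OF inj_on_imp_bij_betw[OF inj]] by simp
      fix x assume "x \<in> carrier ((PMapGrp T)\<lparr>carrier := c ` carrier W\<rparr>)"
      then obtain g where g: "g \<in> carrier W" "x = c g" by auto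
      then show "?i x \<in> carrier W" using inj by simp
      fix y assume "y \<in> carrier ((PMapGrp T)\<lparr>carrier := c ` carrier W\<rparr>)"
      then obtain h where h: "h \<in> carrier W" "y = c h" by auto
      show "?i (x \<otimes>\<^bsub>(PMapGrp T)\<lparr>carrier := c ` carrier W\<rparr>\<^esub> y) = ?i x \<otimes>\<^bsub>W\<^esub> ?i y"
        using g h inj c_mult by (simp add: PMapGrp_simps(2) inv_into_f_f)
    qed
  qed
  ultimately show ?thesis by blast
qed

section \<open>Proper maps of locally finite graphs defined by edge paths\<close>

locale lf_graph = graph V Ed src tgt
  for V :: "'v set" and Ed :: "'e set" and src tgt :: "'e \<Rightarrow> 'v" +
  assumes lf: "locally_finite_graph V Ed src tgt"
begin

definition endpoints :: "'e set \<Rightarrow> 'v set" where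
  "endpoints E = src ` E \<union> tgt ` E"

lemma endpoints_subset: "E \<subseteq> Ed \<Longrightarrow> endpoints E \<subseteq> V"
  by (auto simp: endpoints_def)

lemma finite_endpoints: "finite E \<Longrightarrow> finite (endpoints E)"
  by (simp add: endpoints_def)

lemma finite_incident: "v \<in> V \<Longrightarrow> finite {e \<in> Ed. src e = v \<or> tgt e = v}"
  using lf by (simp add: locally_finite_graph_def)

lemma finite_endpoints_preimage:
  assumes "\<And>e. e \<in> Ed \<Longrightarrow> E e \<subseteq> Ed" "\<And>d. finite {e \<in> Ed. d \<in> E e}" "v \<in> V"
  shows "finite {e \<in> Ed. v \<in> endpoints (E e)}"
proof (rule finite_subset)
  show "{e \<in> Ed. v \<in> endpoints (E e)} \<subseteq> (\<Union>d\<in>{d \<in> Ed. src d = v \<or> tgt d = v}. {e \<in> Ed. d \<in> E e})"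
    using assms(1) by (fastforce simp: endpoints_def)
  show "finite (\<Union>d\<in>{d \<in> Ed. src d = v \<or> tgt d = v}. {e \<in> Ed. d \<in> E e})"
    using finite_incident[OF assms(3)] assms(2) by auto
qed

text \<open>The homotopy over \<open>e\<close> stays in the subgraph spanned by \<open>E e\<close>,
  and a compact set meets finitely many of these, so its preimage lies over finitely many edges. The
  edge \<open>e\<close> is inserted for its endpoints, since \<open>E e\<close> may be
  empty.\<close>

lemma proper_homotopicI:
  assumes f: "\<And>v. v \<in> V \<Longrightarrow> f (Inl v) = Inl v" and g: "\<And>v. v \<in> V \<Longrightarrow> g (Inl v) = Inl v"
    and E: "\<And>e. e \<in> Ed \<Longrightarrow> E e \<subseteq> Ed" "\<And>d. finite {e \<in> Ed. d \<in> E e}"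
    and h: "\<And>e. e \<in> Ed \<Longrightarrow> phtpy (graph_top (endpoints (insert e (E e))) (E e) src tgt) (Inl (src e)) (Inl (tgt e))
       (\<lambda>t. f (gp e t)) (\<lambda>t. g (gp e t))"
  shows "proper_homotopic G f g"
proof -
  define VV where "VV e = endpoints (insert e (E e))" for e
  have VV: "VV e \<subseteq> V" if "e \<in> Ed" for e using E(1)[OF that] that endpoints_subset by (simp add: VV_def)
  have finV: "finite {e \<in> Ed. v \<in> VV e}" if "v \<in> V" for v
    unfolding VV_def
  proof (rule finite_endpoints_preimage[OF _ _ that])
    show "finite {e \<in> Ed. d \<in> insert e (E e)}" for d
      by (rule finite_subset[of _ "insert d {e \<in> Ed. d \<in> E e}"]) (use E(2)[of d] in auto)
  qed (use E(1) in auto)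
  have sub: "graph (VV e) (E e) src tgt" for e
    by unfold_locales (auto simp: is_graph_def VV_def endpoints_def)
  have "\<exists>k. continuous_map (top_of_set ({0..1::real} \<times> {0..1::real})) (graph_top (VV e) (E e) src tgt) k \<and>
      (\<forall>t. k (0, t) = f (gp e t)) \<and> (\<forall>t. k (1, t) = g (gp e t)) \<and>
      (\<forall>s\<in>{0..1}. k (s, 0) = Inl (src e) \<and> k (s, 1) = Inl (tgt e))" if "e \<in> Ed" for e
    using phtpyE[OF h[OF that], folded VV_def] by metis
  then obtain k where k: "\<And>e. e \<in> Ed \<Longrightarrow> continuous_map (top_of_set ({0..1::real} \<times> {0..1::real})) (graph_top (VV e) (E e) src tgt) (k e)"
     "\<And>e t. e \<in> Ed \<Longrightarrow> k e (0, t) = f (gp e t)" "\<And>e t. e \<in> Ed \<Longrightarrow> k e (1, t) = g (gp e t)"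
     "\<And>e s. e \<in> Ed \<Longrightarrow> s \<in> {0..1} \<Longrightarrow> k e (s, 0) = Inl (src e) \<and> k e (s, 1) = Inl (tgt e)"
    by metis
  \<comment> \<open>\<open>proper_homotopic\<close> prescribes both ends of the homotopy at all
    values of the type, so \<open>H\<close> also has to match \<open>f\<close> and \<open>g\<close>
    outside the graph.\<close>
  define H where "H z = (if snd z \<in> gcarrier V Ed then (case snd z of Inl v \<Rightarrow> Inl v | Inr (e, t) \<Rightarrow> k e (fst z, t))
     else if fst z = 0 then f (snd z) else g (snd z))" for z
  have Hgp: "H (s, gp e t) = k e (s, t)" if "e \<in> Ed" "s \<in> {0..1}" "t \<in> {0..1}" for e s t
    using gpt_in[OF that(1,3)] k(4)[OF that(1,2)] by (auto simp: H_def gpt_def)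
  have HInl: "H (s, Inl v) = Inl v" if "v \<in> V" for s v using that by (simp add: H_def)
  have kin: "k e (s, t) \<in> gcarrier (VV e) (E e)" if "e \<in> Ed" "s \<in> {0..1}" "t \<in> {0..1}" for e s t
    using Pi_mem[OF continuous_map_funspace[OF k(1)[OF that(1)]], of "(s, t)"] that graph.topspace_graph[OF sub] by auto
  have cont: "continuous_map (cyl G) G H"
  proof (rule continuous_map_prod_graphI)
    fix e assume e: "e \<in> Ed"
    have "continuous_map (top_of_set ({0..1::real} \<times> {0..1::real})) G (id \<circ> k e)"
      using continuous_map_compose[OF k(1)[OF e] continuous_map_inclusion[OF VV[OF e] E(1)[OF e]]]
        graph.is_graph[OF sub] by simp
    then show "continuous_map (top_of_set ({0..1} \<times> {0..1})) G (\<lambda>z. H (fst z, gp e (snd z)))"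
      by (rule continuous_map_eq) (use Hgp[OF e] in auto)
  qed (simp add: HInl pathin_def)
  have "proper_cmap (cyl G) G H"
    unfolding proper_cmap_def
  proof (intro conjI allI impI cont)
    fix K assume K: "compactin G K"
    obtain V0 E0 where VE: "finite V0" "finite E0" "V0 \<subseteq> V" "E0 \<subseteq> Ed" "K \<subseteq> gcarrier V0 E0"
      using compactin_imp_finite_subgraph[OF K lf] by metis
    let ?J = "(\<Union>v\<in>V0. {e \<in> Ed. v \<in> VV e}) \<union> (\<Union>d\<in>E0. {e \<in> Ed. d \<in> E e})"
    let ?L = "Inl ` V0 \<union> (\<Union>e\<in>?J. gp e ` {0..1})"
    have "finite ?J" using VE finV E(2) by auto
    then have "compactin G ?L" using VE by (intro compactin_finite_subgraph) auto
    then have "compactin (cyl G) ({0..1} \<times> ?L)" by (simp add: compactin_Times)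
    then show "compactin (cyl G) {z \<in> topspace (cyl G). H z \<in> K}"
    proof (rule closed_compactin)
      show "closedin (cyl G) {z \<in> topspace (cyl G). H z \<in> K}"
        by (intro closedin_continuous_map_preimage[OF cont] compactin_imp_closedin Hausdorff_graph K)
      show "{z \<in> topspace (cyl G). H z \<in> K} \<subseteq> {0..1} \<times> ?L"
      proof
        fix z assume "z \<in> {z \<in> topspace (cyl G). H z \<in> K}"
        then obtain s x where z: "z = (s, x)" "s \<in> {0..1}" "x \<in> gcarrier V Ed" "H (s, x) \<in> gcarrier V0 E0"
          using VE(5) by auto
        from z(3) have "x \<in> ?L"
        proof (cases rule: gcarrier_cases)
          case (1 v)
          then show ?thesis using z(4) HInl by (auto simp: gcarrier_def)
        next
          case (2 e t)
          have "k e (s, t) \<in> gcarrier (VV e) (E e)" "k e (s, t) \<in> gcarrier V0 E0"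
            using kin[OF 2(1) z(2), of t] Hgp[OF 2(1) z(2), of t] 2 z(4) by auto
          then have "e \<in> ?J" using 2(1) by (auto simp: gcarrier_def)
          moreover have "x \<in> gp e ` {0..1}" by (rule image_eqI[where f = "gp e" and x = t, OF 2(5)]) (use 2 in simp)
          ultimately show ?thesis by blast
        qed
        then show "z \<in> {0..1} \<times> ?L" using z by simp
      qed
    qed
  qed
  moreover have "H (0, x) = f x" "H (1, x) = g x" for x
  proof -
    have "H (0, x) = f x \<and> H (1, x) = g x"
    proof (cases "x \<in> gcarrier V Ed")
      case True
      then show ?thesis
      proof (cases rule: gcarrier_cases)
        case (2 e t)
        then show ?thesis using Hgp[of e 0 t] Hgp[of e 1 t] k(2,3)[of e t] by simp
      qed (use f g HInl in auto)
    qed (simp add: H_def)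
    then show "H (0, x) = f x" "H (1, x) = g x" by auto
  qed
  ultimately show ?thesis unfolding proper_homotopic_def by blast
qed

section \<open>Edge maps of proper assignments\<close>

definition proper_assignment :: "('e \<Rightarrow> ('e \<times> bool) list) \<Rightarrow> bool" where
  "proper_assignment P \<longleftrightarrow> (\<forall>e\<in>Ed. wp (src e) (P e) (tgt e)) \<and> (\<forall>d. finite {e \<in> Ed. d \<in> fst ` set (P e)})"

lemma proper_assignmentD:
  assumes "proper_assignment P"
  shows "e \<in> Ed \<Longrightarrow> wp (src e) (P e) (tgt e)" "finite {e \<in> Ed. d \<in> fst ` set (P e)}"
    "e \<in> Ed \<Longrightarrow> fst ` set (P e) \<subseteq> Ed"
proof -
  show 1: "wp (src e) (P e) (tgt e)" if "e \<in> Ed" for e using assms that by (simp add: proper_assignment_def)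
  show "finite {e \<in> Ed. d \<in> fst ` set (P e)}" using assms by (simp add: proper_assignment_def)
  show "fst ` set (P e) \<subseteq> Ed" if "e \<in> Ed" using wpath_letters[OF 1[OF that]] .
qed

lemma proper_assignment_sub:
  assumes P: "proper_assignment P" and Q: "proper_assignment Q"
  shows "proper_assignment (\<lambda>e. sub P (Q e))"
  unfolding proper_assignment_def
proof (intro conjI ballI allI)
  fix e assume e: "e \<in> Ed"
  show "wp (src e) (sub P (Q e)) (tgt e)"
    by (rule wpath_sub[OF proper_assignmentD(1)[OF Q e]])
       (use proper_assignmentD(1)[OF P] proper_assignmentD(3)[OF Q e] in blast)
next
  fix d
  have "{e \<in> Ed. d \<in> fst ` set (sub P (Q e))} \<subseteq> (\<Union>c\<in>{c \<in> Ed. d \<in> fst ` set (P c)}. {e \<in> Ed. c \<in> fst ` set (Q e)})"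
    using proper_assignmentD(3)[OF Q] by (auto simp: letters_sub)
  moreover have "finite (\<Union>c\<in>{c \<in> Ed. d \<in> fst ` set (P c)}. {e \<in> Ed. c \<in> fst ` set (Q e)})"
    using proper_assignmentD(2)[OF P] proper_assignmentD(2)[OF Q] by auto
  ultimately show "finite {e \<in> Ed. d \<in> fst ` set (sub P (Q e))}" by (rule finite_subset)
qed

lemma graph_span: "graph (endpoints (insert e E)) E src tgt"
  by unfold_locales (auto simp: is_graph_def endpoints_def)

abbreviation "em \<equiv> edge_map src tgt"

text \<open>Free reduction only deletes letters, so the homotopy over \<open>e\<close> stays within
  the letters of \<open>P e\<close> and \<open>Q e\<close>.\<close>

lemma edge_map_feq:
  assumes P: "proper_assignment P" and Q: "proper_assignment Q" and feq: "\<And>e. e \<in> Ed \<Longrightarrow> feq (P e) (Q e)"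
  shows "proper_homotopic G (em P) (em Q)"
proof (rule proper_homotopicI[where E = "\<lambda>e. fst ` set (P e) \<union> fst ` set (Q e)"])
  fix d
  have "{e \<in> Ed. d \<in> fst ` set (P e) \<union> fst ` set (Q e)} = {e \<in> Ed. d \<in> fst ` set (P e)} \<union> {e \<in> Ed. d \<in> fst ` set (Q e)}"
    by auto
  then show "finite {e \<in> Ed. d \<in> fst ` set (P e) \<union> fst ` set (Q e)}"
    using proper_assignmentD(2)[OF P, of d] proper_assignmentD(2)[OF Q, of d] by simp
next
  fix e assume e: "e \<in> Ed"
  let ?E = "fst ` set (P e) \<union> fst ` set (Q e)"
  note wP = proper_assignmentD(1)[OF P e] and wQ = proper_assignmentD(1)[OF Q e]
  have "phtpy (graph_top (endpoints (insert e ?E)) ?E src tgt) (Inl (src e)) (Inl (tgt e)) (ep (src e) (P e)) (ep (src e) (Q e))"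
    by (rule graph.phtpy_epath_feq[OF graph_span wpath_mono[OF wP] wpath_mono[OF wQ] _ feq[OF e]])
       (auto simp: endpoints_def)
  then show "phtpy (graph_top (endpoints (insert e ?E)) ?E src tgt) (Inl (src e)) (Inl (tgt e))
    (\<lambda>t. em P (gp e t)) (\<lambda>t. em Q (gp e t))"
    by (rule phtpy_cong) (simp_all add: edge_map_gpt[where P = P and e = e, OF wP] edge_map_gpt[where P = Q and e = e, OF wQ])
qed (use proper_assignmentD(3)[OF P] proper_assignmentD(3)[OF Q] in auto)

text \<open>The letters of \<open>Q e\<close> are included so that the endpoints of the intermediate
  path are vertices of the subgraph that confines the homotopy.\<close>

lemma edge_map_comp:
  assumes P: "proper_assignment P" and Q: "proper_assignment Q"
  shows "proper_homotopic G (em P \<circ> em Q) (em (\<lambda>e. sub P (Q e)))"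
proof (rule proper_homotopicI[where E = "\<lambda>e. fst ` set (Q e) \<union> fst ` set (sub P (Q e))"])
  note PQ = proper_assignment_sub[OF P Q]
  fix d
  have "{e \<in> Ed. d \<in> fst ` set (Q e) \<union> fst ` set (sub P (Q e))} = {e \<in> Ed. d \<in> fst ` set (Q e)} \<union> {e \<in> Ed. d \<in> fst ` set (sub P (Q e))}"
    by auto
  then show "finite {e \<in> Ed. d \<in> fst ` set (Q e) \<union> fst ` set (sub P (Q e))}"
    using proper_assignmentD(2)[OF Q, of d] proper_assignmentD(2)[OF PQ, of d] by simp
next
  fix e assume e: "e \<in> Ed"
  let ?E = "fst ` set (Q e) \<union> fst ` set (sub P (Q e))"
  note wQ = proper_assignmentD(1)[OF Q e] and wPQ = proper_assignmentD(1)[OF proper_assignment_sub[OF P Q] e]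
  have "phtpy (graph_top (endpoints (insert e ?E)) ?E src tgt) (Inl (src e)) (Inl (tgt e))
     (em P \<circ> ep (src e) (Q e)) (ep (src e) (sub P (Q e)))"
  proof (rule graph.phtpy_edge_map_epath[OF graph_span wpath_mono[OF wQ order_refl]])
    fix d assume d: "d \<in> fst ` set (Q e)"
    then have "d \<in> Ed" using proper_assignmentD(3)[OF Q e] by blast
    then show "wpath ?E src tgt (src d) (P d) (tgt d)"
      using d by (intro wpath_mono[OF proper_assignmentD(1)[OF P]]) (auto simp: letters_sub)
  qed (auto simp: endpoints_def)
  then show "phtpy (graph_top (endpoints (insert e ?E)) ?E src tgt) (Inl (src e)) (Inl (tgt e))
    (\<lambda>t. (em P \<circ> em Q) (gp e t)) (\<lambda>t. em (\<lambda>e. sub P (Q e)) (gp e t))"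
    by (rule phtpy_cong) (simp_all add: edge_map_gpt[where P = Q and e = e, OF wQ] edge_map_gpt[where P = "\<lambda>e. sub P (Q e)" and e = e, OF wPQ])
qed (use proper_assignmentD(3)[OF Q] proper_assignmentD(3)[OF proper_assignment_sub[OF P Q]] in auto)

lemma edge_map_id:
  assumes P: "\<And>e. e \<in> Ed \<Longrightarrow> P e = [(e, False)]"
  shows "proper_homotopic G (em P) id"
proof (rule proper_homotopicI[where E = "\<lambda>e. {e}"])
  fix d :: 'e
  have "{e \<in> Ed. d \<in> {e}} \<subseteq> {d}" by auto
  then show "finite {e \<in> Ed. d \<in> {e}}" by (rule finite_subset) simp
next
  fix e assume e: "e \<in> Ed"
  have w: "wp (src e) (P e) (tgt e)" using P e by simp
  have "phtpy (graph_top (endpoints (insert e {e})) {e} src tgt) (Inl (src e)) (Inl (tgt e)) (ep (src e) [(e, False)]) (gp e)"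
    using graph.phtpy_epath_single[OF graph_span, of "(e, False)" "{e}" e] by (simp add: lpath_def)
  then show "phtpy (graph_top (endpoints (insert e {e})) {e} src tgt) (Inl (src e)) (Inl (tgt e))
     (\<lambda>t. em P (gp e t)) (\<lambda>t. id (gp e t))"
    by (rule phtpy_cong) (simp_all add: edge_map_gpt[where P = P and e = e, OF w] P e)
qed auto

text \<open>Properness is read off as an end of a proper homotopy from \<open>em P\<close> to
  itself.\<close>

lemma proper_edge_map: "proper_assignment P \<Longrightarrow> proper_cmap G G (em P)"
  by (rule proper_homotopic_imp_proper(1)[OF edge_map_feq[OF _ _ feq_refl]])

subsection \<open>Maps fixing the vertices fix the ends\<close>

text \<open>A complementary component could be an open arc inside an edge, without vertices. Adding
  all edges with both ends in \<open>V1\<close> excludes this: from any remaining edge point a part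
  of its edge leads to a vertex outside \<open>L\<close>.\<close>

lemma compact_saturation:
  assumes K: "compactin G K"
  obtains L where "compactin G L" "K \<subseteq> L" "\<And>C. C \<in> compl_components G L \<Longrightarrow> \<exists>v\<in>V. Inl v \<in> C"
proof -
  obtain V0 E0 where VE: "finite V0" "finite E0" "V0 \<subseteq> V" "E0 \<subseteq> Ed" "K \<subseteq> gcarrier V0 E0"
    using compactin_imp_finite_subgraph[OF K lf] by metis
  define V1 where "V1 = V0 \<union> endpoints E0"
  have V1: "finite V1" "V1 \<subseteq> V" using VE finite_endpoints endpoints_subset by (auto simp: V1_def)
  define E1 where "E1 = E0 \<union> {e \<in> Ed. src e \<in> V1 \<and> tgt e \<in> V1}"
  have "{e \<in> Ed. src e \<in> V1 \<and> tgt e \<in> V1} \<subseteq> (\<Union>v\<in>V1. {e \<in> Ed. src e = v \<or> tgt e = v})" by auto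
  moreover have "finite (\<Union>v\<in>V1. {e \<in> Ed. src e = v \<or> tgt e = v})" using V1 finite_incident by auto
  ultimately have E1: "finite E1" "E1 \<subseteq> Ed" using VE finite_subset by (auto simp: E1_def)
  let ?L = "Inl ` V1 \<union> (\<Union>e\<in>E1. gp e ` {0..1})"
  have ends: "src e \<in> V1" "tgt e \<in> V1" if "e \<in> E1" for e
    using that by (auto simp: E1_def V1_def endpoints_def)
  have Lv: "Inl v \<in> ?L \<longleftrightarrow> v \<in> V1" for v using ends by (auto simp: gpt_def split: if_splits)
  have Le: "Inr (e, t) \<in> ?L \<Longrightarrow> e \<in> E1" for e t by (auto simp: gpt_def split: if_splits)
  show thesis
  proof (rule that[of ?L])
    show "compactin G ?L" using V1 E1 by (intro compactin_finite_subgraph)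
    show "K \<subseteq> ?L"
    proof
      fix x assume "x \<in> K"
      then have "x \<in> gcarrier V0 E0" using VE by blast
      then show "x \<in> ?L"
        by (auto simp: gcarrier_def V1_def E1_def image_iff gpt_def intro: bexI)
    qed
    fix C assume C: "C \<in> compl_components G ?L"
    let ?X = "subtopology G (topspace G - ?L)"
    have C': "C \<in> connected_components_of ?X" using C by (simp add: compl_components_def)
    obtain x where x: "x \<in> C" using nonempty_connected_components_of[OF C'] by blast
    then have "x \<in> topspace ?X" using connected_components_of_subset[OF C'] by blast
    then have xG: "x \<in> gcarrier V Ed" and xL: "x \<notin> ?L"
      unfolding topspace_subtopology topspace_graph by blast+
    from xG show "\<exists>v\<in>V. Inl v \<in> C"
    proof (cases rule: gcarrier_cases)
      case (1 v)
      then show ?thesis using x by blast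
    next
      case (2 e t)
      have x_img: "x \<in> gp e ` {0..1}" by (rule image_eqI[where f = "gp e" and x = t, OF 2(5)]) (use 2 in simp)
      have "e \<notin> E1"
      proof
        assume "e \<in> E1"
        with x_img xL show False by blast
      qed
      have dis: "gp e ` S \<inter> L' = {}" if "\<And>r. r \<in> S \<Longrightarrow> gp e r \<notin> L'" for S L'
        using that by blast
      have "src e \<notin> V1 \<or> tgt e \<notin> V1" using \<open>e \<notin> E1\<close> 2(1) by (auto simp: E1_def)
      then obtain a b v where ab: "{a..b} \<subseteq> {0..1}" "t \<in> {a..b}" "v \<in> V" "Inl v \<in> gp e ` {a..b}" "gp e ` {a..b} \<inter> ?L = {}"
      proof
        assume s: "src e \<notin> V1"
        have "gp e r \<notin> ?L" if "r \<in> {0..t}" for r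
          using Lv[of "src e"] Le[of e r] s \<open>e \<notin> E1\<close> 2 that gpt_def[of src tgt e r] by auto
        then have d: "gp e ` {0..t} \<inter> ?L = {}" by (rule dis)
        have i: "Inl (src e) \<in> gp e ` {0..t}" using 2 by (intro image_eqI[of _ _ 0]) auto
        show thesis by (rule that[OF _ _ _ i d]) (use 2 in auto)
      next
        assume s: "tgt e \<notin> V1"
        have "gp e r \<notin> ?L" if "r \<in> {t..1}" for r
          using Lv[of "tgt e"] Le[of e r] s \<open>e \<notin> E1\<close> 2 that gpt_def[of src tgt e r] by auto
        then have d: "gp e ` {t..1} \<inter> ?L = {}" by (rule dis)
        have i: "Inl (tgt e) \<in> gp e ` {t..1}" using 2 by (intro image_eqI[of _ _ 1]) auto
        show thesis by (rule that[OF _ _ _ i d]) (use 2 in auto)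
      qed
      have "connectedin (top_of_set {0..1}) {a..b}"
        using ab(1) by (simp add: connectedin_subtopology)
      then have "connectedin G (gp e ` {a..b})"
        using connectedin_continuous_map_image[OF pathin_gpt[OF 2(1), unfolded pathin_def]] by blast
      then have "connectedin ?X (gp e ` {a..b})"
        using ab(5) connectedin_subset_topspace[of G "gp e ` {a..b}"] by (auto simp: connectedin_subtopology)
      moreover have "x \<in> gp e ` {a..b}" by (rule image_eqI[where f = "gp e" and x = t, OF 2(5) ab(2)])
      then have "\<not> disjnt C (gp e ` {a..b})" using x by (auto simp: disjnt_def)
      ultimately have "gp e ` {a..b} \<subseteq> C" by (rule connected_components_of_maximal[OF C'])
      then show ?thesis using ab(3,4) by blast
    qed
  qed
qed

text \<open>Away from the projected preimage of \<open>K\<close>, the track of a connected set under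
  the homotopy avoids \<open>K\<close> and so stays in one component; a vertex fixed by
  \<open>f\<close> shows which one.\<close>

lemma end_act_fixed:
  assumes f: "\<And>v. v \<in> V \<Longrightarrow> f (Inl v) = Inl v" and fg: "proper_homotopic G f g" and \<epsilon>: "\<epsilon> \<in> Ends G"
  shows "end_act G g \<epsilon> = \<epsilon>"
proof
  fix K
  have \<epsilon>_comp: "\<epsilon> L \<in> compl_components G L" if "compactin G L" for L using \<epsilon> that by (auto simp: Ends_def)
  have \<epsilon>_mono: "\<epsilon> L' \<subseteq> \<epsilon> L" if "compactin G L" "compactin G L'" "L \<subseteq> L'" for L L' using \<epsilon> that by (auto simp: Ends_def)
  have \<epsilon>_ne: "\<epsilon> L \<noteq> {}" if "compactin G L" for L
    using nonempty_connected_components_of \<epsilon>_comp[OF that] unfolding compl_components_def by blast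
  show "end_act G g \<epsilon> K = \<epsilon> K"
  proof (cases "compactin G K")
    case K: True
    obtain H where H: "proper_cmap (cyl G) G H" "\<And>x. H (0, x) = f x" "\<And>x. H (1, x) = g x"
      using proper_homotopicE[OF fg] by metis
    have "compactin G (snd ` {z \<in> topspace (cyl G). H z \<in> K})" (is "compactin G ?M")
      by (intro image_compactin[OF proper_cmapD(2)[OF H(1) K] continuous_map_snd])
    then have KM: "compactin G (K \<union> ?M)" using K by (intro compactin_Un)
    obtain L where L: "compactin G L" "K \<union> ?M \<subseteq> L" "\<And>C. C \<in> compl_components G L \<Longrightarrow> \<exists>v\<in>V. Inl v \<in> C"
      by (rule compact_saturation[OF KM]) (rule that)
    have L_comp: "\<epsilon> L \<in> connected_components_of (subtopology G (topspace G - L))"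
      using \<epsilon>_comp[OF L(1)] by (simp add: compl_components_def)
    have K_comp: "\<epsilon> K \<in> connected_components_of (subtopology G (topspace G - K))"
      using \<epsilon>_comp[OF K] by (simp add: compl_components_def)
    have eL: "\<epsilon> L \<subseteq> topspace G - L" using connected_components_of_subset[OF L_comp] by auto
    obtain v where v: "v \<in> V" "Inl v \<in> \<epsilon> L" using L(3)[OF \<epsilon>_comp[OF L(1)]] by blast
    have "connectedin G (\<epsilon> L)"
      using connectedin_connected_components_of[OF L_comp] by (simp add: connectedin_subtopology)
    then have "connectedin (cyl G) ({0..1} \<times> \<epsilon> L)" by (simp add: connectedin_Times connectedin_subtopology)
    then have "connectedin G (H ` ({0..1} \<times> \<epsilon> L))"
      by (rule connectedin_continuous_map_image[OF proper_cmapD(1)[OF H(1)]])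
    moreover have "H ` ({0..1} \<times> \<epsilon> L) \<inter> K = {}"
    proof -
      have "x \<in> ?M" if "s \<in> {0..1}" "x \<in> \<epsilon> L" "H (s, x) \<in> K" for s x
        using that eL by (intro image_eqI[of _ _ "(s, x)"]) auto
      then show ?thesis using eL L(2) by blast
    qed
    ultimately have "connectedin (subtopology G (topspace G - K)) (H ` ({0..1} \<times> \<epsilon> L))"
      using connectedin_subset_topspace by (fastforce simp: connectedin_subtopology)
    moreover have "Inl v \<in> H ` ({0..1} \<times> \<epsilon> L)"
      using v H(2)[of "Inl v"] f[OF v(1)] by (intro image_eqI[of _ _ "(0, Inl v)"]) auto
    moreover have "Inl v \<in> \<epsilon> K" using v(2) \<epsilon>_mono[OF K L(1)] L(2) by blast
    ultimately have "H ` ({0..1} \<times> \<epsilon> L) \<subseteq> \<epsilon> K"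
      by (intro connected_components_of_maximal[OF K_comp]) (auto simp: disjnt_def)
    moreover have "g ` \<epsilon> L \<subseteq> H ` ({0..1} \<times> \<epsilon> L)"
    proof
      fix y assume "y \<in> g ` \<epsilon> L"
      then obtain x where "x \<in> \<epsilon> L" "y = H (1, x)" using H(3) by auto
      then show "y \<in> H ` ({0..1} \<times> \<epsilon> L)" by (intro image_eqI[of _ _ "(1, x)"]) auto
    qed
    ultimately have g: "g ` \<epsilon> L \<subseteq> \<epsilon> K" by blast
    have "(THE C. C \<in> compl_components G K \<and> (\<exists>L. compactin G L \<and> g ` \<epsilon> L \<subseteq> C)) = \<epsilon> K"
    proof (rule the_equality)
      show "\<epsilon> K \<in> compl_components G K \<and> (\<exists>L. compactin G L \<and> g ` \<epsilon> L \<subseteq> \<epsilon> K)"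
        using \<epsilon>_comp[OF K] L(1) g by blast
      fix C assume C: "C \<in> compl_components G K \<and> (\<exists>L. compactin G L \<and> g ` \<epsilon> L \<subseteq> C)"
      then obtain L' where L': "compactin G L'" "g ` \<epsilon> L' \<subseteq> C" by blast
      \<comment> \<open>Any two candidate components share the image of a point of
        \<open>\<epsilon> (L \<union> L')\<close>.\<close>
      have u: "compactin G (L \<union> L')" using L(1) L'(1) by (rule compactin_Un)
      obtain x where "x \<in> \<epsilon> (L \<union> L')" using \<epsilon>_ne[OF u] by blast
      then have "x \<in> \<epsilon> L" "x \<in> \<epsilon> L'" using \<epsilon>_mono[OF L(1) u] \<epsilon>_mono[OF L'(1) u] by auto
      then have "g x \<in> C" "g x \<in> \<epsilon> K" using g L'(2) by auto
      then have "\<not> disjnt C (\<epsilon> K)" by (auto simp: disjnt_def)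
      moreover have "C \<in> connected_components_of (subtopology G (topspace G - K))"
        using C by (simp add: compl_components_def)
      ultimately show "C = \<epsilon> K" using connected_components_of_disjoint[OF _ K_comp] by blast
    qed
    then show ?thesis using K by (simp add: end_act_def)
  next
    case False
    then show ?thesis using \<epsilon> by (simp add: end_act_def Ends_def)
  qed
qed

end

section \<open>Wreath products in the pure mapping class group\<close>

lemma group_wreathZ:
  assumes "group A" shows "group (wreathZ A)"
proof -
  interpret A: group A by fact
  have car: "p \<in> carrier (wreathZ A) \<longleftrightarrow> (\<forall>i. fst p i \<in> carrier A) \<and> finite {i. fst p i \<noteq> \<one>\<^bsub>A\<^esub>}" for p
    by (cases p) (auto simp: wreathZ_def)
  have mult: "p \<otimes>\<^bsub>wreathZ A\<^esub> q = (\<lambda>i. fst p i \<otimes>\<^bsub>A\<^esub> fst q (i - snd p), snd p + snd q)" for p q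
    by (cases p; cases q) (simp add: wreathZ_def)
  have one: "\<one>\<^bsub>wreathZ A\<^esub> = (\<lambda>_. \<one>\<^bsub>A\<^esub>, 0)" by (simp add: wreathZ_def)
  have fin: "finite {i. f (i + k) \<noteq> \<one>\<^bsub>A\<^esub>}" if "finite {i. f i \<noteq> \<one>\<^bsub>A\<^esub>}" for f and k :: int
    using finite_vimageI[OF that, of "\<lambda>i. i + k"] by (simp add: vimage_def inj_def)
  show ?thesis
  proof (rule groupI)
    fix p q r
    assume p: "p \<in> carrier (wreathZ A)" and q: "q \<in> carrier (wreathZ A)" and r: "r \<in> carrier (wreathZ A)"
    have "{i. fst p i \<otimes>\<^bsub>A\<^esub> fst q (i - snd p) \<noteq> \<one>\<^bsub>A\<^esub>} \<subseteq> {i. fst p i \<noteq> \<one>\<^bsub>A\<^esub>} \<union> {i. fst q (i + (- snd p)) \<noteq> \<one>\<^bsub>A\<^esub>}"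
      by auto
    moreover have "finite ({i. fst p i \<noteq> \<one>\<^bsub>A\<^esub>} \<union> {i. fst q (i + (- snd p)) \<noteq> \<one>\<^bsub>A\<^esub>})"
      using p q fin[of "fst q" "- snd p"] by (simp add: car)
    ultimately have "finite {i. fst p i \<otimes>\<^bsub>A\<^esub> fst q (i - snd p) \<noteq> \<one>\<^bsub>A\<^esub>}" by (rule finite_subset)
    then show "p \<otimes>\<^bsub>wreathZ A\<^esub> q \<in> carrier (wreathZ A)"
      using p q by (simp add: car mult)
    show "p \<otimes>\<^bsub>wreathZ A\<^esub> q \<otimes>\<^bsub>wreathZ A\<^esub> r = p \<otimes>\<^bsub>wreathZ A\<^esub> (q \<otimes>\<^bsub>wreathZ A\<^esub> r)"
      using p q r by (simp add: car mult A.m_assoc algebra_simps)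
    show "\<one>\<^bsub>wreathZ A\<^esub> \<otimes>\<^bsub>wreathZ A\<^esub> p = p" using p by (simp add: car mult one)
    show "\<exists>y\<in>carrier (wreathZ A). y \<otimes>\<^bsub>wreathZ A\<^esub> p = \<one>\<^bsub>wreathZ A\<^esub>"
    proof (intro bexI)
      let ?y = "(\<lambda>i. inv\<^bsub>A\<^esub> fst p (i + snd p), - snd p)"
      show "?y \<otimes>\<^bsub>wreathZ A\<^esub> p = \<one>\<^bsub>wreathZ A\<^esub>" using p by (simp add: car mult one)
      have "{i. inv\<^bsub>A\<^esub> fst p (i + snd p) \<noteq> \<one>\<^bsub>A\<^esub>} \<subseteq> {i. fst p (i + snd p) \<noteq> \<one>\<^bsub>A\<^esub>}" by auto
      then show "?y \<in> carrier (wreathZ A)"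
        using p fin[of "fst p" "snd p"] finite_subset by (auto simp: car)
    qed
  qed (simp add: car one)
qed

theorem wreath_embeds:
  fixes V :: "'v set" and Ed :: "'e set" and src tgt :: "'e \<Rightarrow> 'v" and x0 :: 'v
    and A :: "('g, 'm) monoid_scheme"
  assumes gr: "is_graph V Ed src tgt" and lf: "locally_finite_graph V Ed src tgt"
    and con: "connected_space (graph_top V Ed src tgt)" and x0: "x0 \<in> V"
    and inf: "infinite_rank (fundamental_group (graph_top V Ed src tgt) (Inl x0))"
    and act: "letter_action A N sg"
  shows "\<exists>H. subgroup H (PMapGrp (graph_top V Ed src tgt)) \<and>
     (PMapGrp (graph_top V Ed src tgt)) \<lparr>carrier := H\<rparr> \<cong> wreathZ A"
proof -
  interpret lf_graph V Ed src tgt by unfold_locales (fact gr lf)+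
  interpret rooted_graph V Ed src tgt x0
    by unfold_locales (use x0 connected_wpath[OF con x0] in auto)
  interpret letter_action A N sg by fact
  obtain io :: "nat \<Rightarrow> int \<Rightarrow> 'e" where io:
    "\<And>i m j k. io i m = io j k \<longleftrightarrow> i = j \<and> m = k" "\<And>i m. io i m \<in> Ed - TE"
    "\<And>d. finite {(i, m). d \<in> fst ` set (tau (src (io i m)))} \<or> finite {(i, m). d \<notin> fst ` set (tau (src (io i m)))}"
    "\<And>d. finite {(i, m). d \<in> fst ` set (tau (tgt (io i m)))} \<or> finite {(i, m). d \<notin> fst ` set (tau (tgt (io i m)))}"
    by (rule ex_io[OF infinite_nontree[OF inf]]) (rule that)
  interpret wreath_data V Ed src tgt x0 A N sg io
    by unfold_locales (use io in auto)
  let ?W = "wreathZ A"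
  define F where "F p = em (pg (fst p) (snd p))" for p
  have car: "p \<in> carrier ?W \<longleftrightarrow> (\<forall>i. fst p i \<in> carrier A) \<and> finite {i. fst p i \<noteq> \<one>\<^bsub>A\<^esub>}" for p
    by (cases p) (auto simp: wreathZ_def)
  have mult: "p \<otimes>\<^bsub>?W\<^esub> q = (\<lambda>i. fst p i \<otimes>\<^bsub>A\<^esub> fst q (i - snd p), snd p + snd q)" for p q
    by (cases p; cases q) (simp add: wreathZ_def)
  have one: "\<one>\<^bsub>?W\<^esub> = (\<lambda>_. \<one>\<^bsub>A\<^esub>, 0)" by (simp add: wreathZ_def)
  have pa: "proper_assignment (pg (fst p) (snd p))" if "p \<in> carrier ?W" for p
    using that wpath_pg finite_pg unfolding proper_assignment_def car by blast
  have W: "group ?W" by (rule group_wreathZ) (rule A.is_group)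
  show ?thesis
  proof (rule embeds_in_PMapGrp[OF Hausdorff_graph W, of F])
    fix p assume p: "p \<in> carrier ?W"
    show "proper_cmap G G (F p)" unfolding F_def by (rule proper_edge_map[OF pa[OF p]])
    show "end_act G f \<epsilon> = \<epsilon>" if "proper_homotopic G (F p) f" "\<epsilon> \<in> Ends G" for f \<epsilon>
      by (rule end_act_fixed[OF _ that]) (simp add: F_def)
    fix q assume q: "q \<in> carrier ?W"
    have pq: "p \<otimes>\<^bsub>?W\<^esub> q \<in> carrier ?W" using W p q by (simp add: group.is_monoid monoid.m_closed)
    have "proper_homotopic G (F p \<circ> F q) (em (\<lambda>e. sub (pg (fst p) (snd p)) (pg (fst q) (snd q) e)))"
      unfolding F_def by (rule edge_map_comp[OF pa[OF p] pa[OF q]])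
    also have "proper_homotopic G \<dots> (F (p \<otimes>\<^bsub>?W\<^esub> q))"
      unfolding F_def
    proof (rule edge_map_feq[OF proper_assignment_sub[OF pa[OF p] pa[OF q]] pa[OF pq]])
      fix e assume "e \<in> Ed"
      then show "feq (sub (pg (fst p) (snd p)) (pg (fst q) (snd q) e)) (pg (fst (p \<otimes>\<^bsub>?W\<^esub> q)) (snd (p \<otimes>\<^bsub>?W\<^esub> q)) e)"
        unfolding mult fst_conv snd_conv by (intro pg_mult) (use p q in \<open>auto simp: car\<close>)
    qed
    finally (proper_homotopic_trans) show "proper_homotopic G (F p \<circ> F q) (F (p \<otimes>\<^bsub>?W\<^esub> q))" .
  next
    show "proper_homotopic G (F \<one>\<^bsub>?W\<^esub>) id"
      unfolding F_def one fst_conv snd_conv by (rule edge_map_id[OF pg_one])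
  next
    fix p assume p: "p \<in> carrier ?W" and h: "proper_homotopic G (F p) id"
    let ?P = "pg (fst p) (snd p)"
    obtain H where H: "proper_cmap (cyl G) G H" "\<And>x. H (0, x) = F p x" "\<And>x. H (1, x) = id x"
      using proper_homotopicE[OF h] by metis
    \<comment> \<open>The track of the basepoint is a loop, in general not constant; its word
      \<open>w\<close> will be the conjugator.\<close>
    define c where "c s = H (s, Inl x0)" for s
    have "continuous_map (top_of_set {0..1}) (cyl G) (\<lambda>s. (s, Inl x0))"
      using x0 by (intro continuous_map_pairedI) auto
    from continuous_map_compose[OF this proper_cmapD(1)[OF H(1)]]
    have c: "pathin G c" by (simp add: pathin_def c_def[abs_def] comp_def)
    have c01: "c 0 = Inl x0" "c 1 = Inl x0" using H(2,3) by (simp_all add: c_def F_def)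
    obtain w where w: "wp x0 w x0" "phtpy G (Inl x0) (Inl x0) c (ep x0 w)"
      using path_homotopic_epath[OF c c01] by metis
    have "fst p = (\<lambda>_. \<one>\<^bsub>A\<^esub>) \<and> snd p = 0"
    proof (rule inner_trivial[OF _ w(1)])
      show "fst p i \<in> carrier A" for i using p by (simp add: car)
      fix u assume u: "wp x0 u x0"
      let ?Q = "\<lambda>z. H (fst z, ep x0 u (snd z))"
      have "continuous_map (top_of_set ({0..1} \<times> {0..1})) (cyl G) (\<lambda>z::real\<times>real. (fst z, ep x0 u (snd z)))"
      proof (rule continuous_map_pairedI)
        show "continuous_map (top_of_set ({0..1} \<times> {0..1})) (top_of_set {0..1}) (fst :: real \<times> real \<Rightarrow> real)"
          by (auto intro!: continuous_intros)
        have "continuous_map (top_of_set ({0..1} \<times> {0..1})) (top_of_set {0..1}) (snd :: real \<times> real \<Rightarrow> real)"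
          by (auto intro!: continuous_intros)
        from continuous_map_compose[OF this pathin_epath[OF u x0, unfolded pathin_def]]
        show "continuous_map (top_of_set ({0..1::real} \<times> {0..1})) G (\<lambda>z. ep x0 u (snd z))" by (simp add: comp_def)
      qed
      from continuous_map_compose[OF this proper_cmapD(1)[OF H(1)]]
      have Q: "continuous_map (top_of_set ({0..1} \<times> {0..1})) G ?Q" by (simp add: comp_def)
      \<comment> \<open>Since \<open>u\<close> is a loop, both tracks in the square are
        \<open>c\<close>, and its two boundary routes express conjugation by
        \<open>c\<close>.\<close>
      have sq: "phtpy G (Inl x0) (Inl x0) (pconcat (F p \<circ> ep x0 u) c) (pconcat c (ep x0 u))"
        using phtpy_square[OF Q] u by (simp add: H(2,3) c_def[abs_def] F_def comp_def)
      have em: "phtpy G (Inl x0) (Inl x0) (F p \<circ> ep x0 u) (ep x0 (sub ?P u))"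
        unfolding F_def
        by (rule phtpy_edge_map_epath[OF u]) (use wpath_pg wpath_letters[OF u] x0 in auto)
      have Pu: "wp x0 (sub ?P u) x0"
        by (rule wpath_sub[OF u]) (use wpath_pg wpath_letters[OF u] in auto)
      have eu: "phtpy G (Inl x0) (Inl x0) (ep x0 u) (ep x0 u)"
        using phtpy_refl[OF pathin_epath[OF u x0]] u by simp
      have "phtpy G (Inl x0) (Inl x0) (ep x0 (sub ?P u @ w)) (pconcat (ep x0 (sub ?P u)) (ep x0 w))"
        by (rule phtpy_epath_append[OF Pu w(1) x0])
      also have "phtpy G (Inl x0) (Inl x0) \<dots> (pconcat (F p \<circ> ep x0 u) c)"
        by (rule phtpy_pconcat[OF phtpy_sym[OF em] phtpy_sym[OF w(2)]])
      also note sq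
      also have "phtpy G (Inl x0) (Inl x0) (pconcat c (ep x0 u)) (pconcat (ep x0 w) (ep x0 u))"
        by (rule phtpy_pconcat[OF w(2) eu])
      also have "phtpy G (Inl x0) (Inl x0) \<dots> (ep x0 (w @ u))"
        by (rule phtpy_sym[OF phtpy_epath_append[OF w(1) u x0]])
      finally show "feq (sub ?P u @ w) (w @ u)"
        by (rule homotopic_epath_imp_feq[OF wpath_appendI[OF Pu w(1)] wpath_appendI[OF w(1) u] x0])
    qed
    then show "p = \<one>\<^bsub>?W\<^esub>" unfolding one by (simp add: prod_eq_iff)
  qed
qed

subsection \<open>Automorphisms of free groups\<close>

lemma free_group_simps:
  "w \<in> carrier (free_group n) \<longleftrightarrow> fred w = w \<and> fst ` set w \<subseteq> {..<n}"
  "v \<otimes>\<^bsub>free_group n\<^esub> w = fred (v @ w)" "\<one>\<^bsub>free_group n\<^esub> = []"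
  by (auto simp: free_group_def freduce_eq_fred)

lemma group_free_group: "group (free_group n)"
proof (rule groupI)
  fix u v w :: "(nat \<times> bool) list"
  assume uvw: "u \<in> carrier (free_group n)" "v \<in> carrier (free_group n)" "w \<in> carrier (free_group n)"
  show "u \<otimes>\<^bsub>free_group n\<^esub> v \<in> carrier (free_group n)"
  proof -
    have "fst ` set (fred (u @ v)) \<subseteq> {..<n}"
      by (rule order_trans[OF letters_fred]) (use uvw in \<open>simp add: free_group_simps(1) image_Un\<close>)
    then show ?thesis by (simp add: free_group_simps)
  qed
  have "feq (fred (u @ v) @ w) (u @ fred (v @ w))"
    using feq_trans[OF feq_append[OF feq_fred(1)[of "u @ v"] feq_refl[of w]]]
      feq_append[OF feq_refl[of u] feq_fred(2)[of "v @ w"]] by simp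
  then show "u \<otimes>\<^bsub>free_group n\<^esub> v \<otimes>\<^bsub>free_group n\<^esub> w = u \<otimes>\<^bsub>free_group n\<^esub> (v \<otimes>\<^bsub>free_group n\<^esub> w)"
    by (simp add: free_group_simps feq_def)
  show "\<one>\<^bsub>free_group n\<^esub> \<otimes>\<^bsub>free_group n\<^esub> u = u" using uvw by (simp add: free_group_simps)
  have "fred (winv u) \<in> carrier (free_group n)"
    using uvw letters_fred[of "winv u"] by (auto simp: free_group_simps)
  moreover have "fred (fred (winv u) @ u) = []"
    using feq_trans[OF feq_append[OF feq_fred(1)[of "winv u"] feq_refl[of u]] feq_winv_left] by (simp add: feq_def)
  ultimately show "\<exists>y\<in>carrier (free_group n). y \<otimes>\<^bsub>free_group n\<^esub> u = \<one>\<^bsub>free_group n\<^esub>"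
    by (auto simp: free_group_simps)
qed (simp add: free_group_simps)

lemma AutoGroup_simps:
  "carrier (AutoGroup G) = hom G G \<inter> Bij (carrier G)"
  "a \<in> Bij (carrier G) \<Longrightarrow> b \<in> Bij (carrier G) \<Longrightarrow> a \<otimes>\<^bsub>AutoGroup G\<^esub> b = compose (carrier G) a b"
  "\<one>\<^bsub>AutoGroup G\<^esub> = (\<lambda>x\<in>carrier G. x)"
  by (simp_all add: AutoGroup_def auto_def BijGroup_def)

text \<open>An extra fixed letter \<open>n\<close> is added so that for \<open>n = 0\<close> the shift still acts nontrivially.\<close>
definition aut_word :: "nat \<Rightarrow> ((nat \<times> bool) list \<Rightarrow> (nat \<times> bool) list) \<Rightarrow> nat \<Rightarrow> (nat \<times> bool) list" where
  "aut_word n a i = (if i < n then a [(i, False)] else [(i, False)])"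

lemma single_in_free_group: "i < n \<Longrightarrow> [(i, b)] \<in> carrier (free_group n)"
  by (simp add: free_group_simps push_def)

text \<open>A homomorphism is determined by its values on positive letters; as \<open>x # w\<close>
  is reduced, it is the product of \<open>[x]\<close> and \<open>w\<close> in the group.\<close>

lemma hom_free_group_word:
  assumes a: "a \<in> hom (free_group n) (free_group n)" and w: "w \<in> carrier (free_group n)"
  shows "feq (a w) (sub (aut_word n a) w)"
proof -
  interpret F: group "free_group n" by (rule group_free_group)
  have a_mult: "a (fred (u @ v)) = fred (a u @ a v)" if "u \<in> carrier (free_group n)" "v \<in> carrier (free_group n)" for u v
    using hom_mult[OF a that] by (simp add: free_group_simps)
  have a_one: "a [] = []"
    using hom_one[OF a F.is_group F.is_group] by (simp add: free_group_simps)
  have letter: "feq (a [x]) (if snd x then winv (aut_word n a (fst x)) else aut_word n a (fst x))" if "fst x < n" for x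
  proof (cases "snd x")
    case True
    let ?i = "fst x"
    have x: "x = (?i, True)" using True by (simp add: prod_eq_iff)
    \<comment> \<open>The value on an inverse letter is forced because its product with the positive
      letter is trivial.\<close>
    have "a (fred ([(?i, True)] @ [(?i, False)])) = fred (a [(?i, True)] @ a [(?i, False)])"
      using that by (intro a_mult single_in_free_group)
    then have *: "feq (a [(?i, True)] @ a [(?i, False)]) []"
      by (simp add: feq_def push_def linv_def a_one)
    have "feq (a [(?i, True)]) (a [(?i, True)] @ a [(?i, False)] @ winv (a [(?i, False)]))"
      using feq_sym[OF feq_cancel_winv[of "a [(?i, True)]" "a [(?i, False)]" "[]"]] by simp
    also have "feq \<dots> ([] @ winv (a [(?i, False)]))"
      using feq_append[OF * feq_refl[of "winv (a [(?i, False)])"]] by simp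
    finally show ?thesis using that True x by (simp add: aut_word_def)
  next
    case False
    then have "x = (fst x, False)" by (simp add: prod_eq_iff)
    then show ?thesis using that False by (simp add: aut_word_def)
  qed
  show ?thesis
    using w
  proof (induction w)
    case (Cons x w)
    have red: "isred (x # w)" using Cons.prems isred_fred[of "x # w"] by (simp only: free_group_simps)
    then have "isred w" by (auto simp: successively_Cons)
    then have wc: "w \<in> carrier (free_group n)" using Cons.prems by (simp add: free_group_simps(1) fred_id)
    have xn: "fst x < n" using Cons.prems by (simp add: free_group_simps(1))
    have "a (x # w) = a (fred ([x] @ w))" using fred_id[OF red] by simp
    also have "\<dots> = fred (a [x] @ a w)"
      using single_in_free_group[OF xn, of "snd x"] by (intro a_mult wc) simp
    also have "feq \<dots> (a [x] @ a w)" by simp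
    also have "feq \<dots> (sub (aut_word n a) (x # w))"
      unfolding sub_simps(3) by (intro feq_append letter[OF xn] Cons.IH[OF wc])
    finally show ?case .
  qed (simp add: a_one)
qed

lemma letter_action_Aut: "letter_action (AutoGroup (free_group n)) (Suc n) (aut_word n)"
proof -
  let ?F = "free_group n"
  have A: "group (AutoGroup ?F)" by (rule group.AutoGroup[OF group_free_group])
  have a_in: "a w \<in> carrier ?F" if "a \<in> carrier (AutoGroup ?F)" "w \<in> carrier ?F" for a w
    using that by (auto simp: AutoGroup_simps hom_def)
  show ?thesis
  proof (intro letter_action.intro[OF A] letter_action_axioms.intro)
    fix a i assume a: "a \<in> carrier (AutoGroup ?F)" and i: "i < Suc n"
    show "fst ` set (aut_word n a i) \<subseteq> {..<Suc n}"
    proof (cases "i < n")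
      case True
      then have "fst ` set (aut_word n a i) \<subseteq> {..<n}"
        using a_in[OF a single_in_free_group[OF True, of False]] by (simp add: aut_word_def free_group_simps(1))
      then show ?thesis by (rule subset_trans) auto
    qed (use i in \<open>simp add: aut_word_def\<close>)
  next
    fix a b i assume a: "a \<in> carrier (AutoGroup ?F)" and b: "b \<in> carrier (AutoGroup ?F)" and i: "i < Suc n"
    show "feq (sub (aut_word n a) (aut_word n b i)) (aut_word n (a \<otimes>\<^bsub>AutoGroup ?F\<^esub> b) i)"
    proof (cases "i < n")
      case True
      then have "(a \<otimes>\<^bsub>AutoGroup ?F\<^esub> b) [(i, False)] = a (b [(i, False)])"
        using a b single_in_free_group[OF True] by (simp add: AutoGroup_simps compose_def)
      then show ?thesis
        using hom_free_group_word[OF _ a_in[OF b single_in_free_group[OF True]], of a False] a True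
        by (simp add: aut_word_def AutoGroup_simps(1) feq_sym)
    qed (simp add: aut_word_def)
  next
    fix i assume "i < Suc n"
    then show "aut_word n \<one>\<^bsub>AutoGroup ?F\<^esub> i = [(i, False)]"
      using single_in_free_group[of i n False] by (simp add: aut_word_def AutoGroup_simps)
  next
    fix a assume a: "a \<in> carrier (AutoGroup ?F)" and fix_letters: "\<And>i. i < Suc n \<Longrightarrow> feq (aut_word n a i) [(i, False)]"
    have "a w = w" if w: "w \<in> carrier ?F" for w
    proof -
      have "feq (a w) (sub (aut_word n a) w)"
        by (rule hom_free_group_word[OF _ w]) (use a in \<open>simp add: AutoGroup_simps\<close>)
      also have "feq \<dots> (sub (\<lambda>x. [(x, False)]) w)"
        using w fix_letters by (intro feq_sub_cong) (auto simp: free_group_simps(1))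
      also have "\<dots> = w" by (rule sub_single)
      finally show "a w = w" using a_in[OF a w] w by (simp add: feq_def free_group_simps(1))
    qed
    \<comment> \<open>Elements of \<open>AutoGroup\<close> are extensional functions, so agreement
      with the identity on the carrier suffices.\<close>
    moreover have "a \<in> extensional (carrier ?F)" using a by (simp add: AutoGroup_simps Bij_def)
    ultimately show "a = \<one>\<^bsub>AutoGroup ?F\<^esub>"
      by (auto simp: AutoGroup_simps extensional_def restrict_def fun_eq_iff)
  qed simp
qed

subsection \<open>The infinite cyclic group of transvections\<close>

definition pow_word :: "int \<Rightarrow> (nat \<times> bool) list" where
  "pow_word k = replicate (nat \<bar>k\<bar>) (1, k < 0)"

text \<open>A Nielsen transvection with exponent \<open>k\<close>. In rank two these realize the
  integers faithfully by automorphisms, whereas rank one offers only the inversion.\<close>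

definition transvection_word :: "int \<Rightarrow> nat \<Rightarrow> (nat \<times> bool) list" where
  "transvection_word k i = (if i = 0 then (0, False) # pow_word k else [(i, False)])"

lemma feq_pow_word_Suc: "feq ((1, False) # pow_word k) (pow_word (k + 1))"
proof (cases "k \<ge> 0")
  case True
  then have "nat \<bar>k + 1\<bar> = Suc (nat \<bar>k\<bar>)" by simp
  with True show ?thesis by (simp add: pow_word_def)
next
  case False
  then have k: "nat \<bar>k\<bar> = Suc (nat \<bar>k + 1\<bar>)" by simp
  \<comment> \<open>At \<open>k = -1\<close> the direction flag of \<open>pow_word (k + 1)\<close>
    changes, but that word is empty.\<close>
  have "pow_word k = (1, True) # pow_word (k + 1)"
  proof (cases "k = -1")
    case True
    then show ?thesis by (simp add: pow_word_def)
  next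
    case False
    then show ?thesis using \<open>\<not> k \<ge> 0\<close> k by (simp add: pow_word_def)
  qed
  then show ?thesis using feq_cancel2[of "[]" "(1, False)" "pow_word (k + 1)"] by (simp add: linv_def)
qed

lemma feq_pow_word_pred: "feq ((1, True) # pow_word k) (pow_word (k - 1))"
proof -
  have "feq ((1, True) # pow_word k) ([(1, True)] @ ((1, False) # pow_word (k - 1)))"
    using feq_append[OF feq_refl[of "[(1, True)]"] feq_sym[OF feq_pow_word_Suc[of "k - 1"]]] by simp
  also have "feq \<dots> (pow_word (k - 1))"
    using feq_cancel2[of "[]" "(1, True)" "pow_word (k - 1)"] by (simp add: linv_def)
  finally show ?thesis .
qed

lemma feq_pow_word_add: "feq (pow_word k @ pow_word l) (pow_word (k + l))"
proof (induction k rule: int_induct[where k = 0])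
  case base
  show ?case by (simp add: pow_word_def)
next
  case (step1 i)
  have "feq (pow_word (i + 1) @ pow_word l) (((1, False) # pow_word i) @ pow_word l)"
    by (intro feq_append feq_refl feq_sym[OF feq_pow_word_Suc])
  also have "feq \<dots> ([(1, False)] @ pow_word (i + l))"
    using feq_append[OF feq_refl[of "[(1, False)]"] step1(2)] by simp
  also have "feq \<dots> (pow_word (i + l + 1))" using feq_pow_word_Suc by simp
  finally show ?case by (simp add: algebra_simps)
next
  case (step2 i)
  have "feq (pow_word (i - 1) @ pow_word l) (((1, True) # pow_word i) @ pow_word l)"
    by (intro feq_append feq_refl feq_sym[OF feq_pow_word_pred])
  also have "feq \<dots> ([(1, True)] @ pow_word (i + l))"
    using feq_append[OF feq_refl[of "[(1, True)]"] step2(2)] by simp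
  also have "feq \<dots> (pow_word (i + l - 1))" using feq_pow_word_pred by simp
  finally show ?case by (simp add: algebra_simps)
qed

lemma isred_replicate: "isred (replicate k a)"
  by (induction k) (auto simp: successively_Cons)

text \<open>Letter 1 is fixed, so the exponents of two transvections add; faithfulness follows by
  cancelling letter 0 on the left.\<close>

lemma letter_action_int: "letter_action integer_group 2 transvection_word"
proof (intro letter_action.intro letter_action_axioms.intro)
  show "group integer_group" by simp
  fix i :: nat assume i: "i < 2"
  then have i01: "i = 0 \<or> i = 1" by auto
  show "transvection_word \<one>\<^bsub>integer_group\<^esub> i = [(i, False)]"
    by (simp add: transvection_word_def pow_word_def)
  fix a :: int
  show "fst ` set (transvection_word a i) \<subseteq> {..<2}"
    using i01 by (auto simp: transvection_word_def pow_word_def)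
  fix b :: int
  have "sub (transvection_word a) (pow_word b) = sub (\<lambda>x. [(x, False)]) (pow_word b)"
    by (rule sub_cong) (auto simp: pow_word_def transvection_word_def)
  then have "sub (transvection_word a) (pow_word b) = pow_word b" by (simp add: sub_single)
  then have "sub (transvection_word a) (transvection_word b 0) = [(0, False)] @ pow_word a @ pow_word b"
    by (simp add: transvection_word_def)
  also have "feq \<dots> ([(0, False)] @ pow_word (a + b))"
    by (intro feq_append feq_refl feq_pow_word_add)
  finally show "feq (sub (transvection_word a) (transvection_word b i)) (transvection_word (a \<otimes>\<^bsub>integer_group\<^esub> b) i)"
    using i01 by (auto simp: transvection_word_def)
next
  fix a :: int assume "\<And>i. i < 2 \<Longrightarrow> feq (transvection_word a i) [(i, False)]"
  from this[of 0] have "feq ([(0, False)] @ pow_word a) [(0, False)]" by (simp add: transvection_word_def)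
  from feq_append[OF feq_refl[of "[(0, True)]"] this]
  have 1: "feq ((0, True) # linv (0, True) # pow_word a) ((0, True) # linv (0, True) # [])" by (simp add: linv_def)
  have "feq (pow_word a) ((0, True) # linv (0, True) # pow_word a)"
    using feq_sym[OF feq_cancel2[of "[]" "(0, True)" "pow_word a"]] by simp
  also note 1
  also have "feq ((0, True) # linv (0, True) # []) []"
    using feq_cancel2[of "[]" "(0, True)" "[]"] by simp
  finally have "feq (pow_word a) []" .
  moreover have "isred (pow_word a)" unfolding pow_word_def by (rule isred_replicate)
  ultimately have "pow_word a = []" by (simp add: feq_def fred_id)
  then show "a = \<one>\<^bsub>integer_group\<^esub>" by (simp add: pow_word_def)
qed simp

theorem mainTheorem15:
  fixes V :: "'v set" and Ed :: "'e set" and src tgt :: "'e \<Rightarrow> 'v" and x0 :: 'v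
  assumes "is_graph V Ed src tgt"
    and "locally_finite_graph V Ed src tgt"
    and "connected_space (graph_top V Ed src tgt)"
    and "x0 \<in> V"
    and "infinite_rank (fundamental_group (graph_top V Ed src tgt) (Inl x0))"
  shows "(\<forall>n::nat. \<exists>H. subgroup H (PMapGrp (graph_top V Ed src tgt)) \<and>
            (PMapGrp (graph_top V Ed src tgt)) \<lparr>carrier := H\<rparr> \<cong> wreathZ (AutoGroup (free_group n)))
       \<and> (\<exists>H. subgroup H (PMapGrp (graph_top V Ed src tgt)) \<and>
            (PMapGrp (graph_top V Ed src tgt)) \<lparr>carrier := H\<rparr> \<cong> wreathZ integer_group)"
  using wreath_embeds[OF assms letter_action_Aut] wreath_embeds[OF assms letter_action_int] by blast

end
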